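(* Let $n\ge1$. For every $\lambda>2n-1$, the $C^*$-algebras $\mathcal{T}^{(\lambda)}(L^\infty(\mathrm{D}^{\mathrm{I}}_{n\times n})^{\mathrm{U}(n)_L})$ and $\mathcal{T}^{(\lambda)}(L^\infty(\mathrm{D}^{\mathrm{I}}_{n\times n})^{\mathrm{U}(n)_R})$ centralize each other. More precisely, we have $ST=TS$ for every $S\in\mathcal{T}^{(\lambda)}(L^\infty(\mathrm{D}^{\mathrm{I}}_{n\times n})^{\mathrm{U}(n)_L})$ and $T\in\mathcal{T}^{(\lambda)}(L^\infty(\mathrm{D}^{\mathrm{I}}_{n\times n})^{\mathrm{U}(n)_R})$.
   Context: $\mathrm{D}^{\mathrm{I}}_{n\times n}=\{Z\in M_{n\times n}(\mathbb{C}): Z^*Z<I_n\}$. For $\lambda>2n-1$, $dv_\lambda(Z)=c_\lambda\det(I_n-ZZ^* )^{\lambda-2n}dv(Z)$, with $dv$ Lebesgue measure and $c_\lambda>0$ such that $v_\lambda(\mathrm{D}^{\mathrm{I}}_{n\times n})=1$. $\mathcal{A}^2_\lambda(\mathrm{D}^{\mathrm{I}}_{n\times n})$ is the weighted Bergman space of holomorphic functions in $L^2(\mathrm{D}^{\mathrm{I}}_{n\times n},v_\lambda)$, with orthogonal projection $B_\lambda$ from $L^2(\mathrm{D}^{\mathrm{I}}_{n\times n},v_\lambda)$. For $a\in L^\infty(\mathrm{D}^{\mathrm{I}}_{n\times n})$ (a symbol; functions equal a.e. are identified), $T^{(\lambda)}_a(f)=B_\lambda(af)$. For a set $\mathcal{S}$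 of symbols, $\mathcal{T}^{(\lambda)}(\mathcal{S})$ is the unital Banach algebra (norm-closed algebra of operators on $\mathcal{A}^2_\lambda(\mathrm{D}^{\mathrm{I}}_{n\times n})$) generated by the $T^{(\lambda)}_a$, $a\in\mathcal{S}$. $L^\infty(\mathrm{D}^{\mathrm{I}}_{n\times n})^{\mathrm{U}(n)_L}$ is the space of symbols with $a(UZ)=a(Z)$ for every $U\in\mathrm{U}(n)$, and $L^\infty(\mathrm{D}^{\mathrm{I}}_{n\times n})^{\mathrm{U}(n)_R}$ the space of symbols with $a(ZV)=a(Z)$ for every $V\in\mathrm{U}(n)$; being conjugation invariant, they yield $C^*$-algebras. *)

theory Defs
  imports "HOL-Analysis.Analysis" "HOL-Library.FuncSet"
begin

type_synonym 'n cmat = "complex ^ 'n ^ 'n"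

definition ctransp :: "'n::finite cmat \<Rightarrow> 'n cmat" where
  "ctransp A = (\<chi> i j. cnj (A $ j $ i))"

definition unitary_group :: "'n::finite cmat set" where
  "unitary_group = {U. ctransp U ** U = mat 1 \<and> U ** ctransp U = mat 1}"

definition pos_definite :: "'n::finite cmat \<Rightarrow> bool" where
  "pos_definite A \<longleftrightarrow> ctransp A = A \<and>
     (\<forall>x. x \<noteq> 0 \<longrightarrow> 0 < Re (\<Sum>i\<in>UNIV. cnj (x $ i) * (A *v x) $ i))"

definition loewner_less :: "'n::finite cmat \<Rightarrow> 'n cmat \<Rightarrow> bool" where
  "loewner_less A B \<longleftrightarrow> pos_definite (B - A)"

definition cartan_domain :: "'n::finite cmat set" where
  "cartan_domain = {Z. loewner_less (ctransp Z ** Z) (mat 1)}"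


(* The determinant is a positive real on the domain, so taking Re loses nothing there. *)
definition scaled_measure :: "real \<Rightarrow> real \<Rightarrow> 'n::finite cmat measure" where
  "scaled_measure lam c = density (lebesgue_on cartan_domain)
     (\<lambda>Z. ennreal (c * Re (det (mat 1 - Z ** ctransp Z)) powr (lam - 2 * real CARD('n))))"

definition norm_const :: "'n::finite itself \<Rightarrow> real \<Rightarrow> real" where
  "norm_const _ lam = (THE c. 0 < c \<and>
     emeasure (scaled_measure lam c :: 'n cmat measure) cartan_domain = 1)"

definition v_measure :: "real \<Rightarrow> 'n::finite cmat measure" where
  "v_measure lam = scaled_measure lam (norm_const TYPE('n) lam)"


(* Holomorphy in several variables: complex Frechet differentiability, i.e. the real
   derivative exists and commutes with multiplication by complex scalars. *)
definition holomorphic_mat :: "('n::finite cmat \<Rightarrow> complex) \<Rightarrow> 'n cmat set \<Rightarrow> bool" where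
  "holomorphic_mat f S \<longleftrightarrow> (\<forall>Z\<in>S. \<exists>f'. (f has_derivative f') (at Z within S) \<and>
     (\<forall>c H. f' (\<chi> i j. c * H $ i $ j) = c * f' H))"

definition L2_space :: "real \<Rightarrow> ('n::finite cmat \<Rightarrow> complex) set" where
  "L2_space lam = {f. f \<in> borel_measurable (v_measure lam) \<and>
     integrable (v_measure lam) (\<lambda>Z. (cmod (f Z))\<^sup>2)}"

definition L2_inner ::
  "real \<Rightarrow> ('n::finite cmat \<Rightarrow> complex) \<Rightarrow> ('n cmat \<Rightarrow> complex) \<Rightarrow> complex" where
  "L2_inner lam f g = (\<integral>Z. f Z * cnj (g Z) \<partial>v_measure lam)"

definition L2_norm :: "real \<Rightarrow> ('n::finite cmat \<Rightarrow> complex) \<Rightarrow> real" where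
  "L2_norm lam f = sqrt (\<integral>Z. (cmod (f Z))\<^sup>2 \<partial>v_measure lam)"

(* Functions on the domain are represented by total functions.  Bergman functions are set to 0
   off the domain, so that equality of elements is equality of functions. *)
definition bergman_space :: "real \<Rightarrow> ('n::finite cmat \<Rightarrow> complex) set" where
  "bergman_space lam = {f \<in> L2_space lam. holomorphic_mat f cartan_domain \<and>
     (\<forall>Z. Z \<notin> cartan_domain \<longrightarrow> f Z = 0)}"

definition bergman_proj ::
  "real \<Rightarrow> ('n::finite cmat \<Rightarrow> complex) \<Rightarrow> ('n cmat \<Rightarrow> complex)" where
  "bergman_proj lam g = (THE h. h \<in> bergman_space lam \<and>
     (\<forall>f\<in>bergman_space lam. L2_inner lam (\<lambda>Z. g Z - h Z) f = 0))"


(* Operators on the Bergman space are functions that are undefined off bergman_space lam. *)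
type_synonym 'n operator = "('n cmat \<Rightarrow> complex) \<Rightarrow> ('n cmat \<Rightarrow> complex)"

definition bounded_ops :: "real \<Rightarrow> 'n::finite operator set" where
  "bounded_ops lam = {T \<in> bergman_space lam \<rightarrow>\<^sub>E bergman_space lam.
     (\<forall>f\<in>bergman_space lam. \<forall>g\<in>bergman_space lam.
        T (\<lambda>Z. f Z + g Z) = (\<lambda>Z. T f Z + T g Z)) \<and>
     (\<forall>c. \<forall>f\<in>bergman_space lam. T (\<lambda>Z. c * f Z) = (\<lambda>Z. c * T f Z)) \<and>
     (\<exists>C. \<forall>f\<in>bergman_space lam. L2_norm lam (T f) \<le> C * L2_norm lam f)}"

definition op_norm :: "real \<Rightarrow> 'n::finite operator \<Rightarrow> real" where
  "op_norm lam T = (SUP f\<in>{f \<in> bergman_space lam. L2_norm lam f \<le> 1}. L2_norm lam (T f))"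

definition op_id :: "real \<Rightarrow> 'n::finite operator" where
  "op_id lam = (\<lambda>f\<in>bergman_space lam. f)"

definition op_add :: "real \<Rightarrow> 'n::finite operator \<Rightarrow> 'n operator \<Rightarrow> 'n operator" where
  "op_add lam S T = (\<lambda>f\<in>bergman_space lam. \<lambda>Z. S f Z + T f Z)"

definition op_scale :: "real \<Rightarrow> complex \<Rightarrow> 'n::finite operator \<Rightarrow> 'n operator" where
  "op_scale lam c T = (\<lambda>f\<in>bergman_space lam. \<lambda>Z. c * T f Z)"

definition op_diff :: "real \<Rightarrow> 'n::finite operator \<Rightarrow> 'n operator \<Rightarrow> 'n operator" where
  "op_diff lam S T = (\<lambda>f\<in>bergman_space lam. \<lambda>Z. S f Z - T f Z)"

definition op_mult :: "real \<Rightarrow> 'n::finite operator \<Rightarrow> 'n operator \<Rightarrow> 'n operator" where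
  "op_mult lam S T = compose (bergman_space lam) S T"

definition unital_banach_algebra :: "real \<Rightarrow> 'n::finite operator set \<Rightarrow> bool" where
  "unital_banach_algebra lam A \<longleftrightarrow> A \<subseteq> bounded_ops lam \<and> op_id lam \<in> A \<and>
     (\<forall>S\<in>A. \<forall>T\<in>A. op_add lam S T \<in> A \<and> op_mult lam S T \<in> A) \<and>
     (\<forall>c. \<forall>T\<in>A. op_scale lam c T \<in> A) \<and>
     (\<forall>X. \<forall>T\<in>bounded_ops lam. (\<forall>k::nat. X k \<in> A) \<longrightarrow>
        (\<lambda>k. op_norm lam (op_diff lam (X k) T)) \<longlonglongrightarrow> 0 \<longrightarrow> T \<in> A)"


definition Linf_space :: "('n::finite cmat \<Rightarrow> complex) set" where
  "Linf_space = {a. a \<in> borel_measurable (lebesgue_on cartan_domain) \<and>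
     (\<exists>C. AE Z in lebesgue_on cartan_domain. cmod (a Z) \<le> C)}"

(* Symbols are classes of functions modulo null sets, so for each unitary matrix the invariance
   is an identity almost everywhere. *)
definition left_invariant_symbols :: "('n::finite cmat \<Rightarrow> complex) set" where
  "left_invariant_symbols = {a \<in> Linf_space.
     \<forall>U\<in>unitary_group. AE Z in lebesgue_on cartan_domain. a (U ** Z) = a Z}"

definition right_invariant_symbols :: "('n::finite cmat \<Rightarrow> complex) set" where
  "right_invariant_symbols = {a \<in> Linf_space.
     \<forall>V\<in>unitary_group. AE Z in lebesgue_on cartan_domain. a (Z ** V) = a Z}"

definition toeplitz :: "real \<Rightarrow> ('n::finite cmat \<Rightarrow> complex) \<Rightarrow> 'n operator" where
  "toeplitz lam a = (\<lambda>f\<in>bergman_space lam. bergman_proj lam (\<lambda>Z. a Z * f Z))"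

definition toeplitz_algebra ::
  "real \<Rightarrow> ('n::finite cmat \<Rightarrow> complex) set \<Rightarrow> 'n operator set" where
  "toeplitz_algebra lam \<S> = unital_banach_algebra lam hull (toeplitz lam ` \<S>)"

end

theory Submission
  imports Defs "HOL-Complex_Analysis.Complex_Analysis"
begin

text \<open>
  A Toeplitz operator whose symbol is invariant under left multiplication by unitary matrices commutes
  with all left translations \<open>f \<mapsto> f (U \<cdot>)\<close> of the Bergman space, and similarly on the right.  Left and right
  translations commute with each other, and each family generates the commutant of the other; this is
  why operators of the two kinds commute.  The proof makes this concrete without decomposing the
  Bergman space into irreducible representations.

  Let \<open>p\<close> be a Bergman function that is homogeneous of degree \<open>k\<close>.  It extends to an entire function.  If \<open>S\<close>
  commutes with left translations, then \<open>(S p)(U/2)\<close> is the value at the point \<open>1/2\<close> of \<open>S\<close> applied to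
  \<open>p (U \<cdot>)\<close>, and for a Toeplitz operator this value is an integral \<open>\<integral> p(U W) \<alpha>(W) dv(W)\<close> with a function \<open>\<alpha>\<close>
  that does not depend on \<open>p\<close>.  Both sides are holomorphic and homogeneous in \<open>U\<close>, and a homogeneous entire function
  that vanishes on the unitary group vanishes identically (\<open>homogeneous_zero_on_unitary\<close>, by the
  Cayley transform).  So the formula holds with an arbitrary matrix \<open>Y\<close> in place of \<open>U\<close>
  (\<open>toeplitz_representation\<close>).  An operator \<open>R\<close> that commutes with right translations is given in the same way
  by \<open>\<integral> p(X Y) \<beta>(X) dv(X)\<close>.  Composing the two formulas in either order produces the double integral of
  \<open>p(X Y W) \<beta>(X) \<alpha>(W)\<close>, and Fubini's theorem shows that \<open>S\<close> and \<open>R\<close> commute on \<open>p\<close> (\<open>commute_on_Hom\<close>).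

  The adjoint of a Toeplitz operator is the Toeplitz operator of the conjugate symbol, which has the same
  invariance.  Hence the commutator of two Toeplitz operators maps every Bergman function to one that is orthogonal to
  all homogeneous functions, and such a function is zero because the homogeneous parts of a function are averages over
  the circle of its rotations (\<open>homogeneous_dense\<close>, \<open>toeplitz_commute\<close>).  The passage to the generated
  algebras is formal: the commutant of a set of bounded operators is a unital Banach algebra
  (\<open>commutant_algebra\<close>), so it contains the algebra generated by any of its subsets.

  Two facts have to be established before any of this makes sense.  The weight \<open>det(1 - Z Z\<^sup>*)\<^sup>\<mu>\<close> has a
  finite integral for every \<open>\<mu> > -1\<close> (\<open>weight_integrable\<close>), so that the normalising constant exists in the
  whole range of the parameter.  And convergence in the norm implies locally uniform convergence
  (\<open>evaluation_bound\<close>), so that the Bergman space is complete and the orthogonal projection exists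
  (\<open>H_complete\<close>, \<open>projection_exists\<close>).
\<close>

no_notation fps_nth (infixl "$" 75)


section \<open>Matrices and the domain\<close>

text \<open>Complex scalars acting on matrices; \<open>scaleR\<close> covers only the real ones (\<open>csc_of_real\<close>).\<close>

definition csc :: "complex \<Rightarrow> 'n::finite cmat \<Rightarrow> 'n cmat" where
  "csc c Z = (\<chi> i j. c * Z $ i $ j)"

lemma csc_nth [simp]: "csc c Z $ i $ j = c * Z $ i $ j"
  by (simp add: csc_def)

lemma csc_simps [simp]: "csc 1 Z = Z" "csc 0 Z = 0" "csc c 0 = 0" "csc a (csc b Z) = csc (a * b) Z"
  by (simp_all add: vec_eq_iff)

lemma csc_of_real: "csc (of_real r) Z = r *\<^sub>R Z"
  by (simp add: vec_eq_iff) (simp add: scaleR_conv_of_real)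

lemma csc_add: "csc c (Y + Z) = csc c Y + csc c Z" "csc (a + b) Z = csc a Z + csc b Z"
  by (simp_all add: vec_eq_iff algebra_simps)

lemma csc_mult: "csc c Y ** Z = csc c (Y ** Z)" "Y ** csc c Z = csc c (Y ** Z)"
  by (simp_all add: vec_eq_iff matrix_matrix_mult_def sum_distrib_left mult_ac)

lemma csc_matvec: "csc c Z *v x = c *s (Z *v x)"
  by (simp add: vec_eq_iff matrix_vector_mult_def sum_distrib_left mult_ac)

lemma norm_cvec_scale: "norm (c *s x) = cmod c * norm (x :: complex ^ 'n::finite)"
  by (simp add: norm_vec_def norm_mult L2_set_right_distrib)

lemma norm_csc [simp]: "norm (csc c Z) = cmod c * norm Z"
proof -
  have "csc c Z $ i = c *s Z $ i" for i
    by (simp add: vec_eq_iff)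
  then show ?thesis
    by (simp add: norm_vec_def[of "csc c Z"] norm_vec_def[of Z] norm_cvec_scale L2_set_right_distrib)
qed

lemma bounded_linear_csc: "bounded_linear (csc c)"
  by (rule bounded_linear_intro[where K="cmod c"]) (auto simp: csc_add vec_eq_iff algebra_simps)

lemma inner_cvec: "x \<bullet> y = Re (\<Sum>i\<in>UNIV. cnj (x $ i) * y $ i)" for x y :: "complex ^ 'n::finite"
  by (simp add: inner_vec_def inner_complex_def)

lemma ctransp_nth [simp]: "ctransp A $ i $ j = cnj (A $ j $ i)"
  by (simp add: ctransp_def)

lemma inner_matvec: "x \<bullet> (A *v y) = (ctransp A *v x) \<bullet> y" for x y :: "complex ^ 'n::finite"
proof -
  have "(\<Sum>i\<in>UNIV. \<Sum>j\<in>UNIV. cnj (x $ i) * (A $ i $ j * y $ j)) =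
        (\<Sum>j\<in>UNIV. \<Sum>i\<in>UNIV. cnj (x $ i) * (A $ i $ j * y $ j))"
    by (rule sum.swap)
  then show ?thesis
    by (simp add: inner_cvec matrix_vector_mult_def sum_distrib_left sum_distrib_right mult_ac)
qed

lemma ctransp_simps [simp]: "ctransp (ctransp A) = A" "ctransp (mat 1) = mat 1"
  "ctransp (A ** B) = ctransp B ** ctransp A" "ctransp (A - B) = ctransp A - ctransp B"
  by (auto simp: vec_eq_iff matrix_matrix_mult_def mat_def mult_ac)

lemma matmul_diff_distrib: "(A - B) ** C = A ** C - B ** C" "C ** (A - B) = C ** A - C ** B"
  for A B C :: "'n::finite cmat"
  by (simp_all add: vec_eq_iff matrix_matrix_mult_def algebra_simps sum_subtractf)

lemma ctransp_csc: "ctransp (csc c A) = csc (cnj c) (ctransp A)"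
  by (simp add: vec_eq_iff)

lemma det_ctransp: "det (ctransp A) = cnj (det A)"
proof -
  have "ctransp A = transpose (\<chi> i j. cnj (A $ i $ j))"
    by (simp add: vec_eq_iff transpose_def)
  then have "det (ctransp A) = det (\<chi> i j. cnj (A $ i $ j))"
    by simp
  also have "\<dots> = cnj (det A)"
    by (simp add: det_def)
  finally show ?thesis .
qed

text \<open>The norm on matrices is the Frobenius norm, which dominates the operator norm.\<close>

lemma norm_matvec_le: "norm (A *v x) \<le> norm A * norm x" for x :: "complex ^ 'n::finite"
proof -
  have "norm ((A *v x) $ i) \<le> norm (A $ i) * norm x" for i
  proof -
    have "norm ((A *v x) $ i) \<le> (\<Sum>j\<in>UNIV. \<bar>norm (A $ i $ j)\<bar> * \<bar>norm (x $ j)\<bar>)"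
      unfolding matrix_vector_mult_def by (simp, rule order_trans[OF norm_sum]) (simp add: norm_mult)
    also have "\<dots> \<le> norm (A $ i) * norm x"
      unfolding norm_vec_def by (rule L2_set_mult_ineq)
    finally show ?thesis .
  qed
  then have "norm (A *v x) \<le> L2_set (\<lambda>i. norm (A $ i) * norm x) UNIV"
    unfolding norm_vec_def[of "A *v x"] by (intro L2_set_mono) auto
  also have "\<dots> = norm A * norm x"
    by (simp add: norm_vec_def[of A] L2_set_left_distrib)
  finally show ?thesis .
qed

definition contracts :: "'n::finite cmat \<Rightarrow> bool" where
  "contracts Z \<longleftrightarrow> (\<forall>x. x \<noteq> 0 \<longrightarrow> norm (Z *v x) < norm x)"

lemma cartan_domain_iff: "Z \<in> cartan_domain \<longleftrightarrow> contracts Z"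
proof -
  have "(\<Sum>i\<in>UNIV. cnj (x $ i) * ((mat 1 - ctransp Z ** Z) *v x) $ i) =
     (\<Sum>i\<in>UNIV. cnj (x $ i) * (x - ctransp Z *v (Z *v x)) $ i)" for x
    by (simp add: matrix_vector_mult_diff_rdistrib matrix_vector_mul_assoc)
  then have "Re (\<Sum>i\<in>UNIV. cnj (x $ i) * ((mat 1 - ctransp Z ** Z) *v x) $ i) = (norm x)\<^sup>2 - (norm (Z *v x))\<^sup>2" for x
    by (simp only: inner_cvec[symmetric] inner_diff_right inner_matvec ctransp_simps power2_norm_eq_inner)
  moreover have "ctransp (mat 1 - ctransp Z ** Z) = mat 1 - ctransp Z ** Z"
    by simp
  moreover have "(norm (Z *v x) < norm x) \<longleftrightarrow> 0 < (norm x)\<^sup>2 - (norm (Z *v x))\<^sup>2" for x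
    by (smt (verit) norm_ge_zero power2_less_imp_less power_strict_mono zero_less_numeral)
  ultimately show ?thesis
    by (simp add: cartan_domain_def loewner_less_def pos_definite_def contracts_def)
qed

lemma contracts_le: "contracts Z \<Longrightarrow> norm (Z *v x) \<le> norm x"
  by (cases "x = 0") (auto simp: contracts_def intro: less_imp_le)

text \<open>By Cauchy--Schwarz, \<open>|Z\<^sup>* x|\<^sup>2 = \<langle>x, Z Z\<^sup>* x\<rangle> \<le> |x| |Z Z\<^sup>* x|\<close>.  The domain is defined by \<open>Z\<^sup>* Z < 1\<close> and the weight by
  \<open>1 - Z Z\<^sup>*\<close>; this lemma connects the two.\<close>

lemma contracts_ctransp:
  assumes "contracts Z" shows "contracts (ctransp Z)"
  unfolding contracts_def
proof (intro allI impI)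
  fix x :: "complex ^ 'a" assume x: "x \<noteq> 0"
  let ?y = "ctransp Z *v x"
  show "norm ?y < norm x"
  proof (cases "?y = 0")
    case False
    have "(norm ?y)\<^sup>2 = x \<bullet> (Z *v ?y)"
      by (simp add: power2_norm_eq_inner inner_matvec)
    also have "\<dots> \<le> norm x * norm (Z *v ?y)"
      by (rule norm_cauchy_schwarz)
    also have "\<dots> < norm x * norm ?y"
      using assms False x by (simp add: contracts_def)
    finally show ?thesis
      using False by (simp add: power2_eq_square)
  qed (use x in simp)
qed

text \<open>The unit sphere is compact, so the strict inequalities for the single vectors come with a common gap.
  It makes the domain open and leaves room to scale each of its points by a factor larger than 1.\<close>

lemma contracts_uniform:
  assumes "contracts Z" obtains s where "0 < s" "s < 1" "\<And>x. norm (Z *v x) \<le> s * norm x"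
proof -
  have c: "continuous_on (sphere 0 1) (\<lambda>x. norm (Z *v x))"
    unfolding matrix_vector_mult_def by (intro continuous_intros)
  have ne: "sphere (0::complex ^ 'a) 1 \<noteq> {}"
    by (metis insert_not_empty le_numeral_extra(4) sphere_eq_empty zero_less_one not_one_less_zero)
  obtain u where u: "u \<in> sphere 0 1" "\<And>x. x \<in> sphere 0 1 \<Longrightarrow> norm (Z *v x) \<le> norm (Z *v u)"
    using continuous_attains_sup[OF compact_sphere ne c] by auto
  have "norm (Z *v u) < 1"
    using assms u(1) unfolding contracts_def by (metis mem_sphere_0 norm_zero zero_neq_one)
  then obtain s where s: "norm (Z *v u) < s" "s < 1"
    using dense by blast
  have "norm (Z *v x) \<le> s * norm x" for x
  proof (cases "x = 0")
    case False
    define c where "c = complex_of_real (inverse (norm x))"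
    have "c *s x \<in> sphere 0 1"
      using False by (simp add: norm_cvec_scale c_def norm_inverse)
    from u(2)[OF this] have "cmod c * norm (Z *v x) \<le> norm (Z *v u)"
      by (simp add: vector_scalar_commute norm_cvec_scale)
    then have "norm (Z *v x) \<le> norm (Z *v u) * norm x"
      using False by (simp add: c_def norm_inverse norm_divide field_simps)
    also have "\<dots> \<le> s * norm x"
      using s by (intro mult_right_mono) auto
    finally show ?thesis .
  qed simp
  moreover have "0 < s"
    using s(1) norm_ge_zero[of "Z *v u"] by linarith
  ultimately show ?thesis
    using that s(2) by blast
qed

lemma contracts_uniformI:
  assumes "s < 1" "\<And>x. norm (Z *v x) \<le> s * norm x" shows "contracts Z"
  unfolding contracts_def
proof (intro allI impI)
  fix x :: "complex ^ 'a" assume "x \<noteq> 0"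
  then have "s * norm x < 1 * norm x"
    using assms(1) by (intro mult_strict_right_mono) auto
  with assms(2)[of x] show "norm (Z *v x) < norm x" by simp
qed

lemma open_cartan_domain: "open (cartan_domain :: 'n::finite cmat set)"
  unfolding open_dist
proof
  fix Z :: "'n cmat" assume "Z \<in> cartan_domain"
  then obtain s where s: "0 < s" "s < 1" "\<And>x. norm (Z *v x) \<le> s * norm x"
    using contracts_uniform cartan_domain_iff by blast
  have "Y \<in> cartan_domain" if "dist Y Z < 1 - s" for Y
  proof -
    have "norm (Y *v x) \<le> (s + dist Y Z) * norm x" for x
    proof -
      have "norm (Y *v x) \<le> norm (Z *v x) + norm ((Y - Z) *v x)"
        by (metis add.commute diff_add_cancel matrix_vector_mult_diff_rdistrib norm_triangle_ineq)
      also have "\<dots> \<le> s * norm x + norm (Y - Z) * norm x"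
        using s norm_matvec_le add_mono by blast
      finally show ?thesis by (simp add: dist_norm algebra_simps)
    qed
    with that show ?thesis
      unfolding cartan_domain_iff using contracts_uniformI[of "s + dist Y Z" Y] by simp
  qed
  then show "\<exists>e>0. \<forall>Y. dist Y Z < e \<longrightarrow> Y \<in> cartan_domain"
    using s by (intro exI[of _ "1 - s"]) auto
qed

lemma ball_subset_cartan_domain: "norm Z < 1 \<Longrightarrow> Z \<in> cartan_domain"
  unfolding cartan_domain_iff using contracts_uniformI norm_matvec_le by blast

lemma csc_in_cartan_domain:
  assumes "Z \<in> cartan_domain" "cmod c \<le> 1" shows "csc c Z \<in> cartan_domain"
proof -
  have "cmod c * norm (Z *v x) \<le> norm (Z *v x)" for x
    using assms(2) by (simp add: mult_left_le_one_le)
  then show ?thesis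
    using assms(1) unfolding cartan_domain_iff contracts_def
    by (metis csc_matvec norm_cvec_scale order_le_less_trans)
qed

lemma csc_cartan_domain_beyond:
  assumes "Z \<in> cartan_domain" obtains R where "R > 1" "\<And>c. cmod c < R \<Longrightarrow> csc c Z \<in> cartan_domain"
proof -
  obtain s where s: "0 < s" "s < 1" "\<And>x. norm (Z *v x) \<le> s * norm x"
    using assms contracts_uniform cartan_domain_iff by blast
  have "csc c Z \<in> cartan_domain" if "cmod c < 1 / s" for c
    unfolding cartan_domain_iff
  proof (rule contracts_uniformI)
    show "cmod c * s < 1" using that s by (simp add: field_simps)
    show "norm (csc c Z *v x) \<le> cmod c * s * norm x" for x
      using s by (simp add: csc_matvec norm_cvec_scale mult.assoc mult_left_mono)
  qed
  moreover have "1 / s > 1" using s by simp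
  ultimately show ?thesis using that by blast
qed

lemma norm_le_of_contracts:
  assumes "\<And>x. norm (Z *v x) \<le> norm x" shows "norm (Z :: 'n::finite cmat) \<le> real CARD('n)"
proof -
  have e: "norm (axis j 1 :: complex ^ 'n) = 1" for j by simp
  have "norm (transpose Z $ j) \<le> 1" for j
  proof -
    have "transpose Z $ j = Z *v axis j 1"
      by (simp add: vec_eq_iff transpose_def matrix_vector_mult_def axis_def if_distrib cong: if_cong)
    then show ?thesis using assms[of "axis j 1"] by simp
  qed
  then have c: "norm (Z $ i $ j) \<le> 1" for i j
    using Finite_Cartesian_Product.norm_nth_le[of "transpose Z $ j" i] by (simp add: transpose_def order_trans)
  have "norm Z ^ 2 = (\<Sum>i\<in>UNIV. \<Sum>j\<in>UNIV. norm (Z $ i $ j) ^ 2)"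
    by (simp add: norm_vec_def L2_set_def sum_nonneg)
  also have "\<dots> \<le> (\<Sum>i\<in>(UNIV::'n set). \<Sum>j\<in>(UNIV::'n set). 1)"
    using c by (intro sum_mono) (simp add: power_le_one)
  also have "\<dots> = real CARD('n) ^ 2"
    by (simp add: power2_eq_square)
  finally show ?thesis
    by (rule power2_le_imp_le) simp
qed

lemma norm_cartan_domain: "(Z :: 'n::finite cmat) \<in> cartan_domain \<Longrightarrow> norm Z \<le> real CARD('n)"
  using norm_le_of_contracts contracts_le cartan_domain_iff by blast

lemma bounded_cartan_domain: "bounded (cartan_domain :: 'n::finite cmat set)"
  unfolding bounded_iff using norm_cartan_domain by blast

lemma continuous_on_ctransp [continuous_intros]:
  "continuous_on S f \<Longrightarrow> continuous_on S (\<lambda>x. ctransp (f x :: 'n::finite cmat))"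
  unfolding ctransp_def by (intro continuous_intros)

lemma continuous_on_matmul [continuous_intros]:
  "continuous_on S f \<Longrightarrow> continuous_on S g \<Longrightarrow> continuous_on S (\<lambda>x. f x ** (g x :: 'n::finite cmat))"
  unfolding matrix_matrix_mult_def by (intro continuous_intros)

lemma continuous_on_csc [continuous_intros]:
  "continuous_on S f \<Longrightarrow> continuous_on S g \<Longrightarrow> continuous_on S (\<lambda>x. csc (f x) (g x :: 'n::finite cmat))"
  unfolding csc_def by (intro continuous_intros)

lemma continuous_on_det [continuous_intros]:
  "continuous_on S f \<Longrightarrow> continuous_on S (\<lambda>x. det (f x :: 'n::finite cmat))"
  unfolding det_def by (intro continuous_intros)

text \<open>The determinant is real for every matrix \<open>Z\<close>, since \<open>1 - Z Z\<^sup>*\<close> is Hermitian (\<open>det_gap\<close>).  On the domain it is positive,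
  and on the boundary it vanishes, so negative powers of it are singular there.\<close>

definition gap :: "'n::finite cmat \<Rightarrow> real" where
  "gap Z = Re (det (mat 1 - Z ** ctransp Z))"

lemma continuous_on_gap [continuous_intros]:
  "continuous_on S f \<Longrightarrow> continuous_on S (\<lambda>x. gap (f x :: 'n::finite cmat))"
  unfolding gap_def by (intro continuous_intros)

lemma det_gap: "det (mat 1 - Z ** ctransp Z) = of_real (gap Z)"
proof -
  have "cnj (det (mat 1 - Z ** ctransp Z)) = det (mat 1 - Z ** ctransp Z)"
    by (simp flip: det_ctransp)
  then show ?thesis
    by (simp add: gap_def complex_eq_iff)
qed

lemma gap_nonzero: assumes "contracts Z" shows "gap Z \<noteq> 0"
proof -
  let ?B = "mat 1 - Z ** ctransp Z"
  have "inj ((*v) ?B)"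
  proof (rule injI)
    fix x y assume "?B *v x = ?B *v y"
    then have "?B *v (x - y) = 0"
      by (simp add: matrix_vector_mult_diff_distrib)
    then have "(x - y) \<bullet> (?B *v (x - y)) = 0"
      by simp
    then have "(norm (x - y))\<^sup>2 = (norm (ctransp Z *v (x - y)))\<^sup>2"
      by (simp add: matrix_vector_mult_diff_rdistrib matrix_vector_mul_assoc[symmetric] inner_diff_right
          inner_matvec power2_norm_eq_inner)
    then have "norm (x - y) = norm (ctransp Z *v (x - y))"
      by (simp add: power2_eq_iff_nonneg)
    then show "x = y"
      using contracts_ctransp[OF assms] unfolding contracts_def by (metis eq_iff_diff_eq_0 less_irrefl)
  qed
  then have "det ?B \<noteq> 0"
    by (simp add: invertible_det_nz[symmetric] invertible_left_inverse matrix_left_invertible_injective)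
  then show ?thesis
    by (simp add: det_gap)
qed

text \<open>The determinant is 1 at the origin and has no zero on the segment from there to \<open>Z\<close>.\<close>

lemma gap_pos: assumes "contracts Z" shows "gap Z > 0"
proof (rule ccontr)
  assume "\<not> 0 < gap Z"
  have c: "continuous_on {0..1} (\<lambda>r. gap (csc (of_real r) Z))"
    by (intro continuous_intros)
  have "gap (0 :: 'a cmat) = 1"
    by (simp add: gap_def)
  then obtain r where "r \<in> {0..1}" "gap (csc (of_real r) Z) = 0"
    using IVT2'[of "\<lambda>r. gap (csc (of_real r) Z)" 1 0 0] c \<open>\<not> 0 < gap Z\<close> by auto
  moreover have "contracts (csc (of_real r) Z)"
    using csc_in_cartan_domain[of Z "of_real r"] assms \<open>r \<in> {0..1}\<close> by (simp add: cartan_domain_iff)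
  ultimately show False
    using gap_nonzero by blast
qed

lemma unitary_norm:
  assumes "U \<in> unitary_group" shows "norm (U *v x) = norm x"
proof -
  have "(norm (U *v x))\<^sup>2 = (ctransp U *v (U *v x)) \<bullet> x"
    by (simp add: power2_norm_eq_inner inner_matvec[symmetric])
  also have "\<dots> = (norm x)\<^sup>2"
    using assms by (simp add: matrix_vector_mul_assoc unitary_group_def power2_norm_eq_inner)
  finally show ?thesis
    by (simp add: power2_eq_iff_nonneg)
qed

lemma unitary_ctransp: "U \<in> unitary_group \<Longrightarrow> ctransp U \<in> unitary_group"
  by (simp add: unitary_group_def)

lemma unitary_cancel:
  assumes "U \<in> unitary_group"
  shows "ctransp U ** (U ** Z) = Z" "U ** (ctransp U ** Z) = Z" "Z ** U ** ctransp U = Z" "Z ** ctransp U ** U = Z"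
  using assms by (simp_all add: unitary_group_def matrix_mul_assoc)
    (simp_all flip: matrix_mul_assoc)

lemma csc_unitary: "cmod c = 1 \<Longrightarrow> csc c (mat 1) \<in> unitary_group"
proof -
  assume "cmod c = 1"
  then have "c * cnj c = 1" "cnj c * c = 1"
    using complex_norm_square[of c] by (simp_all add: mult.commute)
  then show ?thesis
    by (simp add: unitary_group_def ctransp_csc csc_mult)
qed

lemma contracts_unitary_mult:
  assumes "U \<in> unitary_group" "contracts Z" shows "contracts (U ** Z)" "contracts (Z ** U)"
proof -
  show "contracts (U ** Z)"
    using assms(2) unfolding contracts_def by (simp add: matrix_vector_mul_assoc[symmetric] unitary_norm[OF assms(1)])
  have "U *v x \<noteq> 0" if "x \<noteq> 0" for x
    using that unitary_norm[OF assms(1), of x] by auto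
  then show "contracts (Z ** U)"
    using assms(2) unfolding contracts_def by (metis matrix_vector_mul_assoc unitary_norm[OF assms(1)])
qed

lemma gap_unitary_mult:
  assumes "U \<in> unitary_group" shows "gap (U ** Z) = gap Z" "gap (Z ** U) = gap Z"
proof -
  have "mat 1 - (U ** Z) ** ctransp (U ** Z) = U ** (mat 1 - Z ** ctransp Z) ** ctransp U"
    using assms by (simp add: matrix_mul_assoc unitary_group_def
      matmul_diff_distrib)
  then have "det (mat 1 - (U ** Z) ** ctransp (U ** Z)) = det (mat 1 - Z ** ctransp Z) * det (U ** ctransp U)"
    by (simp add: det_mul)
  also have "U ** ctransp U = mat 1"
    using assms by (simp add: unitary_group_def)
  finally show "gap (U ** Z) = gap Z"
    by (simp add: gap_def)
  have "(Z ** U) ** ctransp (Z ** U) = Z ** ctransp Z"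
    using unitary_cancel(3)[OF assms, of Z] by (simp add: matrix_mul_assoc)
  then show "gap (Z ** U) = gap Z"
    by (simp add: gap_def)
qed

section \<open>Integrability of the weight\<close>

text \<open>The multiples of \<open>y\<close> are added row by row.  When row \<open>m\<close> is treated, linearity in this row splits off the
  determinant with \<open>y\<close> itself in row \<open>m\<close>, and that row can be used to clear the copies of \<open>y\<close> in all
  rows treated before.\<close>

lemma det_one_plus_rank_one:
  fixes x y :: "'a::field ^ 'n::finite"
  shows "det (\<chi> i. axis i 1 + x $ i *s y) = 1 + (\<Sum>i\<in>UNIV. x $ i * y $ i)"
proof -
  define R where "R S = (\<lambda>i. if i \<in> S then axis i 1 + x $ i *s y else axis i 1)" for S :: "'n set"
  have row_mat: "row i (mat 1 :: 'a ^ 'n ^ 'n) = axis i 1" for i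
    by (auto simp: vec_eq_iff row_def mat_def axis_def)
  have y: "(\<Sum>i\<in>UNIV. y $ i *s axis i 1) = y"
    by (simp add: vec_eq_iff axis_def if_distrib cong: if_cong)
  have aux: "det (\<chi> i. if i = m then y else R S i) = y $ m" if "finite S" "m \<notin> S" for S m
    using that
  proof (induction S)
    case empty
    show ?case
      using cramer_lemma_transpose[of m y "mat 1"] by (simp add: row_mat y R_def cong: if_cong)
  next
    case (insert k S)
    let ?A = "\<chi> i. if i = m then y else R S i"
    have k: "k \<noteq> m" "m \<noteq> k" using insert by auto
    have "(\<chi> i. if i = m then y else R (insert k S) i) =
        (\<chi> i. if i = k then row k ?A + x $ k *s row m ?A else row i ?A)"
      using k insert(2) by (auto simp: vec_eq_iff row_def R_def)
    then show ?case
      using det_row_operation[OF k(1), of ?A "x $ k"] insert by simp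
  qed
  have "det (\<chi> i. R S i) = 1 + (\<Sum>i\<in>S. x $ i * y $ i)" if "finite S" for S
    using that
  proof (induction S)
    case empty
    have "(\<chi> i. axis i 1) = (mat 1 :: 'a ^ 'n ^ 'n)"
      by (auto simp: vec_eq_iff mat_def axis_def)
    then show ?case by (simp add: R_def)
  next
    case (insert m S)
    have "(\<chi> i. R (insert m S) i) = (\<chi> i. if i = m then axis m 1 + x $ m *s y else R S i)"
      by (auto simp: vec_eq_iff R_def)
    also have "det \<dots> = det (\<chi> i. if i = m then axis m 1 else R S i) + det (\<chi> i. if i = m then x $ m *s y else R S i)"
      by (rule det_row_add)
    also have "det (\<chi> i. if i = m then x $ m *s y else R S i) = x $ m * det (\<chi> i. if i = m then y else R S i)"
      by (rule det_row_mul)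
    also have "(\<chi> i. if i = m then axis m 1 else R S i) = (\<chi> i. R S i)"
      using insert by (auto simp: vec_eq_iff R_def)
    finally show ?case
      using insert aux[of S m] by (simp add: algebra_simps)
  qed
  from this[of UNIV] show ?thesis
    by (simp add: R_def)
qed

text \<open>Erasing columns instead of deleting them keeps the matrices in one type, so that an induction over the set of columns is possible.\<close>

definition cols :: "'n set \<Rightarrow> 'n::finite cmat \<Rightarrow> 'n cmat" where
  "cols J Z = (\<chi> i j. if j \<in> J then Z $ i $ j else 0)"

definition unit_entry :: "'n::finite \<Rightarrow> 'n cmat" where
  "unit_entry i = (\<chi> a b. if a = i \<and> b = i then 1 else 0)"

lemma cols_UNIV [simp]: "cols UNIV Z = Z"
  by (simp add: cols_def vec_eq_iff)

lemma continuous_on_cols [continuous_intros]: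
  "continuous_on S f \<Longrightarrow> continuous_on S (\<lambda>x. cols J (f x :: 'n::finite cmat))"
  unfolding cols_def
  by (intro continuous_on_vec_lambda, rename_tac i j, case_tac "j \<in> J") (auto intro!: continuous_intros)

lemma contracts_cols_mono:
  assumes "contracts (cols K Z)" "J \<subseteq> K" shows "contracts (cols J Z)"
  unfolding contracts_def
proof (intro allI impI)
  fix x :: "complex ^ 'a" assume "x \<noteq> 0"
  define y where "y = (\<chi> j. if j \<in> J then x $ j else 0)"
  have eq: "cols J Z *v x = cols K Z *v y"
    using assms(2) by (auto simp: vec_eq_iff cols_def y_def matrix_vector_mult_def intro!: sum.cong)
  have le: "norm y \<le> norm x"
    unfolding norm_vec_def y_def by (intro L2_set_mono) auto
  show "norm (cols J Z *v x) < norm x"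
  proof (cases "y = 0")
    case True
    then show ?thesis using \<open>x \<noteq> 0\<close> by (simp add: eq)
  next
    case False
    then show ?thesis using assms(1) le eq unfolding contracts_def by (metis order_less_le_trans)
  qed
qed

text \<open>Let \<open>Y\<close> consist of the columns in \<open>J\<close>, let \<open>q\<close> be column \<open>i\<close>, and \<open>B = 1 - Y Y\<^sup>*\<close>.  Adding the column \<open>q\<close> changes
  the determinant to \<open>det (B - q q\<^sup>*) = det B (1 - q\<^sup>* B\<^sup>-\<^sup>1 q)\<close>, which is a quadratic polynomial in one entry of \<open>q\<close>.
  The coefficient \<open>\<alpha>\<close> is a diagonal entry of \<open>B\<^sup>-\<^sup>1\<close>, and it is at least 1 because \<open>B \<le> 1\<close>.  This bound does not depend on \<open>Z\<close>,
  which makes the slice estimates below uniform.\<close>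

lemma gap_add_column:
  fixes Z :: "'n::finite cmat"
  assumes "i \<notin> J" and Y: "contracts (cols J Z)"
  obtains c b \<alpha> where "\<alpha> \<ge> 1" "\<And>s. gap (cols (insert i J) (Z + csc s (unit_entry i))) =
     gap (cols J Z) * (c + Re (b * s) - \<alpha> * (cmod s)\<^sup>2)"
proof -
  define Y where "Y = cols J Z"
  define B where "B = mat 1 - Y ** ctransp Y"
  define v where "v = (\<chi> k. Z $ k $ i)"
  let ?e = "axis i 1 :: complex ^ 'n"
  have gY: "det B = of_real (gap Y)"
    by (simp add: B_def det_gap)
  then have "invertible B"
    using Y gap_nonzero by (auto simp: invertible_det_nz Y_def)
  then obtain C where C: "B ** C = mat 1"
    by (auto simp: invertible_def)
  define x where "x = C *v ?e"
  define \<alpha> where "\<alpha> = ?e \<bullet> x"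
  have Bx: "B *v x = ?e"
    using C by (simp add: x_def matrix_vector_mul_assoc)
  have e: "?e = x - Y *v (ctransp Y *v x)"
    unfolding Bx[symmetric] by (simp add: B_def matrix_vector_mult_diff_rdistrib matrix_vector_mul_assoc)
  have "\<alpha> \<ge> 1"
  proof -
    let ?y = "ctransp Y *v x"
    have "\<alpha> = ?e \<bullet> ?e + ?e \<bullet> (Y *v ?y)"
      unfolding \<alpha>_def by (subst (2) e) (simp add: inner_diff_right inner_add_right)
    moreover have "?e \<bullet> ?e = 1"
      by (simp add: inner_axis_axis)
    moreover have "?e \<bullet> (Y *v ?y) = (norm ?y)\<^sup>2 - (norm (Y *v ?y))\<^sup>2"
    proof -
      have "?e \<bullet> (Y *v ?y) = x \<bullet> (Y *v ?y) - (Y *v ?y) \<bullet> (Y *v ?y)"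
        by (subst e) (simp add: inner_diff_left)
      then show ?thesis
        by (simp add: inner_matvec[of x] power2_norm_eq_inner)
    qed
    moreover have "norm (Y *v ?y) \<le> norm ?y"
      using contracts_le Y Y_def by blast
    ultimately show ?thesis
      using power_mono[of "norm (Y *v ?y)" "norm ?y" 2] by simp
  qed
  define b where "b = (\<Sum>k\<in>UNIV. cnj (v $ k) * C $ k $ i) + cnj ((C *v v) $ i)"
  have main: "gap (cols (insert i J) (Z + csc s (unit_entry i))) = gap Y * ((1 - v \<bullet> (C *v v)) + Re (- b * s) - \<alpha> * (cmod s)\<^sup>2)" for s
  proof -
    let ?W = "cols (insert i J) (Z + csc s (unit_entry i))"
    define q where "q = v + s *s ?e"
    have WW: "?W ** ctransp ?W = Y ** ctransp Y + (\<chi> k l. q $ k * cnj (q $ l))"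
    proof -
      have W: "?W $ k $ j = (if j = i then q $ k else Y $ k $ j)" for k j
        using assms(1) by (auto simp: cols_def unit_entry_def Y_def q_def v_def axis_def)
      have Yi: "Y $ k $ i = 0" for k
        using assms(1) by (simp add: cols_def Y_def)
      have "(\<Sum>j\<in>UNIV. ?W $ k $ j * cnj (?W $ l $ j)) =
         (\<Sum>j\<in>UNIV. Y $ k $ j * cnj (Y $ l $ j) + (if j = i then q $ k * cnj (q $ l) else 0))" for k l
        by (rule sum.cong) (auto simp: W Yi)
      then show ?thesis
        by (simp add: vec_eq_iff matrix_matrix_mult_def sum.distrib)
    qed
    define p where "p = - (C *v q)"
    define p' where "p' = (\<chi> l. cnj (q $ l))"
    have "mat 1 - ?W ** ctransp ?W = B ** (\<chi> k. axis k 1 + p $ k *s p')"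
    proof -
      have 1: "(\<chi> k. axis k 1 + p $ k *s p') = mat 1 + (\<chi> k l. p $ k * p' $ l)"
        by (auto simp: vec_eq_iff mat_def axis_def)
      have "B ** (\<chi> k l. p $ k * p' $ l) = (\<chi> k l. (B *v p) $ k * p' $ l)"
        by (simp add: vec_eq_iff matrix_matrix_mult_def matrix_vector_mult_def sum_distrib_left mult_ac)
      moreover have "B *v p = - q"
      proof -
        have "B *v p = B *v (0 - C *v q)" by (simp add: p_def)
        also have "\<dots> = - q" unfolding matrix_vector_mult_diff_distrib using C by (simp add: matrix_vector_mul_assoc)
        finally show ?thesis .
      qed
      ultimately have 2: "B ** (\<chi> k l. p $ k * p' $ l) = - (\<chi> k l. q $ k * cnj (q $ l))"
        by (simp add: vec_eq_iff p'_def)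
      show ?thesis
        unfolding 1 matrix_add_ldistrib 2 WW by (simp add: B_def)
    qed
    then have "det (mat 1 - ?W ** ctransp ?W) = of_real (gap Y) * (1 + (\<Sum>k\<in>UNIV. p $ k * p' $ k))"
      by (simp add: det_mul det_one_plus_rank_one gY)
    then have "gap ?W = gap Y * (1 + Re (\<Sum>k\<in>UNIV. p $ k * p' $ k))"
      unfolding gap_def[of ?W] by simp
    also have "Re (\<Sum>k\<in>UNIV. p $ k * p' $ k) = - (q \<bullet> (C *v q))"
      by (simp add: inner_cvec p_def p'_def sum_negf mult.commute)
    also have "q \<bullet> (C *v q) = v \<bullet> (C *v v) + Re (b * s) + \<alpha> * (cmod s)\<^sup>2"
    proof -
      have Ce: "(C *v (s *s ?e)) = s *s x"
        by (simp add: x_def vector_scalar_commute)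
      have a: "(s *s ?e) \<bullet> y = Re (cnj s * y $ i)" for y
        by (simp add: inner_cvec axis_def if_distrib if_distribR cong: if_cong)
      have xi: "x $ k = C $ k $ i" for k
        by (simp add: x_def matrix_vector_mult_def axis_def if_distrib cong: if_cong)
      have al: "\<alpha> = Re (x $ i)"
        using a[of x] by (simp add: \<alpha>_def inner_cvec axis_def if_distrib if_distribR cong: if_cong)
      have "q \<bullet> (C *v q) = v \<bullet> (C *v v) + v \<bullet> (s *s x) + (s *s ?e) \<bullet> (C *v v) + (s *s ?e) \<bullet> (s *s x)"
        by (simp add: q_def matrix_vector_right_distrib inner_add_left inner_add_right Ce)
      also have "v \<bullet> (s *s x) = Re ((\<Sum>k\<in>UNIV. cnj (v $ k) * C $ k $ i) * s)"
      proof -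
        have "(\<Sum>k\<in>UNIV. cnj (v $ k) * (s *s x) $ k) = (\<Sum>k\<in>UNIV. cnj (v $ k) * C $ k $ i) * s"
          by (simp add: xi sum_distrib_left mult_ac)
        then show ?thesis by (simp only: inner_cvec)
      qed
      also have "(s *s ?e) \<bullet> (C *v v) = Re (cnj ((C *v v) $ i) * s)"
        by (simp add: a)
      also have "(s *s ?e) \<bullet> (s *s x) = Re (x $ i) * (cmod s)\<^sup>2"
        unfolding a cmod_power2 by (simp add: power2_eq_square algebra_simps)
      finally show ?thesis
        by (simp add: b_def al distrib_right)
    qed
    finally show ?thesis
      by simp
  qed
  show thesis
    using that[OF \<open>\<alpha> \<ge> 1\<close>, of "1 - v \<bullet> (C *v v)" "- b"] main Y_def by simp
qed

text \<open>Completing the square turns the set into an annulus \<open>(M - t)/\<alpha> < |s - s\<^sub>0|\<^sup>2 < M/\<alpha>\<close>, whose area is at most \<open>\<pi> t/\<alpha>\<close> for every \<open>M\<close>.\<close>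

lemma emeasure_quadratic_strip:
  assumes "\<alpha> \<ge> 1" "t > 0"
  shows "emeasure lborel {s::complex. 0 < c + Re (b * s) - \<alpha> * (cmod s)\<^sup>2 \<and> c + Re (b * s) - \<alpha> * (cmod s)\<^sup>2 < t} \<le> ennreal (pi * t)"
proof -
  define s0 where "s0 = cnj b / of_real (2 * \<alpha>)"
  define M where "M = c + \<alpha> * (cmod s0)\<^sup>2"
  have sq: "c + Re (b * s) - \<alpha> * (cmod s)\<^sup>2 = M - \<alpha> * (cmod (s - s0))\<^sup>2" for s
  proof -
    have p1: "(cmod (s - s0))\<^sup>2 = (cmod s)\<^sup>2 + (cmod s0)\<^sup>2 - 2 * Re (cnj s0 * s)"
      unfolding cmod_power2 by (simp add: power2_eq_square algebra_simps)
    have p2: "2 * \<alpha> * Re (cnj s0 * s) = Re (b * s)"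
      using assms(1) by (simp add: s0_def field_simps)
    have "\<alpha> * (cmod (s - s0))\<^sup>2 = \<alpha> * (cmod s)\<^sup>2 + \<alpha> * (cmod s0)\<^sup>2 - Re (b * s)"
      unfolding p1 p2[symmetric] by (simp only: right_diff_distrib distrib_left mult_ac)
    then show ?thesis
      by (simp only: M_def)
  qed
  define r where "r = sqrt (max 0 (M / \<alpha>))"
  define r' where "r' = sqrt (max 0 ((M - t) / \<alpha>))"
  have ballm: "emeasure lborel (ball s0 r) = ennreal (pi * r\<^sup>2)" "emeasure lborel (ball s0 r') = ennreal (pi * r'\<^sup>2)"
    by (simp_all add: emeasure_ball unit_ball_vol_2 r_def r'_def)
  have rr: "r' \<le> r"
    using assms unfolding r_def r'_def by (intro real_sqrt_le_mono max.mono divide_right_mono) auto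
  have lt: "x < sqrt (max 0 y) \<longleftrightarrow> x\<^sup>2 < y" if "x \<ge> 0" for x y :: real
    using that by (smt (verit) max_def real_less_rsqrt real_sqrt_less_iff real_sqrt_pow2 real_sqrt_unique real_sqrt_zero zero_le_power2 real_less_lsqrt)
  have "{s. 0 < c + Re (b * s) - \<alpha> * (cmod s)\<^sup>2 \<and> c + Re (b * s) - \<alpha> * (cmod s)\<^sup>2 < t} \<subseteq> ball s0 r - ball s0 r'"
  proof
    fix s assume "s \<in> {s. 0 < c + Re (b * s) - \<alpha> * (cmod s)\<^sup>2 \<and> c + Re (b * s) - \<alpha> * (cmod s)\<^sup>2 < t}"
    then have "0 < M - \<alpha> * (cmod (s - s0))\<^sup>2" "M - \<alpha> * (cmod (s - s0))\<^sup>2 < t"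
      by (simp_all only: mem_Collect_eq sq)
    then have "(cmod (s - s0))\<^sup>2 < M / \<alpha>" "\<not> (cmod (s - s0))\<^sup>2 < (M - t) / \<alpha>"
      using assms by (simp_all add: field_simps)
    then show "s \<in> ball s0 r - ball s0 r'"
      by (simp add: r_def r'_def dist_norm norm_minus_commute lt)
  qed
  then have "emeasure lborel {s. 0 < c + Re (b * s) - \<alpha> * (cmod s)\<^sup>2 \<and> c + Re (b * s) - \<alpha> * (cmod s)\<^sup>2 < t}
     \<le> emeasure lborel (ball s0 r - ball s0 r')"
    by (rule emeasure_mono) auto
  also have "\<dots> = ennreal (pi * r\<^sup>2) - ennreal (pi * r'\<^sup>2)"
    using rr by (subst emeasure_Diff) (auto simp: ballm subset_ball)
  also have "\<dots> = ennreal (pi * r\<^sup>2 - pi * r'\<^sup>2)"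
    by (simp add: ennreal_minus)
  also have "\<dots> \<le> ennreal (pi * t)"
  proof (rule ennreal_leI)
    have "M / \<alpha> - (M - t) / \<alpha> \<le> t"
      using assms by (simp add: field_simps)
    moreover have "0 \<le> t" using assms by simp
    ultimately have "r\<^sup>2 - r'\<^sup>2 \<le> t"
      unfolding r_def r'_def by (simp add: max_def)
    then have "pi * (r\<^sup>2 - r'\<^sup>2) \<le> pi * t"
      by (intro mult_left_mono) auto
    then show "pi * r\<^sup>2 - pi * r'\<^sup>2 \<le> pi * t" by (simp add: algebra_simps)
  qed
  finally show ?thesis .
qed

text \<open>A dyadic decomposition: where \<open>2\<^sup>-\<^sup>k\<^sup>-\<^sup>1 \<le> h < 2\<^sup>-\<^sup>k\<close>, the integrand is at most \<open>2\<close> to the power \<open>-(k+1) \<mu>\<close> and the measure at most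
  \<open>C 2\<^sup>-\<^sup>k\<close>.  The resulting geometric series converges because \<open>\<mu> > -1\<close>.\<close>

lemma nn_integral_powr_le_of_small_values:
  fixes h :: "'a \<Rightarrow> real"
  assumes [measurable]: "h \<in> borel_measurable M" "\<Omega> \<in> sets M"
    and pos: "\<And>x. x \<in> \<Omega> \<Longrightarrow> h x > 0" and \<mu>: "-1 < \<mu>" "\<mu> < 0"
    and K: "emeasure M \<Omega> \<le> ennreal K" "K \<ge> 0" and C: "C \<ge> 0"
    and small: "\<And>t. t > 0 \<Longrightarrow> emeasure M {x \<in> \<Omega>. h x < t} \<le> ennreal (C * t)"
  shows "(\<integral>\<^sup>+x. indicator \<Omega> x * ennreal (h x powr \<mu>) \<partial>M)
     \<le> ennreal (K + C * (1/2) powr \<mu> / (1 - (1/2) powr (\<mu> + 1)))"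
proof -
  define w where "w k = ((1/2::real) ^ Suc k) powr \<mu>" for k
  define A where "A k = {x \<in> \<Omega>. h x < (1/2) ^ k}" for k :: nat
  have A_eq: "A k = {x \<in> space M. x \<in> \<Omega> \<and> h x < (1/2) ^ k}" for k
    using sets.sets_into_space[OF assms(2)] by (auto simp: A_def)
  have [measurable]: "A k \<in> sets M" for k
    unfolding A_eq by measurable
  have pw: "indicator \<Omega> x * ennreal (h x powr \<mu>) \<le> indicator \<Omega> x + (\<Sum>k. ennreal (w k) * indicator (A k) x)" for x
  proof (cases "x \<in> \<Omega>")
    case True
    show ?thesis
    proof (cases "h x < 1")
      case False
      then have "h x powr \<mu> \<le> 1 powr \<mu>"
        using \<mu> by (intro powr_mono2') auto
      then show ?thesis using True by (auto intro: add_increasing2)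
    next
      case lt: True
      have "\<exists>n. (1/2) ^ n < h x"
        using real_arch_pow_inv[of "h x" "1/2"] pos[OF True] by simp
      then have ex: "\<exists>n. (1/2) ^ n \<le> h x" using less_imp_le by blast
      define n where "n = (LEAST n. (1/2) ^ n \<le> h x)"
      have n: "(1/2) ^ n \<le> h x" unfolding n_def using ex by (rule LeastI_ex)
      with lt have "n \<noteq> 0" by (intro notI) auto
      then obtain k where k: "n = Suc k" using not0_implies_Suc by blast
      have "\<not> (1/2) ^ k \<le> h x"
        using not_less_Least[of k "\<lambda>n. (1/2) ^ n \<le> h x"] k n_def by simp
      then have xA: "x \<in> A k" using True by (simp add: A_def)
      have "h x powr \<mu> \<le> w k"
        unfolding w_def using n k \<mu> by (intro powr_mono2') auto
      then have "indicator \<Omega> x * ennreal (h x powr \<mu>) \<le> ennreal (w k) * indicator (A k) x"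
        using True xA by (simp add: ennreal_leI)
      also have "\<dots> = (\<Sum>k\<in>{k}. ennreal (w k) * indicator (A k) x)"
        by (simp only: sum.insert finite.emptyI empty_iff not_False_eq_True sum.empty add_0_right)
      also have "\<dots> \<le> (\<Sum>k. ennreal (w k) * indicator (A k) x)"
        by (rule sum_le_suminf) (auto simp: summableI)
      finally show ?thesis by (auto intro: add_increasing)
    qed
  qed simp
  let ?r = "(1/2::real) powr (\<mu> + 1)"
  have r: "0 < ?r" "?r < 1"
    using \<mu> powr_less_mono2[of "\<mu> + 1" "1/2" 1] by auto
  have wk: "w k * (C * (1/2) ^ k) = C * (1/2) powr \<mu> * ?r ^ k" for k
  proof -
    have "((1/2::real) ^ k) powr \<mu> = ((1/2) powr \<mu>) ^ k"
      by (induction k) (simp_all only: power_0 power_Suc powr_mult powr_one_eq_one)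
    then have "w k = (1/2) powr \<mu> * ((1/2) powr \<mu>) ^ k"
      unfolding w_def by (simp only: power_Suc powr_mult)
    moreover have "?r ^ k = ((1/2) powr \<mu>) ^ k * (1/2) ^ k"
    proof -
      have "?r = (1/2) powr \<mu> * (1/2)"
        by (simp add: powr_add)
      then show ?thesis
        by (simp only: power_mult_distrib)
    qed
    ultimately show ?thesis by simp
  qed
  have "(\<integral>\<^sup>+x. indicator \<Omega> x * ennreal (h x powr \<mu>) \<partial>M)
     \<le> (\<integral>\<^sup>+x. indicator \<Omega> x + (\<Sum>k. ennreal (w k) * indicator (A k) x) \<partial>M)"
    by (rule nn_integral_mono) (rule pw)
  also have "\<dots> = emeasure M \<Omega> + (\<Sum>k. ennreal (w k) * emeasure M (A k))"
    by (subst nn_integral_add) (auto simp: nn_integral_suminf nn_integral_cmult)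
  also have "\<dots> \<le> ennreal K + (\<Sum>k. ennreal (C * (1/2) powr \<mu> * ?r ^ k))"
  proof (intro add_mono K suminf_le summableI)
    fix k
    have "ennreal (w k) * emeasure M (A k) \<le> ennreal (w k) * ennreal (C * (1/2) ^ k)"
      unfolding A_def by (intro mult_left_mono small) auto
    then show "ennreal (w k) * emeasure M (A k) \<le> ennreal (C * (1/2) powr \<mu> * ?r ^ k)"
      using C by (subst wk[symmetric], subst ennreal_mult) (auto simp: w_def)
  qed
  also have "(\<Sum>k. ennreal (C * (1/2) powr \<mu> * ?r ^ k)) = ennreal (C * (1/2) powr \<mu> * (1 / (1 - ?r)))"
    using C r by (intro suminf_ennreal_eq sums_mult geometric_sums) (auto intro!: mult_nonneg_nonneg)
  also have "ennreal K + \<dots> = ennreal (K + C * (1/2) powr \<mu> / (1 - ?r))"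
    using K C r by (subst ennreal_plus[symmetric]) auto
  finally show ?thesis .
qed

lemma nn_integral_lborel_shift:
  fixes f :: "'a::euclidean_space \<Rightarrow> ennreal"
  assumes [measurable]: "f \<in> borel_measurable borel"
  shows "(\<integral>\<^sup>+x. f (x + a) \<partial>lborel) = (\<integral>\<^sup>+x. f x \<partial>lborel)"
proof -
  have "(\<integral>\<^sup>+x. f x \<partial>lborel) = (\<integral>\<^sup>+x. f x \<partial>distr lborel borel ((+) a))"
    by (simp add: lborel_distr_plus)
  also have "\<dots> = (\<integral>\<^sup>+x. f (a + x) \<partial>lborel)"
    by (rule nn_integral_distr) auto
  finally show ?thesis by (simp add: add.commute)
qed

lemma borel_csc [measurable (raw)]:
  fixes f :: "'a \<Rightarrow> 'n::finite cmat"
  assumes "g \<in> borel_measurable M" "f \<in> borel_measurable M"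
  shows "(\<lambda>x. csc (g x) (f x)) \<in> borel_measurable M"
  using assms by (rule borel_measurable_continuous_Pair) (intro continuous_intros)

text \<open>The weight of the matrix formed by the columns in \<open>J\<close>.  The other columns are not constrained by the
  contraction property, hence the cut-off at radius \<open>R\<close>.\<close>

definition partial_weight :: "real \<Rightarrow> 'n set \<Rightarrow> real \<Rightarrow> 'n::finite cmat \<Rightarrow> ennreal" where
  "partial_weight \<mu> J R Z = indicator {Z. norm Z < R \<and> contracts (cols J Z)} Z * ennreal (gap (cols J Z) powr \<mu>)"

lemma open_contracts_cols: "open {Z::'n::finite cmat. norm Z < R \<and> contracts (cols J Z)}"
proof -
  have "open (cols J -` (cartan_domain :: 'n cmat set))"
    by (intro open_vimage open_cartan_domain) (intro continuous_intros)
  moreover have "open {Z::'n cmat. norm Z < R}"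
    by (intro open_Collect_less continuous_intros)
  ultimately have "open ((cols J -` cartan_domain) \<inter> {Z::'n cmat. norm Z < R})"
    by (rule open_Int)
  then show ?thesis
    by (rule back_subst[of "open"]) (auto simp: cartan_domain_iff)
qed

lemma borel_gap [measurable]: "gap \<in> borel_measurable borel"
  by (intro borel_measurable_continuous_onI continuous_intros)

lemma borel_cols [measurable]: "cols J \<in> borel_measurable borel"
  by (intro borel_measurable_continuous_onI continuous_intros)

lemma borel_partial_weight [measurable]: "partial_weight \<mu> J R \<in> borel_measurable borel"
proof -
  have [measurable]: "{Z::'a cmat. norm Z < R \<and> contracts (cols J Z)} \<in> sets borel"
    using open_contracts_cols by (rule borel_open)
  show ?thesis unfolding partial_weight_def by measurable
qed

lemma norm_unit_entry: "norm (unit_entry i :: 'n::finite cmat) = 1"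
proof -
  have "norm (unit_entry i $ a) = (if a = i then 1 else 0)" for a :: 'n
  proof -
    have "unit_entry i $ a = (if a = i then axis i 1 else 0)"
      by (auto simp: vec_eq_iff unit_entry_def axis_def)
    then show ?thesis by simp
  qed
  then have "(\<Sum>a\<in>UNIV. (norm (unit_entry i $ a))\<^sup>2) = (\<Sum>a\<in>(UNIV::'n set). (if a = i then 1 else 0 :: real))"
    by (intro sum.cong) auto
  then show ?thesis
    by (simp add: norm_vec_def[of "unit_entry i"] L2_set_def)
qed

text \<open>Integration over a single entry of column \<open>i\<close> removes the whole column from the weight at the cost of a
  constant: by \<open>gap_add_column\<close> the gap is the gap of the other columns times a quadratic polynomial, and the latter takes values
  below \<open>t\<close> on a set of area at most \<open>\<pi> t\<close>.\<close>

lemma partial_weight_slice: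
  fixes Z :: "'n::finite cmat"
  assumes "i \<notin> J" and \<mu>: "-1 < \<mu>" "\<mu> < 0"
  shows "(\<integral>\<^sup>+s. indicator (ball 0 1) s * partial_weight \<mu> (insert i J) R (Z + csc s (unit_entry i)) \<partial>lborel)
    \<le> ennreal (pi + pi * (1/2) powr \<mu> / (1 - (1/2) powr (\<mu> + 1))) * partial_weight \<mu> J (R + 1) Z"
proof -
  define \<Omega> where "\<Omega> = {s. s \<in> ball 0 1 \<and> Z + csc s (unit_entry i) \<in> {Z. norm Z < R \<and> contracts (cols (insert i J) Z)}}"
  have cm: "continuous_on UNIV (\<lambda>s. Z + csc s (unit_entry i))"
    by (intro continuous_intros)
  have "open (ball 0 1 \<inter> (\<lambda>s. Z + csc s (unit_entry i)) -` {Z. norm Z < R \<and> contracts (cols (insert i J) Z)})"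
    using open_vimage[OF open_contracts_cols cm] by (intro open_Int) auto
  then have "open \<Omega>"
    by (rule back_subst[of "open"]) (auto simp: \<Omega>_def)
  then have [measurable]: "\<Omega> \<in> sets borel" by (rule borel_open)
  show ?thesis
  proof (cases "\<Omega> = {}")
    case True
    then have z: "indicator (ball 0 1) s * partial_weight \<mu> (insert i J) R (Z + csc s (unit_entry i)) = 0" for s
      unfolding partial_weight_def \<Omega>_def by (auto simp: indicator_def)
    have "(\<integral>\<^sup>+s. indicator (ball 0 1) s * partial_weight \<mu> (insert i J) R (Z + csc s (unit_entry i)) \<partial>lborel) = (\<integral>\<^sup>+(s::complex). 0 \<partial>lborel)"
      by (rule nn_integral_cong) (rule z)
    then show ?thesis by simp
  next
    case False
    then obtain s0 where s0: "s0 \<in> \<Omega>" by blast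
    have "cols J (Z + csc s0 (unit_entry i)) = cols J Z"
      using assms(1) by (auto simp: vec_eq_iff cols_def unit_entry_def)
    then have Y: "contracts (cols J Z)"
      using s0 contracts_cols_mono[of "insert i J" "Z + csc s0 (unit_entry i)" J] by (auto simp: \<Omega>_def)
    have "norm Z \<le> norm (Z + csc s0 (unit_entry i)) + norm (csc s0 (unit_entry i))"
      by (metis add_diff_cancel_right' norm_triangle_ineq4)
    then have nZ: "norm Z < R + 1"
      using s0 by (auto simp: \<Omega>_def norm_unit_entry)
    define g where "g = gap (cols J Z)"
    have g: "g > 0" using gap_pos Y by (simp add: g_def)
    define h where "h s = gap (cols (insert i J) (Z + csc s (unit_entry i))) / g" for s
    have [measurable]: "h \<in> borel_measurable borel"
      unfolding h_def by measurable
    obtain c b \<alpha> where al: "\<alpha> \<ge> 1" and gp: "\<And>s. gap (cols (insert i J) (Z + csc s (unit_entry i))) =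
       g * (c + Re (b * s) - \<alpha> * (cmod s)\<^sup>2)"
      unfolding g_def using gap_add_column[OF assms(1) Y] by (metis (no_types))
    have h: "h s = c + Re (b * s) - \<alpha> * (cmod s)\<^sup>2" for s
      using g by (simp add: h_def gp)
    have hpos: "h s > 0" if "s \<in> \<Omega>" for s
      using that gap_pos[of "cols (insert i J) (Z + csc s (unit_entry i))"] g by (simp add: h_def \<Omega>_def)
    have "(\<integral>\<^sup>+s. indicator (ball 0 1) s * partial_weight \<mu> (insert i J) R (Z + csc s (unit_entry i)) \<partial>lborel)
       = (\<integral>\<^sup>+s. ennreal (g powr \<mu>) * (indicator \<Omega> s * ennreal (h s powr \<mu>)) \<partial>lborel)"
    proof (rule nn_integral_cong)
      fix s
      show "indicator (ball 0 1) s * partial_weight \<mu> (insert i J) R (Z + csc s (unit_entry i)) =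
         ennreal (g powr \<mu>) * (indicator \<Omega> s * ennreal (h s powr \<mu>))"
      proof (cases "s \<in> \<Omega>")
        case True
        have "gap (cols (insert i J) (Z + csc s (unit_entry i))) powr \<mu> = g powr \<mu> * h s powr \<mu>"
          using g hpos[OF True] by (simp add: gp h powr_mult)
        then show ?thesis
          using True by (simp add: partial_weight_def \<Omega>_def ennreal_mult)
      next
        case False
        then show ?thesis
          by (auto simp: partial_weight_def \<Omega>_def indicator_def)
      qed
    qed
    also have "\<dots> = ennreal (g powr \<mu>) * (\<integral>\<^sup>+s. indicator \<Omega> s * ennreal (h s powr \<mu>) \<partial>lborel)"
      by (rule nn_integral_cmult) measurable
    also have "(\<integral>\<^sup>+s. indicator \<Omega> s * ennreal (h s powr \<mu>) \<partial>lborel) \<le>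
      ennreal (pi + pi * (1/2) powr \<mu> / (1 - (1/2) powr (\<mu> + 1)))"
    proof (rule nn_integral_powr_le_of_small_values)
      have "emeasure lborel \<Omega> \<le> emeasure lborel (ball (0::complex) 1)"
        by (rule emeasure_mono) (auto simp: \<Omega>_def)
      then show "emeasure lborel \<Omega> \<le> ennreal pi"
        by (simp add: emeasure_ball unit_ball_vol_2)
      fix t :: real assume t: "t > 0"
      have "emeasure lborel {x \<in> \<Omega>. h x < t} \<le> emeasure lborel {s::complex. 0 < c + Re (b * s) - \<alpha> * (cmod s)\<^sup>2 \<and> c + Re (b * s) - \<alpha> * (cmod s)\<^sup>2 < t}"
        using hpos by (intro emeasure_mono) (auto simp: h)
      also have "\<dots> \<le> ennreal (pi * t)"
        by (rule emeasure_quadratic_strip[OF al t])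
      finally show "emeasure lborel {x \<in> \<Omega>. h x < t} \<le> ennreal (pi * t)" .
    qed (use hpos \<mu> in auto)
    finally have "(\<integral>\<^sup>+s. indicator (ball 0 1) s * partial_weight \<mu> (insert i J) R (Z + csc s (unit_entry i)) \<partial>lborel)
       \<le> ennreal (g powr \<mu>) * ennreal (pi + pi * (1/2) powr \<mu> / (1 - (1/2) powr (\<mu> + 1)))"
      by (simp add: mult_left_mono)
    also have "ennreal (g powr \<mu>) = partial_weight \<mu> J (R + 1) Z"
      using Y nZ by (simp add: partial_weight_def g_def)
    finally show ?thesis by (simp add: mult.commute)
  qed
qed

text \<open>The columns are added one at a time.  Translation by \<open>s\<close> in a single entry does not change
  the Lebesgue integral, so the integral may be averaged over \<open>s\<close> in the unit disc; after exchanging the order of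
  integration the inner integral is the one estimated in \<open>partial_weight_slice\<close>.  The translations enlarge the radius \<open>R\<close> by 1.\<close>

lemma partial_weight_finite:
  assumes \<mu>: "-1 < \<mu>" "\<mu> < 0"
  shows "(\<integral>\<^sup>+Z. partial_weight \<mu> J R (Z :: 'n::finite cmat) \<partial>lborel) < \<infinity>"
  using finite_class.finite[of J]
proof (induction J arbitrary: R rule: finite_induct)
  case empty
  have "cols {} Z = 0" for Z :: "'n cmat" by (simp add: cols_def vec_eq_iff)
  then have "partial_weight \<mu> {} R Z \<le> indicator (ball 0 R) Z" for Z :: "'n cmat"
    by (auto simp: partial_weight_def gap_def indicator_def)
  then have "(\<integral>\<^sup>+Z. partial_weight \<mu> {} R (Z :: 'n cmat) \<partial>lborel) \<le> (\<integral>\<^sup>+Z. indicator (ball 0 R) (Z :: 'n cmat) \<partial>lborel)"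
    by (intro nn_integral_mono)
  also have "\<dots> < \<infinity>"
    using emeasure_bounded_finite[of "ball (0 :: 'n cmat) R"] by simp
  finally show ?case .
next
  case (insert i J)
  let ?L = "ennreal (pi + pi * (1/2) powr \<mu> / (1 - (1/2) powr (\<mu> + 1)))"
  let ?h = "partial_weight \<mu> (insert i J) R :: 'n cmat \<Rightarrow> ennreal"
  let ?E = "\<lambda>s. csc s (unit_entry i) :: 'n cmat"
  have [measurable]: "ball (0::complex) 1 \<in> sets borel"
    by (rule borel_open) simp
  have "emeasure lborel (ball (0::complex) 1) * (\<integral>\<^sup>+Z. ?h Z \<partial>lborel) = (\<integral>\<^sup>+s. indicator (ball (0::complex) 1) s * (\<integral>\<^sup>+Z. ?h Z \<partial>lborel) \<partial>lborel)"
    by (subst nn_integral_multc) auto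
  also have "\<dots> = (\<integral>\<^sup>+s. (\<integral>\<^sup>+Z. indicator (ball (0::complex) 1) s * ?h (Z + ?E s) \<partial>lborel) \<partial>lborel)"
    by (simp add: nn_integral_cmult nn_integral_lborel_shift)
  also have "\<dots> = (\<integral>\<^sup>+Z. (\<integral>\<^sup>+s. indicator (ball (0::complex) 1) s * ?h (Z + ?E s) \<partial>lborel) \<partial>lborel)"
    by (rule lborel_pair.Fubini') measurable
  also have "\<dots> \<le> (\<integral>\<^sup>+Z. ?L * partial_weight \<mu> J (R + 1) Z \<partial>lborel)"
    using \<mu> insert by (intro nn_integral_mono partial_weight_slice) auto
  also have "\<dots> = ?L * (\<integral>\<^sup>+Z. partial_weight \<mu> J (R + 1) (Z :: 'n cmat) \<partial>lborel)"
    by (rule nn_integral_cmult) measurable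
  also have "\<dots> < \<infinity>"
    using insert.IH[of "R + 1"] by (simp add: ennreal_mult_less_top)
  finally show ?case
    by (auto simp: ennreal_mult_less_top emeasure_ball unit_ball_vol_2)
qed

text \<open>For \<open>\<mu> \<ge> 0\<close> the weight is bounded.  The case \<open>-1 < \<mu> < 0\<close>, which corresponds to parameters between
  \<open>2n - 1\<close> and \<open>2n\<close>, is the one that needs the estimates above.\<close>

lemma weight_integrable:
  assumes "\<mu> > -1"
  shows "(\<integral>\<^sup>+Z. indicator cartan_domain Z * ennreal (gap Z powr \<mu>) \<partial>(lborel :: 'n::finite cmat measure)) < \<infinity>"
proof (cases "\<mu> < 0")
  case True
  have "indicator cartan_domain Z * ennreal (gap Z powr \<mu>) = partial_weight \<mu> UNIV (real CARD('n) + 1) Z" for Z :: "'n cmat"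
    using norm_cartan_domain[of Z] by (auto simp: partial_weight_def cartan_domain_iff indicator_def)
  then show ?thesis
    using partial_weight_finite[OF assms True, of UNIV "real CARD('n) + 1"] by simp
next
  case False
  have "compact (closure (cartan_domain :: 'n cmat set))"
    using bounded_cartan_domain by (simp add: compact_closure)
  then have "bounded (gap ` closure (cartan_domain :: 'n cmat set))"
    by (intro compact_imp_bounded compact_continuous_image continuous_intros)
  then obtain K where K: "\<And>Z::'n cmat. Z \<in> cartan_domain \<Longrightarrow> \<bar>gap Z\<bar> \<le> K"
    unfolding bounded_iff using closure_subset by fastforce
  have "gap Z powr \<mu> \<le> K powr \<mu>" if "Z \<in> cartan_domain" for Z :: "'n cmat"
    using K[OF that] gap_pos[of Z] that False by (intro powr_mono2) (auto simp: cartan_domain_iff)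
  then have "(\<integral>\<^sup>+Z. indicator cartan_domain Z * ennreal (gap Z powr \<mu>) \<partial>(lborel :: 'n cmat measure))
     \<le> (\<integral>\<^sup>+Z. ennreal (K powr \<mu>) * indicator cartan_domain Z \<partial>(lborel :: 'n cmat measure))"
    by (intro nn_integral_mono) (auto simp: indicator_def intro!: ennreal_leI)
  also have "\<dots> = ennreal (K powr \<mu>) * emeasure lborel (cartan_domain :: 'n cmat set)"
    using borel_open[OF open_cartan_domain] by (intro nn_integral_cmult_indicator) simp
  also have "\<dots> < \<infinity>"
    using emeasure_bounded_finite[OF bounded_cartan_domain[where 'n='n]] by (simp add: ennreal_mult_less_top)
  finally show ?thesis .
qed

section \<open>The weighted measure and its symmetries\<close>

text \<open>The uniqueness of translation invariant measures: with \<open>B\<close> the unit ball, the double integral of \<open>1\<^sub>B(y) 1\<^sub>A(T x + y)\<close> is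
  \<open>|B|\<close> times the measure of the preimage of \<open>A\<close> if \<open>x\<close> is integrated first, and \<open>|B| |A|\<close> after the substitution of
  \<open>y - T x\<close> for \<open>y\<close>.  The isometry enters only in that the preimages of balls are balls.\<close>

lemma lborel_distr_isometry:
  fixes T :: "'a::euclidean_space \<Rightarrow> 'a"
  assumes T: "linear T" and iso: "\<And>x. norm (T x) = norm x"
  shows "distr lborel borel T = lborel"
proof (rule measure_eqI)
  have inj: "inj T"
    unfolding linear_injective_0[OF T] using iso by (metis norm_eq_zero)
  then have "surj T"
    by (rule linear_inj_imp_surj[OF T])
  have [measurable]: "T \<in> borel_measurable borel"
    using T by (intro borel_measurable_continuous_onI linear_continuous_on linear_conv_bounded_linear[THEN iffD1])
  show "sets (distr lborel borel T) = sets lborel" by simp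
  fix A assume "A \<in> sets (distr lborel borel T)"
  then have [measurable]: "A \<in> sets borel" by simp
  have [measurable]: "ball b r \<in> sets borel" for b :: 'a and r
    by (rule borel_open) simp
  let ?B = "ball (0::'a) 1"
  let ?f = "\<lambda>x. indicator A x :: ennreal"
  have "emeasure lborel ?B * emeasure (distr lborel borel T) A = (\<integral>\<^sup>+y. indicator ?B y * (\<integral>\<^sup>+x. ?f (T x) \<partial>lborel) \<partial>lborel)"
  proof -
    have "emeasure (distr lborel borel T) A = (\<integral>\<^sup>+x. ?f (T x) \<partial>lborel)"
    proof -
      have "(\<integral>\<^sup>+x. ?f (T x) \<partial>lborel) = (\<integral>\<^sup>+x. ?f x \<partial>distr lborel borel T)"
        by (rule nn_integral_distr[symmetric]) auto
      then show ?thesis by simp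
    qed
    then show ?thesis
      by (simp add: nn_integral_multc)
  qed
  also have "\<dots> = (\<integral>\<^sup>+y. (\<integral>\<^sup>+x. indicator ?B y * ?f (T x + y) \<partial>lborel) \<partial>lborel)"
  proof (rule nn_integral_cong)
    fix y
    obtain b where b: "y = T b" using \<open>surj T\<close> by (metis surj_def)
    have "(\<integral>\<^sup>+x. ?f (T x) \<partial>lborel) = (\<integral>\<^sup>+x. ?f (T (x + b)) \<partial>lborel)"
      by (rule nn_integral_lborel_shift[symmetric]) measurable
    then show "indicator ?B y * (\<integral>\<^sup>+x. ?f (T x) \<partial>lborel) = (\<integral>\<^sup>+x. indicator ?B y * ?f (T x + y) \<partial>lborel)"
      by (simp add: nn_integral_cmult b linear_add[OF T])
  qed
  also have "\<dots> = (\<integral>\<^sup>+x. (\<integral>\<^sup>+y. indicator ?B y * ?f (T x + y) \<partial>lborel) \<partial>lborel)"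
    by (rule lborel_pair.Fubini') measurable
  also have "\<dots> = (\<integral>\<^sup>+x. (\<integral>\<^sup>+y. indicator ?B (y - T x) * ?f y \<partial>lborel) \<partial>lborel)"
  proof (rule nn_integral_cong)
    fix x
    have "(\<integral>\<^sup>+y. indicator ?B (y - T x) * ?f y \<partial>lborel) = (\<integral>\<^sup>+y. indicator ?B ((y + T x) - T x) * ?f (y + T x) \<partial>lborel)"
      by (rule nn_integral_lborel_shift[symmetric]) measurable
    then show "(\<integral>\<^sup>+y. indicator ?B y * ?f (T x + y) \<partial>lborel) = (\<integral>\<^sup>+y. indicator ?B (y - T x) * ?f y \<partial>lborel)"
      by (simp add: add.commute)
  qed
  also have "\<dots> = (\<integral>\<^sup>+y. (\<integral>\<^sup>+x. indicator ?B (y - T x) * ?f y \<partial>lborel) \<partial>lborel)"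
    by (rule lborel_pair.Fubini') measurable
  also have "\<dots> = (\<integral>\<^sup>+y. emeasure lborel ?B * ?f y \<partial>lborel)"
  proof (rule nn_integral_cong)
    fix y
    obtain b where b: "y = T b" using \<open>surj T\<close> by (metis surj_def)
    have "indicator ?B (y - T x) = (indicator (ball b 1) x :: ennreal)" for x
      using iso[of "x - b"] norm_minus_commute[of x b] by (simp add: b linear_diff[OF T] indicator_def dist_norm)
    then have "(\<integral>\<^sup>+x. indicator ?B (y - T x) * ?f y \<partial>lborel) = emeasure lborel (ball b 1) * ?f y"
      by (simp add: nn_integral_multc)
    then show "(\<integral>\<^sup>+x. indicator ?B (y - T x) * ?f y \<partial>lborel) = emeasure lborel ?B * ?f y"
      by (simp add: emeasure_ball)
  qed
  also have "\<dots> = emeasure lborel ?B * emeasure lborel A"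
    by (simp add: nn_integral_cmult)
  finally show "emeasure (distr lborel borel T) A = emeasure lborel A"
    by (subst (asm) ennreal_mult_cancel_left)
       (auto simp: emeasure_ball ennreal_eq_0_iff simp flip: not_less)
qed

lemma lebesgue_distr_isometry:
  fixes T :: "'a::euclidean_space \<Rightarrow> 'a"
  assumes T: "linear T" and iso: "\<And>x. norm (T x) = norm x"
  shows "T \<in> lebesgue \<rightarrow>\<^sub>M lebesgue" "distr lebesgue lebesgue T = lebesgue"
proof -
  have [measurable]: "T \<in> borel_measurable borel"
    using T by (intro borel_measurable_continuous_onI linear_continuous_on linear_conv_bounded_linear[THEN iffD1])
  have m: "T \<in> lebesgue \<rightarrow>\<^sub>M lborel"
    by (simp add: measurable_completion)
  have "distr lborel lborel T = distr lborel borel T"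
    by (rule distr_cong) auto
  then have d: "distr lebesgue lborel T = lborel"
    using lborel_distr_isometry[OF assms] by (simp add: distr_completion)
  show "T \<in> lebesgue \<rightarrow>\<^sub>M lebesgue"
    by (rule completion.measurable_completion2[OF m]) (simp add: d)
  show "distr lebesgue lebesgue T = lebesgue"
    using completion.completion_distr_eq[OF m] by (simp add: d)
qed

lemma norm_ctransp [simp]: "norm (ctransp Z) = norm (Z :: 'n::finite cmat)"
proof -
  have "(norm (ctransp Z))\<^sup>2 = (\<Sum>i\<in>UNIV. \<Sum>j\<in>UNIV. (cmod (Z $ j $ i))\<^sup>2)"
    by (simp add: norm_vec_def L2_set_def sum_nonneg)
  also have "\<dots> = (\<Sum>j\<in>UNIV. \<Sum>i\<in>UNIV. (cmod (Z $ j $ i))\<^sup>2)"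
    by (rule sum.swap)
  also have "\<dots> = (norm Z)\<^sup>2"
    by (simp add: norm_vec_def L2_set_def sum_nonneg)
  finally show ?thesis by (simp add: power2_eq_iff_nonneg)
qed

lemma norm_unitary_mult:
  assumes U: "U \<in> unitary_group"
  shows "norm (U ** Z) = norm (Z :: 'n::finite cmat)" "norm (Z ** U) = norm Z"
proof -
  have *: "norm (U ** Z) = norm Z" if U: "U \<in> unitary_group" for U Z :: "'n cmat"
  proof -
    have c: "(norm Z)\<^sup>2 = (\<Sum>j\<in>UNIV. (norm (\<chi> i. Z $ i $ j))\<^sup>2)" for Z :: "'n cmat"
    proof -
      have "(norm Z)\<^sup>2 = (\<Sum>i\<in>UNIV. \<Sum>j\<in>UNIV. (cmod (Z $ i $ j))\<^sup>2)"
        by (simp add: norm_vec_def L2_set_def sum_nonneg)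
      also have "\<dots> = (\<Sum>j\<in>UNIV. \<Sum>i\<in>UNIV. (cmod (Z $ i $ j))\<^sup>2)"
        by (rule sum.swap)
      finally show ?thesis
        by (simp add: norm_vec_def L2_set_def sum_nonneg)
    qed
    have "(\<chi> i. (U ** Z) $ i $ j) = U *v (\<chi> i. Z $ i $ j)" for j
      by (simp add: vec_eq_iff matrix_matrix_mult_def matrix_vector_mult_def)
    then have "(norm (U ** Z))\<^sup>2 = (norm Z)\<^sup>2"
      by (simp only: c[of "U ** Z"] c[of Z] unitary_norm[OF U])
    then show ?thesis by (simp add: power2_eq_iff_nonneg)
  qed
  show "norm (U ** Z) = norm Z" using * U by blast
  have "norm (Z ** U) = norm (ctransp U ** ctransp Z)"
    by (metis ctransp_simps(3) norm_ctransp)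
  then show "norm (Z ** U) = norm Z"
    using *[OF unitary_ctransp[OF U]] by simp
qed

text \<open>The properties shared by left translations, right translations and rotations \<open>Z \<mapsto> c Z\<close> with \<open>|c| = 1\<close>; they
  suffice for acting unitarily on the Bergman space.\<close>

definition domain_symmetry :: "('n::finite cmat \<Rightarrow> 'n cmat) \<Rightarrow> bool" where
  "domain_symmetry \<phi> \<longleftrightarrow> linear \<phi> \<and> (\<forall>Z. norm (\<phi> Z) = norm Z) \<and> (\<forall>Z. \<phi> Z \<in> cartan_domain \<longleftrightarrow> Z \<in> cartan_domain)
     \<and> (\<forall>Z. gap (\<phi> Z) = gap Z) \<and> (\<forall>c Z. \<phi> (csc c Z) = csc c (\<phi> Z))"

lemma matmul_add_distrib: "(A + B) ** C = A ** C + B ** C" "C ** (A + B) = C ** A + C ** B"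
  for A B C :: "'n::finite cmat"
  by (simp_all add: vec_eq_iff matrix_matrix_mult_def algebra_simps sum.distrib)

lemma linear_matmul: "linear (\<lambda>Z :: 'n::finite cmat. U ** Z)" "linear (\<lambda>Z :: 'n::finite cmat. Z ** U)"
  by (auto intro!: linearI simp: matmul_add_distrib csc_of_real[symmetric] csc_mult)

lemma domain_symmetry_unitary:
  assumes U: "U \<in> unitary_group"
  shows "domain_symmetry (\<lambda>Z. U ** Z)" "domain_symmetry (\<lambda>Z. Z ** U)"
proof -
  have "U ** Z \<in> cartan_domain \<longleftrightarrow> Z \<in> cartan_domain" "Z ** U \<in> cartan_domain \<longleftrightarrow> Z \<in> cartan_domain" for Z
    unfolding cartan_domain_iff
    using contracts_unitary_mult[OF U] contracts_unitary_mult[OF unitary_ctransp[OF U]] unitary_cancel[OF U] by metis+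
  then show "domain_symmetry (\<lambda>Z. U ** Z)" "domain_symmetry (\<lambda>Z. Z ** U)"
    unfolding domain_symmetry_def
    using linear_matmul[of U] norm_unitary_mult[OF U] gap_unitary_mult[OF U] by (simp_all add: csc_mult)
qed

lemma domain_symmetry_rotation: "cmod c = 1 \<Longrightarrow> domain_symmetry (csc c)"
  using domain_symmetry_unitary(1)[OF csc_unitary, of c] by (simp add: csc_mult)

lemma borel_measurable_cnj [measurable (raw)]:
  "f \<in> borel_measurable M \<Longrightarrow> (\<lambda>x. cnj (f x)) \<in> borel_measurable M"
  by (rule borel_measurable_continuous_on[where f=cnj]) (intro continuous_intros)

locale weighted_bergman =
  fixes lam :: real and n_type :: "'n::finite itself"
  assumes lam: "lam > 2 * real CARD('n) - 1"
begin

abbreviation D :: "'n cmat set" where "D \<equiv> cartan_domain"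
abbreviation v :: "'n cmat measure" where "v \<equiv> v_measure lam"
abbreviation L2 :: "('n cmat \<Rightarrow> complex) set" where "L2 \<equiv> L2_space lam"
abbreviation H :: "('n cmat \<Rightarrow> complex) set" where "H \<equiv> bergman_space lam"
abbreviation inner2 :: "('n cmat \<Rightarrow> complex) \<Rightarrow> ('n cmat \<Rightarrow> complex) \<Rightarrow> complex" where "inner2 \<equiv> L2_inner lam"

definition weight :: "'n cmat \<Rightarrow> real" where
  "weight Z = norm_const TYPE('n) lam * gap Z powr (lam - 2 * real CARD('n))"

lemma D_sets [measurable]: "D \<in> sets borel"
  by (rule borel_open[OF open_cartan_domain])

text \<open>The total mass is proportional to the constant \<open>c\<close>, with factor the integral \<open>I\<close> of the weight.  As \<open>0 < I < \<infinity>\<close>,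
  exactly one value of \<open>c\<close> gives mass 1.\<close>

lemma norm_const: "norm_const TYPE('n) lam > 0" "emeasure v D = 1"
proof -
  let ?\<mu> = "lam - 2 * real CARD('n)"
  define I where "I = (\<integral>\<^sup>+Z. indicator D Z * ennreal (gap Z powr ?\<mu>) \<partial>lborel)"
  have fin: "I < \<infinity>"
    unfolding I_def using lam by (intro weight_integrable) simp
  have e: "emeasure (scaled_measure lam c :: 'n cmat measure) D = ennreal c * I" if "c > 0" for c
  proof -
    have "emeasure (scaled_measure lam c :: 'n cmat measure) D =
       (\<integral>\<^sup>+Z. ennreal (c * gap Z powr ?\<mu>) * indicator D Z \<partial>lebesgue_on D)"
      unfolding scaled_measure_def gap_def[symmetric]
      by (subst emeasure_density) (auto intro!: measurable_restrict_space1 measurable_completion simp: sets_restrict_space)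
    also have "\<dots> = (\<integral>\<^sup>+Z. ennreal (c * gap Z powr ?\<mu>) * indicator D Z * indicator D Z \<partial>lebesgue)"
      by (rule nn_integral_restrict_space) auto
    also have "\<dots> = (\<integral>\<^sup>+Z. ennreal c * (indicator D Z * ennreal (gap Z powr ?\<mu>)) \<partial>lborel)"
      using that by (subst nn_integral_completion) (auto intro!: nn_integral_cong simp: indicator_def ennreal_mult)
    also have "\<dots> = ennreal c * I"
      unfolding I_def by (rule nn_integral_cmult) measurable
    finally show ?thesis .
  qed
  have "I \<noteq> 0"
  proof
    assume "I = 0"
    then have "AE Z in lborel. indicator D Z * ennreal (gap Z powr ?\<mu>) = 0"
      unfolding I_def by (subst (asm) nn_integral_0_iff_AE) auto
    then have "AE Z in lborel. Z \<notin> D"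
    proof eventually_elim
      case (elim Z)
      then show ?case
        using gap_pos[of Z] by (auto simp: indicator_def cartan_domain_iff split: if_splits)
    qed
    then have "emeasure lborel D = 0"
      by (subst (asm) AE_iff_measurable[OF _ refl]) auto
    moreover have "emeasure lborel (ball (0 :: 'n cmat) 1) \<le> emeasure lborel D"
      by (rule emeasure_mono) (auto intro: ball_subset_cartan_domain)
    ultimately show False
      by (simp add: emeasure_ball ennreal_eq_0_iff flip: not_less)
  qed
  then obtain r where r: "I = ennreal r" "r > 0"
    using fin by (cases I) (auto simp: less_le)
  have "norm_const TYPE('n) lam = 1 / r"
    unfolding norm_const_def
  proof (rule the_equality)
    show "0 < 1 / r \<and> emeasure (scaled_measure lam (1 / r) :: 'n cmat measure) D = 1"
      using r e[of "1/r"] by (simp flip: ennreal_mult)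
    fix c assume c: "0 < c \<and> emeasure (scaled_measure lam c :: 'n cmat measure) D = 1"
    then have "ennreal (c * r) = 1"
      using r e[of c] by (simp add: ennreal_mult)
    then show "c = 1 / r"
      using r by (simp add: field_simps)
  qed
  then show "norm_const TYPE('n) lam > 0" "emeasure v D = 1"
    using r e[of "1/r"] by (simp_all add: v_measure_def flip: ennreal_mult)
qed

lemma v_eq: "v = density (lebesgue_on D) (\<lambda>Z. ennreal (weight Z))"
  by (simp add: v_measure_def scaled_measure_def weight_def gap_def)

lemma weight_pos: "Z \<in> D \<Longrightarrow> weight Z > 0"
  using norm_const(1) gap_pos[of Z] by (simp add: weight_def cartan_domain_iff)

lemma weight_nonneg [simp]: "weight Z \<ge> 0"
  using norm_const(1) by (simp add: weight_def)

lemma borel_weight [measurable]: "weight \<in> borel_measurable borel"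
  unfolding weight_def by measurable

lemma weight_continuous: "continuous_on D weight"
  unfolding weight_def
  by (intro continuous_intros) (auto simp: cartan_domain_iff dest: gap_nonzero)

lemma space_v [simp]: "space v = D"
  by (simp add: v_eq space_restrict_space)

lemma sets_v: "sets v = sets (lebesgue_on D)"
  by (simp add: v_eq)

sublocale v: finite_measure v
  by (rule finite_measureI) (simp add: norm_const)

lemma borel_measurable_v: "f \<in> borel_measurable v \<longleftrightarrow> f \<in> borel_measurable (lebesgue_on D)"
  by (simp add: measurable_cong_sets[OF sets_v refl])

lemma borel_imp_v [measurable (raw)]: "f \<in> borel \<rightarrow>\<^sub>M N \<Longrightarrow> f \<in> v \<rightarrow>\<^sub>M N"
  by (subst measurable_cong_sets[OF sets_v refl]) (auto intro!: measurable_restrict_space1 measurable_completion)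

lemma nn_integral_v:
  assumes "f \<in> borel_measurable v"
  shows "(\<integral>\<^sup>+Z. f Z \<partial>v) = (\<integral>\<^sup>+Z. ennreal (weight Z) * f Z * indicator D Z \<partial>lebesgue)"
proof -
  have [measurable]: "f \<in> borel_measurable (lebesgue_on D)"
    using assms by (simp add: borel_measurable_v)
  have "(\<integral>\<^sup>+Z. f Z \<partial>v) = (\<integral>\<^sup>+Z. ennreal (weight Z) * f Z \<partial>lebesgue_on D)"
    unfolding v_eq
    by (rule nn_integral_density) (auto intro!: measurable_restrict_space1 measurable_completion)
  also have "\<dots> = (\<integral>\<^sup>+Z. ennreal (weight Z) * f Z * indicator D Z \<partial>lebesgue)"
    by (rule nn_integral_restrict_space) auto
  finally show ?thesis .
qed

lemma AE_v: "(AE Z in lebesgue_on D. P Z) \<Longrightarrow> (AE Z in v. P Z)"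
  unfolding v_eq by (subst AE_density) (auto intro!: measurable_restrict_space1 measurable_completion)

lemma domain_symmetry_measure:
  assumes \<phi>: "domain_symmetry \<phi>"
  shows "\<phi> \<in> v \<rightarrow>\<^sub>M v" "distr v v \<phi> = v"
proof -
  have lin: "linear \<phi>" "\<And>Z. norm (\<phi> Z) = norm Z" and D: "\<And>Z. \<phi> Z \<in> D \<longleftrightarrow> Z \<in> D"
    and g: "\<And>Z. gap (\<phi> Z) = gap Z"
    using \<phi> by (auto simp: domain_symmetry_def)
  note leb = lebesgue_distr_isometry[OF lin]
  show m: "\<phi> \<in> v \<rightarrow>\<^sub>M v"
    using leb(1) D by (subst measurable_cong_sets[OF sets_v sets_v]) (auto intro!: measurable_restrict_space3)
  show "distr v v \<phi> = v"
  proof (rule measure_eqI)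
    fix A assume "A \<in> sets (distr v v \<phi>)"
    then have A: "A \<in> sets v" by simp
    then have AD: "A \<subseteq> D" using sets.sets_into_space by fastforce
    have pre: "\<phi> -` A \<inter> D \<in> sets v"
      using measurable_sets[OF m A] by simp
    have AL: "A \<in> sets lebesgue"
      using A by (auto simp: sets_v sets_restrict_space)
    have "emeasure (distr v v \<phi>) A = (\<integral>\<^sup>+Z. indicator (\<phi> -` A \<inter> D) Z \<partial>v)"
      using m A pre by (simp add: emeasure_distr)
    also have "\<dots> = (\<integral>\<^sup>+Z. ennreal (weight Z) * indicator (\<phi> -` A \<inter> D) Z * indicator D Z \<partial>lebesgue)"
      by (rule nn_integral_v) (use pre in auto)
    also have "\<dots> = (\<integral>\<^sup>+Z. ennreal (weight (\<phi> Z)) * indicator A (\<phi> Z) * indicator D (\<phi> Z) \<partial>lebesgue)"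
      by (rule nn_integral_cong) (auto simp: indicator_def D weight_def g)
    also have "\<dots> = (\<integral>\<^sup>+Z. ennreal (weight Z) * indicator A Z * indicator D Z \<partial>distr lebesgue lebesgue \<phi>)"
    proof -
      have [measurable]: "weight \<in> borel_measurable lebesgue" "A \<in> sets lebesgue" "D \<in> sets lebesgue"
        using AL by (auto intro: measurable_completion)
      have m: "(\<lambda>Z. ennreal (weight Z) * indicator A Z * indicator D Z) \<in> borel_measurable lebesgue"
        by measurable
      show ?thesis
        by (rule nn_integral_distr[symmetric, OF leb(1)]) (simp add: m leb(2))
    qed
    also have "\<dots> = (\<integral>\<^sup>+Z. indicator A Z \<partial>v)"
      unfolding leb(2) by (rule nn_integral_v[symmetric]) (use A in auto)
    also have "\<dots> = emeasure v A"
      using A by simp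
    finally show "emeasure (distr v v \<phi>) A = emeasure v A" .
  qed simp
qed

subsection \<open>Square integrable functions\<close>

text \<open>The squared norm is used in place of the norm throughout, because it is a quadratic form.\<close>

definition nsq :: "('n cmat \<Rightarrow> complex) \<Rightarrow> real" where
  "nsq f = (\<integral>Z. (cmod (f Z))\<^sup>2 \<partial>v)"

lemma L2_iff: "f \<in> L2 \<longleftrightarrow> f \<in> borel_measurable v \<and> integrable v (\<lambda>Z. (cmod (f Z))\<^sup>2)"
  by (simp add: L2_space_def)

lemma L2_measurable: "f \<in> L2 \<Longrightarrow> f \<in> borel_measurable v"
  by (simp add: L2_iff)

lemma nsq_nonneg [simp]: "nsq f \<ge> 0"
  by (simp add: nsq_def)

lemma L2_norm_nsq: "L2_norm lam f = sqrt (nsq f)" "(L2_norm lam f)\<^sup>2 = nsq f"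
  by (simp_all add: L2_norm_def nsq_def)

lemma L2_prod_integrable:
  assumes "f \<in> L2" "g \<in> L2"
  shows "integrable v (\<lambda>Z. f Z * g Z)" "integrable v (\<lambda>Z. f Z * cnj (g Z))"
proof -
  have [measurable]: "f \<in> borel_measurable v" "g \<in> borel_measurable v"
    using assms by (simp_all add: L2_iff)
  have i: "integrable v (\<lambda>Z. (cmod (f Z))\<^sup>2 + (cmod (g Z))\<^sup>2)"
    using assms by (simp add: L2_iff)
  have b: "cmod (f Z) * cmod (g Z) \<le> (cmod (f Z))\<^sup>2 + (cmod (g Z))\<^sup>2" for Z
    using sum_squares_bound[of "cmod (f Z)" "cmod (g Z)"] mult_nonneg_nonneg[OF norm_ge_zero norm_ge_zero, of "f Z" "g Z"]
    by linarith
  show "integrable v (\<lambda>Z. f Z * g Z)" "integrable v (\<lambda>Z. f Z * cnj (g Z))"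
    by (rule Bochner_Integration.integrable_bound[OF i]; use b in \<open>auto simp: norm_mult\<close>)+
qed

lemma L2_cnj: "f \<in> L2 \<Longrightarrow> (\<lambda>Z. cnj (f Z)) \<in> L2"
  by (auto simp: L2_iff)

lemma L2_mult_bounded:
  assumes "f \<in> L2" and a: "a \<in> borel_measurable v" "AE Z in v. cmod (a Z) \<le> C"
  shows "(\<lambda>Z. a Z * f Z) \<in> L2" "nsq (\<lambda>Z. a Z * f Z) \<le> C\<^sup>2 * nsq f"
proof -
  have [measurable]: "f \<in> borel_measurable v" "a \<in> borel_measurable v"
    using assms by (simp_all add: L2_iff)
  have i: "integrable v (\<lambda>Z. C\<^sup>2 * (cmod (f Z))\<^sup>2)"
    using assms by (simp add: L2_iff)
  have b: "AE Z in v. (cmod (a Z * f Z))\<^sup>2 \<le> C\<^sup>2 * (cmod (f Z))\<^sup>2"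
    using a(2)
  proof eventually_elim
    case (elim Z)
    then have "(cmod (a Z))\<^sup>2 \<le> C\<^sup>2" by (intro power_mono) auto
    then show ?case by (simp add: norm_mult power_mult_distrib mult_right_mono)
  qed
  have i': "integrable v (\<lambda>Z. (cmod (a Z * f Z))\<^sup>2)"
    by (rule Bochner_Integration.integrable_bound[OF i]) (use b in auto)
  then show "(\<lambda>Z. a Z * f Z) \<in> L2" by (simp add: L2_iff)
  have "nsq (\<lambda>Z. a Z * f Z) \<le> (\<integral>Z. C\<^sup>2 * (cmod (f Z))\<^sup>2 \<partial>v)"
    unfolding nsq_def by (rule integral_mono_AE[OF i' i b])
  then show "nsq (\<lambda>Z. a Z * f Z) \<le> C\<^sup>2 * nsq f"
    by (simp add: nsq_def)
qed

lemma L2_scale: "f \<in> L2 \<Longrightarrow> (\<lambda>Z. c * f Z) \<in> L2"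
  by (rule L2_mult_bounded(1)[where C="cmod c"]) auto

lemma L2_bounded:
  assumes "f \<in> borel_measurable v" "\<And>Z. Z \<in> D \<Longrightarrow> cmod (f Z) \<le> C" shows "f \<in> L2"
proof -
  have "(\<lambda>Z. 1) \<in> L2" by (simp add: L2_iff)
  moreover have "AE Z in v. cmod (f Z) \<le> C"
    using assms(2) by (intro AE_I2) simp
  ultimately show ?thesis
    using L2_mult_bounded(1)[of "\<lambda>Z. 1" f C] assms(1) by simp
qed

lemma L2_add: assumes "f \<in> L2" "g \<in> L2" shows "(\<lambda>Z. f Z + g Z) \<in> L2"
proof -
  have [measurable]: "f \<in> borel_measurable v" "g \<in> borel_measurable v"
    using assms by (simp_all add: L2_iff)
  have i: "integrable v (\<lambda>Z. 2 * (cmod (f Z))\<^sup>2 + 2 * (cmod (g Z))\<^sup>2)"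
    using assms by (simp add: L2_iff)
  have b: "(cmod (f Z + g Z))\<^sup>2 \<le> 2 * (cmod (f Z))\<^sup>2 + 2 * (cmod (g Z))\<^sup>2" for Z
  proof -
    have "(cmod (f Z + g Z))\<^sup>2 \<le> (cmod (f Z) + cmod (g Z))\<^sup>2"
      by (intro power_mono norm_triangle_ineq) auto
    then show ?thesis
      using sum_squares_bound[of "cmod (f Z)" "cmod (g Z)"] by (simp add: power2_sum)
  qed
  have "integrable v (\<lambda>Z. (cmod (f Z + g Z))\<^sup>2)"
    by (rule Bochner_Integration.integrable_bound[OF i]) (use b in auto)
  then show ?thesis by (simp add: L2_iff)
qed

lemma L2_diff: assumes "f \<in> L2" "g \<in> L2" shows "(\<lambda>Z. f Z - g Z) \<in> L2"
  using L2_add[OF assms(1) L2_scale[OF assms(2), of "-1"]] by simp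

lemma L2_integrable: "f \<in> L2 \<Longrightarrow> integrable v f"
  using L2_prod_integrable(1)[of f "\<lambda>Z. 1"] by (simp add: L2_iff)

lemma inner2_cnj: "inner2 g f = cnj (inner2 f g)"
  using Bochner_Integration.integral_cnj[of v "\<lambda>Z. f Z * cnj (g Z)"] by (simp add: L2_inner_def mult.commute)

lemma inner2_self: "inner2 f f = of_real (nsq f)"
  unfolding L2_inner_def nsq_def integral_complex_of_real[symmetric]
  by (simp only: complex_norm_square)

lemma inner2_scale_left: "inner2 (\<lambda>Z. c * f Z) g = c * inner2 f g"
  by (simp add: L2_inner_def mult.assoc)

lemma inner2_scale_right: "inner2 f (\<lambda>Z. c * g Z) = cnj c * inner2 f g"
  by (metis complex_cnj_mult inner2_cnj inner2_scale_left)

lemma inner2_add_left: "f \<in> L2 \<Longrightarrow> g \<in> L2 \<Longrightarrow> h \<in> L2 \<Longrightarrow> inner2 (\<lambda>Z. f Z + g Z) h = inner2 f h + inner2 g h"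
  by (simp add: L2_inner_def distrib_right L2_prod_integrable)

lemma inner2_diff_left: "f \<in> L2 \<Longrightarrow> g \<in> L2 \<Longrightarrow> h \<in> L2 \<Longrightarrow> inner2 (\<lambda>Z. f Z - g Z) h = inner2 f h - inner2 g h"
  by (simp add: L2_inner_def left_diff_distrib L2_prod_integrable)

lemma inner2_add_right: "f \<in> L2 \<Longrightarrow> g \<in> L2 \<Longrightarrow> h \<in> L2 \<Longrightarrow> inner2 f (\<lambda>Z. g Z + h Z) = inner2 f g + inner2 f h"
  by (simp add: L2_inner_def distrib_left L2_prod_integrable)

lemma nsq_add:
  assumes "f \<in> L2" "g \<in> L2" shows "nsq (\<lambda>Z. f Z + g Z) = nsq f + 2 * Re (inner2 f g) + nsq g"
proof -
  have "complex_of_real (nsq (\<lambda>Z. f Z + g Z)) = of_real (nsq f) + inner2 f g + cnj (inner2 f g) + of_real (nsq g)"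
    using assms by (simp add: inner2_self[symmetric] inner2_add_left inner2_add_right L2_add inner2_cnj[of g f])
  then show ?thesis by (simp add: complex_eq_iff)
qed

lemma nsq_scale: "nsq (\<lambda>Z. c * f Z) = (cmod c)\<^sup>2 * nsq f"
  by (simp add: nsq_def norm_mult power_mult_distrib)

lemma nsq_diff:
  assumes "f \<in> L2" "g \<in> L2" shows "nsq (\<lambda>Z. f Z - g Z) = nsq f - 2 * Re (inner2 f g) + nsq g"
  using nsq_add[OF assms(1) L2_scale[OF assms(2), of "-1"]] nsq_scale[of "-1" g] inner2_scale_right[of f "-1" g]
  by simp

lemma nsq_add_le:
  assumes "f \<in> L2" "g \<in> L2" shows "nsq (\<lambda>Z. f Z + g Z) \<le> 2 * nsq f + 2 * nsq g"
  using nsq_add[OF assms] nsq_diff[OF assms] nsq_nonneg[of "\<lambda>Z. f Z - g Z"] by linarith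

text \<open>Subtracting the best multiple of \<open>f\<close> lowers the squared norm of \<open>u\<close> by \<open>|\<langle>u, f\<rangle>|\<^sup>2 / |f|\<^sup>2\<close>.  For \<open>d = 0\<close> this is the Cauchy--Schwarz
  inequality; if \<open>u\<close> is the error of a nearly best approximation from a subspace and \<open>d\<close> the squared distance to it, then it says that
  \<open>u\<close> is nearly orthogonal to the subspace.\<close>

lemma inner2_bound:
  assumes u: "u \<in> L2" and f: "f \<in> L2" and d: "\<And>c. d \<le> nsq (\<lambda>Z. u Z - c * f Z)"
  shows "(cmod (inner2 u f))\<^sup>2 \<le> (nsq u - d) * nsq f"
proof -
  define I where "I = (cmod (inner2 u f))\<^sup>2"
  have q: "d \<le> nsq u - 2 * t * I + t\<^sup>2 * I * nsq f" for t :: real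
  proof -
    let ?c = "of_real t * inner2 u f"
    have "cnj ?c * inner2 u f = of_real (t * I)"
      unfolding I_def of_real_mult complex_norm_square by simp
    then have "Re (inner2 u (\<lambda>Z. ?c * f Z)) = t * I"
      by (simp only: inner2_scale_right Re_complex_of_real)
    moreover have "(cmod ?c)\<^sup>2 = t\<^sup>2 * I"
      by (simp add: norm_mult power_mult_distrib I_def)
    ultimately show ?thesis
      using d[of ?c] nsq_diff[OF u L2_scale[OF f, of ?c]] nsq_scale[of ?c f] by simp
  qed
  show ?thesis
  proof (cases "nsq f = 0")
    case True
    have "I = 0"
    proof (rule ccontr)
      assume "I \<noteq> 0"
      \<comment> \<open>The quadratic in \<open>t\<close> degenerates to a line; this \<open>t\<close> takes it to \<open>d - 1\<close>.\<close>
      define t where "t = (nsq u - d + 1) / (2 * I)"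
      have "2 * t * I = nsq u - d + 1"
        using \<open>I \<noteq> 0\<close> by (simp add: t_def)
      moreover have "d \<le> nsq u - 2 * t * I"
        using q[of t] by (simp only: True mult_zero_right add_0_right)
      ultimately show False by linarith
    qed
    then show ?thesis using True by (simp add: I_def)
  next
    case False
    then have n: "nsq f > 0" using nsq_nonneg[of f] by linarith
    have "d \<le> nsq u - I / nsq f"
      using q[of "1 / nsq f"] n by (simp add: power2_eq_square field_simps)
    then show ?thesis
      using n by (simp add: I_def field_simps)
  qed
qed

lemma cauchy_schwarz: "u \<in> L2 \<Longrightarrow> f \<in> L2 \<Longrightarrow> (cmod (inner2 u f))\<^sup>2 \<le> nsq u * nsq f"
  using inner2_bound[of u f 0] by simp

lemma inner2_symmetry:
  assumes "domain_symmetry \<phi>" "f \<in> borel_measurable v" "g \<in> borel_measurable v"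
  shows "inner2 (\<lambda>Z. f (\<phi> Z)) (\<lambda>Z. g (\<phi> Z)) = inner2 f g"
proof -
  note m = domain_symmetry_measure[OF assms(1)]
  have "inner2 f g = (\<integral>Z. f Z * cnj (g Z) \<partial>distr v v \<phi>)"
    by (simp add: m L2_inner_def)
  also have "\<dots> = inner2 (\<lambda>Z. f (\<phi> Z)) (\<lambda>Z. g (\<phi> Z))"
    unfolding L2_inner_def by (rule integral_distr) (use m assms in auto)
  finally show ?thesis by simp
qed

lemma L2_symmetry:
  assumes "domain_symmetry \<phi>" "f \<in> L2" shows "(\<lambda>Z. f (\<phi> Z)) \<in> L2"
proof -
  note m = domain_symmetry_measure[OF assms(1)]
  have [measurable]: "f \<in> borel_measurable v" and [measurable]: "\<phi> \<in> v \<rightarrow>\<^sub>M v"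
    using assms m by (simp_all add: L2_iff)
  have "integrable (distr v v \<phi>) (\<lambda>Z. (cmod (f Z))\<^sup>2)"
    using assms(2) by (simp add: m L2_iff)
  then have "integrable v (\<lambda>Z. (cmod (f (\<phi> Z)))\<^sup>2)"
    by (subst (asm) integrable_distr_eq) auto
  then show ?thesis by (simp add: L2_iff)
qed

end

section \<open>Averages over the circle\<close>

definition circ :: "real measure" where
  "circ = restrict_space lborel {0..1}"

text \<open>A parametrisation of the unit circle by \<open>[0, 1]\<close>, normalised so that averages are integrals over \<open>circ\<close>.\<close>

definition expi :: "real \<Rightarrow> complex" where
  "expi t = exp (2 * of_real pi * \<i> * of_real t)"

lemma cmod_expi [simp]: "cmod (expi t) = 1"
  by (simp add: expi_def norm_exp_eq_Re)

lemma expi_nonzero [simp]: "expi t \<noteq> 0"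
  by (simp add: expi_def)

lemma space_circ [simp]: "space circ = {0..1}"
  by (simp add: circ_def space_restrict_space)

lemma finite_measure_circ: "finite_measure circ"
  by (rule finite_measureI) (simp add: circ_def emeasure_restrict_space)

lemma measure_circ: "measure circ {0..1} = 1"
  by (simp add: circ_def measure_restrict_space)

lemma continuous_expi [continuous_intros]: "continuous_on A f \<Longrightarrow> continuous_on A (\<lambda>x. expi (f x))"
  unfolding expi_def by (intro continuous_intros)

lemma borel_imp_circ [measurable (raw)]: "f \<in> borel \<rightarrow>\<^sub>M N \<Longrightarrow> f \<in> circ \<rightarrow>\<^sub>M N"
  unfolding circ_def by (rule measurable_restrict_space1) simp

lemma borel_expi [measurable]: "expi \<in> borel_measurable borel"
  by (intro borel_measurable_continuous_onI continuous_intros)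

text \<open>Cauchy's formula on the unit circle, as a Lebesgue integral so that convergence theorems and Fubini's theorem
  apply to it.\<close>

lemma taylor_coefficient_integral:
  assumes g: "g holomorphic_on ball 0 R" and R: "R > 1"
  shows "(\<integral>t. g (expi t) / expi t ^ k \<partial>circ) = (deriv ^^ k) g 0 / fact k"
    and "integrable circ (\<lambda>t. g (expi t) / expi t ^ k)"
proof -
  have c: "continuous_on (cball 0 1) g"
    using R by (intro holomorphic_on_imp_continuous_on holomorphic_on_subset[OF g]) auto
  have h: "g holomorphic_on ball 0 1"
    using R by (intro holomorphic_on_subset[OF g]) auto
  have "((\<lambda>u. g u / (u - 0) ^ Suc k) has_contour_integral (2 * pi * \<i>) / fact k * (deriv ^^ k) g 0) (circlepath 0 1)"
    by (rule Cauchy_has_contour_integral_higher_derivative_circlepath[OF c h]) simp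
  then have "((\<lambda>t. g (circlepath 0 1 t) / circlepath 0 1 t ^ Suc k * vector_derivative (circlepath 0 1) (at t within {0..1}))
     has_integral (2 * pi * \<i>) / fact k * (deriv ^^ k) g 0) {0..1}"
    by (simp add: has_contour_integral_def)
  then have J: "((\<lambda>t. g (circlepath 0 1 t) / circlepath 0 1 t ^ Suc k * vector_derivative (circlepath 0 1) (at t within {0..1}))
     has_integral (2 * pi * \<i>) * ((deriv ^^ k) g 0 / fact k)) {0..1}"
    by simp
  have eq: "g (circlepath 0 1 t) / circlepath 0 1 t ^ Suc k * vector_derivative (circlepath 0 1) (at t within {0..1})
      = (2 * pi * \<i>) * (g (expi t) / expi t ^ k)" if "t \<in> {0..1}" for t
  proof -
    have 1: "circlepath 0 1 t = expi t"
      by (simp add: circlepath expi_def mult_ac)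
    have 2: "vector_derivative (circlepath 0 1) (at t within {0..1}) = (2 * pi * \<i>) * expi t"
      using that vector_derivative_circlepath01[of t 0 1] by (simp add: expi_def)
    show ?thesis
      unfolding 1 2 by (simp add: field_simps)
  qed
  have "((\<lambda>t. (2 * pi * \<i>) * (g (expi t) / expi t ^ k)) has_integral (2 * pi * \<i>) * ((deriv ^^ k) g 0 / fact k)) {0..1}"
    by (rule has_integral_eq[OF eq J])
  then have "((\<lambda>t. 1 / (2 * pi * \<i>) * ((2 * pi * \<i>) * (g (expi t) / expi t ^ k))) has_integral 1 / (2 * pi * \<i>) * ((2 * pi * \<i>) * ((deriv ^^ k) g 0 / fact k))) {0..1}"
    by (rule has_integral_mult_right)
  then have I: "((\<lambda>t. g (expi t) / expi t ^ k) has_integral ((deriv ^^ k) g 0 / fact k)) {0..1}"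
    by simp
  have cont: "continuous_on {0..1} (\<lambda>t. g (expi t) / expi t ^ k)"
    by (intro continuous_intros continuous_on_compose2[OF c]) auto
  have si: "set_integrable lborel {0..1} (\<lambda>t. g (expi t) / expi t ^ k)"
    unfolding set_integrable_def using cont by (intro borel_integrable_compact) auto
  show "integrable circ (\<lambda>t. g (expi t) / expi t ^ k)"
    using si unfolding circ_def set_integrable_def by (subst integrable_restrict_space) auto
  have "(\<integral>t. g (expi t) / expi t ^ k \<partial>circ) = (LINT t : {0..1} | lborel. g (expi t) / expi t ^ k)"
    unfolding circ_def set_lebesgue_integral_def by (rule integral_restrict_space) auto
  also have "\<dots> = integral {0..1} (\<lambda>t. g (expi t) / expi t ^ k)"
    by (rule set_borel_integral_eq_integral[OF si])
  also have "\<dots> = (deriv ^^ k) g 0 / fact k"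
    by (rule integral_unique[OF I])
  finally show "(\<integral>t. g (expi t) / expi t ^ k \<partial>circ) = (deriv ^^ k) g 0 / fact k" .
qed

section \<open>Holomorphic functions of a matrix\<close>

text \<open>The derivative as a complex linear map; holomorphic functions are exactly those for which the choice succeeds.\<close>

definition cderiv :: "('n::finite cmat \<Rightarrow> complex) \<Rightarrow> 'n cmat \<Rightarrow> 'n cmat \<Rightarrow> complex" where
  "cderiv f Z = (SOME f'. (f has_derivative f') (at Z) \<and> (\<forall>c H. f' (csc c H) = c * f' H))"

lemma holomorphic_mat_iff:
  assumes "open S"
  shows "holomorphic_mat f S \<longleftrightarrow> (\<forall>Z\<in>S. \<exists>f'. (f has_derivative f') (at Z) \<and> (\<forall>c H. f' (csc c H) = c * f' H))"
proof -
  have "(f has_derivative f') (at Z within S) \<longleftrightarrow> (f has_derivative f') (at Z)" if "Z \<in> S" for f' Z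
    using at_within_open[OF that assms] by simp
  then show ?thesis
    unfolding holomorphic_mat_def csc_def[symmetric] by blast
qed

lemma cderiv:
  assumes "open S" "holomorphic_mat f S" "Z \<in> S"
  shows "(f has_derivative cderiv f Z) (at Z)" "cderiv f Z (csc c H) = c * cderiv f Z H"
proof -
  have "\<exists>f'. (f has_derivative f') (at Z) \<and> (\<forall>c H. f' (csc c H) = c * f' H)"
    using assms holomorphic_mat_iff by blast
  from someI_ex[OF this] show "(f has_derivative cderiv f Z) (at Z)" "cderiv f Z (csc c H) = c * cderiv f Z H"
    unfolding cderiv_def by auto
qed

lemma cderiv_add: "open S \<Longrightarrow> holomorphic_mat f S \<Longrightarrow> Z \<in> S \<Longrightarrow> cderiv f Z (A + B) = cderiv f Z A + cderiv f Z B"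
  using has_derivative_linear[OF cderiv(1)] by (metis linear_add)

lemma holomorphic_mat_continuous:
  assumes "open S" "holomorphic_mat f S" shows "continuous_on S f"
  using cderiv(1)[OF assms] has_derivative_continuous assms(1) continuous_on_eq_continuous_at by blast

lemma holomorphic_mat_cong:
  assumes "\<And>Z. Z \<in> S \<Longrightarrow> f Z = g Z" "holomorphic_mat f S" shows "holomorphic_mat g S"
  unfolding holomorphic_mat_def
proof
  fix Z assume Z: "Z \<in> S"
  then obtain f' where f': "(f has_derivative f') (at Z within S)" "\<forall>c H. f' (\<chi> i j. c * H $ i $ j) = c * f' H"
    using assms(2) unfolding holomorphic_mat_def by blast
  have "(g has_derivative f') (at Z within S)"
    by (rule has_derivative_transform[OF Z _ f'(1)]) (simp add: assms(1))
  then show "\<exists>f'. (g has_derivative f') (at Z within S) \<and> (\<forall>c H. f' (\<chi> i j. c * H $ i $ j) = c * f' H)"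
    using f'(2) by blast
qed

lemma holomorphic_mat_const: "holomorphic_mat (\<lambda>Z. c) S"
  unfolding holomorphic_mat_def by (auto intro!: exI[of _ "\<lambda>H. 0"])

lemma holomorphic_mat_add:
  assumes "open S" "holomorphic_mat f S" "holomorphic_mat g S" shows "holomorphic_mat (\<lambda>Z. f Z + g Z) S"
  unfolding holomorphic_mat_iff[OF assms(1)]
proof
  fix Z assume Z: "Z \<in> S"
  show "\<exists>f'. ((\<lambda>Z. f Z + g Z) has_derivative f') (at Z) \<and> (\<forall>c H. f' (csc c H) = c * f' H)"
    by (rule exI[of _ "\<lambda>H. cderiv f Z H + cderiv g Z H"])
       (auto intro!: has_derivative_add cderiv[OF assms(1,2) Z] cderiv[OF assms(1,3) Z]
         simp: cderiv(2)[OF assms(1,2) Z] cderiv(2)[OF assms(1,3) Z] distrib_left)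
qed

lemma holomorphic_mat_mult:
  assumes "open S" "holomorphic_mat f S" "holomorphic_mat g S" shows "holomorphic_mat (\<lambda>Z. f Z * g Z) S"
  unfolding holomorphic_mat_iff[OF assms(1)]
proof
  fix Z assume Z: "Z \<in> S"
  show "\<exists>f'. ((\<lambda>Z. f Z * g Z) has_derivative f') (at Z) \<and> (\<forall>c H. f' (csc c H) = c * f' H)"
    using has_derivative_mult[OF cderiv(1)[OF assms(1,2) Z] cderiv(1)[OF assms(1,3) Z]]
    by (intro exI conjI)
       (assumption, simp add: cderiv(2)[OF assms(1,2) Z] cderiv(2)[OF assms(1,3) Z] algebra_simps)
qed

lemma holomorphic_mat_scale: "open S \<Longrightarrow> holomorphic_mat f S \<Longrightarrow> holomorphic_mat (\<lambda>Z. c * f Z) S"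
  by (rule holomorphic_mat_mult[OF _ holomorphic_mat_const])

lemma holomorphic_mat_compose_linear:
  fixes \<phi> :: "'n::finite cmat \<Rightarrow> 'n cmat"
  assumes "open S" "holomorphic_mat f S" "open T" and \<phi>: "linear \<phi>" "\<And>c Z. \<phi> (csc c Z) = csc c (\<phi> Z)"
    and im: "\<And>Z. Z \<in> T \<Longrightarrow> \<phi> Z \<in> S"
  shows "holomorphic_mat (\<lambda>Z. f (\<phi> Z)) T"
  unfolding holomorphic_mat_iff[OF assms(3)]
proof
  fix Z assume Z: "Z \<in> T"
  have "(\<phi> has_derivative \<phi>) (at Z)"
    using \<phi>(1) by (intro bounded_linear_imp_has_derivative linear_conv_bounded_linear[THEN iffD1])
  from has_derivative_compose[OF this cderiv(1)[OF assms(1,2) im[OF Z]]]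
  have "((\<lambda>Z. f (\<phi> Z)) has_derivative (\<lambda>H. cderiv f (\<phi> Z) (\<phi> H))) (at Z)" .
  moreover have "cderiv f (\<phi> Z) (\<phi> (csc c H)) = c * cderiv f (\<phi> Z) (\<phi> H)" for c H
    by (simp add: \<phi>(2) cderiv(2)[OF assms(1,2) im[OF Z]])
  ultimately show "\<exists>f'. ((\<lambda>Z. f (\<phi> Z)) has_derivative f') (at Z) \<and> (\<forall>c H. f' (csc c H) = c * f' H)"
    by blast
qed

lemma linear_csc: "linear (csc c)"
  using bounded_linear_csc by (rule bounded_linear.linear)

text \<open>The chain rule along a holomorphic curve; through it, one-variable theory is applied on complex lines.\<close>

lemma holomorphic_mat_curve:
  fixes P :: "complex \<Rightarrow> 'n::finite cmat"
  assumes "open S" "holomorphic_mat f S" "P z \<in> S"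
    and P: "\<And>i j. ((\<lambda>z. P z $ i $ j) has_field_derivative P' $ i $ j) (at z)"
  shows "((\<lambda>z. f (P z)) has_field_derivative cderiv f (P z) P') (at z)"
proof -
  define E where "E i j = (\<chi> a b. if a = i then if b = j then 1 else 0 else (0 :: complex))" for i j :: 'n
  have rep: "(\<Sum>i\<in>UNIV. \<Sum>j\<in>UNIV. csc (Q $ i $ j) (E i j)) = Q" for Q :: "'n cmat"
  proof -
    have "(\<Sum>i\<in>UNIV. \<Sum>j\<in>UNIV. csc (Q $ i $ j) (E i j)) $ a $ b = Q $ a $ b" for a b
    proof -
      have "(\<Sum>i\<in>UNIV. \<Sum>j\<in>UNIV. csc (Q $ i $ j) (E i j)) $ a $ b =
          (\<Sum>i\<in>UNIV. \<Sum>j\<in>UNIV. if a = i then if b = j then Q $ i $ j else 0 else 0)"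
        by (simp add: E_def) (intro sum.cong refl, simp)
      also have "\<dots> = (\<Sum>i\<in>UNIV. if a = i then \<Sum>j\<in>UNIV. if b = j then Q $ i $ j else 0 else 0)"
        by (intro sum.cong) auto
      finally show ?thesis by simp
    qed
    then show ?thesis by (simp add: vec_eq_iff)
  qed
  have bl: "bounded_linear (\<lambda>c. csc c A)" for A :: "'n cmat"
    by (rule bounded_linear_intro[where K="norm A"]) (auto simp: csc_add vec_eq_iff algebra_simps)
  have d: "((\<lambda>z. csc (P z $ i $ j) (E i j)) has_derivative (\<lambda>h. csc (P' $ i $ j * h) (E i j))) (at z)" for i j
    using P[of i j] unfolding has_field_derivative_def by (rule bounded_linear.has_derivative[OF bl])
  have "((\<lambda>z. \<Sum>i\<in>UNIV. \<Sum>j\<in>UNIV. csc (P z $ i $ j) (E i j)) has_derivative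
      (\<lambda>h. \<Sum>i\<in>UNIV. \<Sum>j\<in>UNIV. csc (P' $ i $ j * h) (E i j))) (at z)"
    by (intro has_derivative_sum d)
  moreover have "(\<Sum>i\<in>UNIV. \<Sum>j\<in>UNIV. csc (P' $ i $ j * h) (E i j)) = csc h P'" for h
    using rep[of "csc h P'"] by (simp add: mult.commute)
  ultimately have "(P has_derivative (\<lambda>h. csc h P')) (at z)"
    by (simp only: rep)
  from has_derivative_compose[OF this cderiv(1)[OF assms(1-3)]]
  have "((\<lambda>z. f (P z)) has_derivative (\<lambda>h. cderiv f (P z) (csc h P'))) (at z)" .
  moreover have "(\<lambda>h. cderiv f (P z) (csc h P')) = (*) (cderiv f (P z) P')"
    by (rule ext) (simp add: cderiv(2)[OF assms(1-3)])
  ultimately show ?thesis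
    by (simp add: has_field_derivative_def)
qed

lemma holomorphic_mat_on_curve:
  assumes "open S" "holomorphic_mat f S" "open T" "\<And>z. z \<in> T \<Longrightarrow> P z \<in> S"
    and "\<And>i j. (\<lambda>z. P z $ i $ j) holomorphic_on T"
  shows "(\<lambda>z. f (P z)) holomorphic_on T"
  unfolding holomorphic_on_open[OF assms(3)]
proof
  fix z assume z: "z \<in> T"
  have "((\<lambda>z. P z $ i $ j) has_field_derivative (\<chi> i j. deriv (\<lambda>z. P z $ i $ j) z) $ i $ j) (at z)" for i j
    using holomorphic_derivI[OF assms(5,3) z] by simp
  from holomorphic_mat_curve[OF assms(1,2) assms(4)[OF z] this]
  show "\<exists>f'. ((\<lambda>z. f (P z)) has_field_derivative f') (at z)"
    by blast
qed

text \<open>Cauchy's inequalities on the complex line through \<open>Z\<close> in direction \<open>H\<close>.  The constants depend on \<open>f\<close> only through the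
  bound \<open>M\<close>, so these estimates are inherited by limits and by integrals of holomorphic functions.\<close>

lemma holomorphic_mat_taylor:
  fixes f :: "'n::finite cmat \<Rightarrow> complex"
  assumes S: "open S" "holomorphic_mat f S" and r: "cball Z r \<subseteq> S" "r > 0"
    and M: "\<And>W. W \<in> cball Z r \<Longrightarrow> cmod (f W) \<le> M"
  shows "cmod (cderiv f Z H) \<le> M / r * norm H"
    and "norm H \<le> r / 2 \<Longrightarrow> cmod (f (Z + H) - f Z - cderiv f Z H) \<le> 8 * M / r\<^sup>2 * (norm H)\<^sup>2"
proof -
  have ZS: "Z \<in> S" using r by auto
  have "cmod (cderiv f Z H) \<le> M / r * norm H \<and>
    (norm H \<le> r / 2 \<longrightarrow> cmod (f (Z + H) - f Z - cderiv f Z H) \<le> 8 * M / r\<^sup>2 * (norm H)\<^sup>2)"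
  proof (cases "H = 0")
    case True
    have "cderiv f Z 0 = 0"
      using cderiv(2)[OF S ZS, of 0 0] by simp
    with True show ?thesis by simp
  next
    case False
    define h where "h = complex_of_real (norm H)"
    define U where "U = csc (1 / h) H"
    have h: "h \<noteq> 0" using False by (simp add: h_def)
    have U: "norm U = 1" "csc h U = H"
      using h False by (simp_all add: U_def h_def norm_divide)
    define \<phi> where "\<phi> \<zeta> = f (Z + csc \<zeta> U)" for \<zeta>
    have inb: "Z + csc \<zeta> U \<in> cball Z r" if "\<zeta> \<in> cball 0 r" for \<zeta>
      using that U by (simp add: dist_norm)
    have hol: "\<phi> holomorphic_on ball 0 r"
      unfolding \<phi>_def using inb r
      by (intro holomorphic_mat_on_curve[OF S]) (auto intro!: holomorphic_intros)
    have cont: "continuous_on (cball 0 r) \<phi>"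
      unfolding \<phi>_def
    proof (rule continuous_on_compose2[OF holomorphic_mat_continuous[OF S]])
      show "continuous_on (cball 0 r) (\<lambda>\<zeta>. Z + csc \<zeta> U)" by (intro continuous_intros)
      show "(\<lambda>\<zeta>. Z + csc \<zeta> U) ` cball 0 r \<subseteq> S" using inb r by blast
    qed
    have d0: "deriv \<phi> 0 = cderiv f Z U"
    proof (rule DERIV_imp_deriv)
      have "((\<lambda>z. f (Z + csc z U)) has_field_derivative cderiv f (Z + csc 0 U) U) (at 0)"
        by (rule holomorphic_mat_curve[OF S]) (use ZS in \<open>auto intro!: derivative_eq_intros\<close>)
      then show "(\<phi> has_field_derivative cderiv f Z U) (at 0)"
        by (simp add: \<phi>_def[abs_def])
    qed
    have "cmod ((deriv ^^ 1) \<phi> 0) \<le> fact 1 * M / r ^ 1"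
      by (rule Cauchy_inequality[OF hol cont r(2)]) (use inb M in \<open>auto simp: \<phi>_def\<close>)
    then have 1: "cmod (cderiv f Z U) \<le> M / r"
      by (simp add: d0)
    have Hd: "cderiv f Z H = h * cderiv f Z U"
      using cderiv(2)[OF S ZS, of h U] U by simp
    have bound1: "cmod (cderiv f Z H) \<le> M / r * norm H"
      using mult_right_mono[OF 1, of "norm H"] by (simp add: Hd norm_mult h_def mult.commute)
    have bound2: "cmod (f (Z + H) - f Z - cderiv f Z H) \<le> 8 * M / r\<^sup>2 * (norm H)\<^sup>2" if H: "norm H \<le> r / 2"
    proof -
      \<comment> \<open>Cauchy's inequality on discs of radius \<open>r / 2\<close>: \<open>8 M / r\<^sup>2 = 2! M / (r/2)\<^sup>2\<close>.\<close>
      have B: "cmod ((deriv ^^ 2) \<phi> w) \<le> 8 * M / r\<^sup>2" if "w \<in> cball 0 (r / 2)" for w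
      proof -
        have "cball w (r / 2) \<subseteq> cball 0 r" "ball w (r / 2) \<subseteq> ball 0 r"
          using that r by (auto simp: cball_subset_cball_iff ball_subset_ball_iff)
        then have "cmod ((deriv ^^ 2) \<phi> w) \<le> fact 2 * M / (r / 2) ^ 2"
          using r(2) inb M
          by (intro Cauchy_inequality holomorphic_on_subset[OF hol] continuous_on_subset[OF cont])
             (auto simp: \<phi>_def subset_iff dist_norm norm_minus_commute)
        then show ?thesis by (simp add: power_divide)
      qed
      have "cmod ((deriv ^^ 0) \<phi> h - (\<Sum>i\<le>1. (deriv ^^ i) \<phi> 0 * (h - 0) ^ i / fact i)) \<le> 8 * M / r\<^sup>2 * cmod (h - 0) ^ Suc 1 / fact 1"
      proof (rule complex_Taylor[where S="cball 0 (r/2)" and f="\<lambda>i. (deriv ^^ i) \<phi>" and n=1])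
        show "((deriv ^^ i) \<phi> has_field_derivative (deriv ^^ Suc i) \<phi> x) (at x within cball 0 (r/2))" if "x \<in> cball 0 (r/2)" for i x
        proof -
          have "x \<in> ball 0 r" using that r by (simp add: dist_norm)
          then show ?thesis
            using holomorphic_derivI[OF holomorphic_higher_deriv[OF hol open_ball] open_ball]
            by (simp add: has_field_derivative_at_within)
        qed
        show "cmod ((deriv ^^ Suc 1) \<phi> x) \<le> 8 * M / r\<^sup>2" if "x \<in> cball 0 (r/2)" for x
          using B[OF that] by (simp add: numeral_2_eq_2)
      qed (use r H in \<open>auto simp: h_def\<close>)
      then have "cmod (\<phi> h - (\<phi> 0 + deriv \<phi> 0 * h)) \<le> 8 * M / r\<^sup>2 * (norm H)\<^sup>2"
        by (simp add: h_def power2_eq_square)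
      then show ?thesis
        by (simp add: \<phi>_def d0 Hd U algebra_simps)
    qed
    show ?thesis using bound1 bound2 by blast
  qed
  then show "cmod (cderiv f Z H) \<le> M / r * norm H"
    and "norm H \<le> r / 2 \<Longrightarrow> cmod (f (Z + H) - f Z - cderiv f Z H) \<le> 8 * M / r\<^sup>2 * (norm H)\<^sup>2"
    by blast+
qed

lemma holomorphic_matI_quadratic:
  fixes f :: "'n::finite cmat \<Rightarrow> complex"
  assumes "open S"
    and q: "\<And>Z. Z \<in> S \<Longrightarrow> \<exists>L C r. r > 0 \<and> (\<forall>A B. L (A + B) = L A + L B) \<and> (\<forall>c H. L (csc c H) = c * L H) \<and>
      (\<forall>H. norm H \<le> r \<longrightarrow> cmod (f (Z + H) - f Z - L H) \<le> C * (norm H)\<^sup>2)"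
  shows "holomorphic_mat f S"
  unfolding holomorphic_mat_iff[OF assms(1)]
proof
  fix Z assume "Z \<in> S"
  from q[OF this] obtain L C r where r: "r > 0" and add: "\<And>A B. L (A + B) = L A + L B"
    and sc: "\<And>c H. L (csc c H) = c * L H"
    and C: "\<And>H. norm H \<le> r \<Longrightarrow> cmod (f (Z + H) - f Z - L H) \<le> C * (norm H)\<^sup>2"
    by blast
  have "linear L"
    by (rule linearI) (simp add: add, simp add: csc_of_real[symmetric] sc scaleR_conv_of_real)
  then have "bounded_linear L"
    by (simp add: linear_conv_bounded_linear)
  moreover have "((\<lambda>H. norm (f (Z + H) - f Z - L H) / norm H) \<longlongrightarrow> 0) (at 0)"
  proof (rule Lim_null_comparison)
    show "\<forall>\<^sub>F H in at 0. norm (norm (f (Z + H) - f Z - L H) / norm H) \<le> C * norm H"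
      unfolding eventually_at
      using r C by (intro exI[of _ r]) (auto simp: dist_norm divide_le_eq power2_eq_square mult.assoc)
    show "((\<lambda>H. C * norm H) \<longlongrightarrow> 0) (at (0::'n cmat))"
      by (auto intro!: tendsto_eq_intros)
  qed
  ultimately have "(f has_derivative L) (at Z)"
    by (simp add: has_derivative_at)
  then show "\<exists>f'. (f has_derivative f') (at Z) \<and> (\<forall>c H. f' (csc c H) = c * f' H)"
    using sc by blast
qed

text \<open>The derivatives are circle integrals of the functions, so they converge by dominated convergence, and the
  quadratic error estimate of \<open>holomorphic_mat_taylor\<close> passes to the limit.\<close>

lemma holomorphic_mat_uniform_limit:
  fixes f :: "nat \<Rightarrow> 'n::finite cmat \<Rightarrow> complex"
  assumes S: "open S" and f: "\<And>k. holomorphic_mat (f k) S"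
    and lim: "\<And>Z. Z \<in> S \<Longrightarrow> (\<lambda>k. f k Z) \<longlonglongrightarrow> g Z"
    and bd: "\<And>Z. Z \<in> S \<Longrightarrow> \<exists>r M. r > 0 \<and> cball Z r \<subseteq> S \<and> (\<forall>k. \<forall>W\<in>cball Z r. cmod (f k W) \<le> M)"
  shows "holomorphic_mat g S"
proof (rule holomorphic_matI_quadratic[OF S])
  fix Z assume Z: "Z \<in> S"
  from bd[OF this] obtain r M where r: "r > 0" "cball Z r \<subseteq> S"
    and M: "\<And>k W. W \<in> cball Z r \<Longrightarrow> cmod (f k W) \<le> M" by blast
  note T = holomorphic_mat_taylor[OF S f r(2,1) M]
  have add: "cderiv (f k) Z (A + B) = cderiv (f k) Z A + cderiv (f k) Z B" for k A B
    by (rule cderiv_add[OF S f Z])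
  have sc: "cderiv (f k) Z (csc c A) = c * cderiv (f k) Z A" for k c A
    by (rule cderiv(2)[OF S f Z])
  let ?K = "8 * M / r\<^sup>2"
  have M0: "M \<ge> 0" using M[of Z 0] r norm_ge_zero order_trans by (metis centre_in_cball less_imp_le)
  have conv: "convergent (\<lambda>k. cderiv (f k) Z H)" for H
  proof -
    \<comment> \<open>The direction is shortened so that twice the unit disc is mapped into the ball of radius \<open>r\<close>.\<close>
    define s where "s = r / (2 * (norm H + 1))"
    define G where "G = csc (of_real s) H"
    have n: "norm H + 1 > 0" by (simp add: add_nonneg_pos)
    then have s: "s > 0" using r by (simp add: s_def)
    have nG: "norm G = s * norm H" using s by (simp add: G_def)
    have inb: "Z + csc \<zeta> G \<in> cball Z r" if "cmod \<zeta> < 2" for \<zeta>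
    proof -
      have "cmod \<zeta> * norm G \<le> 2 * norm G"
        using that by (intro mult_right_mono) auto
      also have "\<dots> = r * (norm H / (norm H + 1))"
        unfolding nG s_def using n by (simp add: field_simps)
      also have "\<dots> \<le> r * 1" using r n by (intro mult_left_mono) auto
      finally show ?thesis by (simp add: dist_norm)
    qed
    have hol: "(\<lambda>\<zeta>. f k (Z + csc \<zeta> G)) holomorphic_on ball 0 2" for k
      by (rule holomorphic_mat_on_curve[OF S f]) (use inb r in \<open>auto intro!: holomorphic_intros\<close>)
    have "((\<lambda>\<zeta>. f k (Z + csc \<zeta> G)) has_field_derivative cderiv (f k) (Z + csc 0 G) G) (at 0)" for k
      by (rule holomorphic_mat_curve[OF S f]) (use Z in \<open>auto intro!: derivative_eq_intros\<close>)
    then have "deriv (\<lambda>\<zeta>. f k (Z + csc \<zeta> G)) 0 = cderiv (f k) Z G" for k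
      by (simp add: DERIV_imp_deriv)
    then have ci: "(\<integral>t. f k (Z + csc (expi t) G) / expi t \<partial>circ) = of_real s * cderiv (f k) Z H"
      and int: "integrable circ (\<lambda>t. f k (Z + csc (expi t) G) / expi t)" for k
      using taylor_coefficient_integral[OF hol[of k], of 1] by (simp_all add: G_def sc)
    have lim': "(\<lambda>k. f k (Z + csc (expi t) G) / expi t) \<longlonglongrightarrow> g (Z + csc (expi t) G) / expi t" for t
      using inb[of "expi t"] r by (intro tendsto_intros lim) auto
    have "(\<lambda>k. \<integral>t. f k (Z + csc (expi t) G) / expi t \<partial>circ) \<longlonglongrightarrow> (\<integral>t. g (Z + csc (expi t) G) / expi t \<partial>circ)"
    proof (rule integral_dominated_convergence)
      show "(\<lambda>t. f k (Z + csc (expi t) G) / expi t) \<in> borel_measurable circ" for k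
        by (rule borel_measurable_integrable[OF int])
      then show "(\<lambda>t. g (Z + csc (expi t) G) / expi t) \<in> borel_measurable circ"
        by (rule borel_measurable_LIMSEQ_metric) (rule lim')
      show "integrable circ (\<lambda>t. M)"
        by (rule finite_measure.integrable_const[OF finite_measure_circ])
      show "AE t in circ. cmod (f k (Z + csc (expi t) G) / expi t) \<le> M" for k
        using M inb by (simp add: norm_divide)
    qed (simp add: lim')
    from tendsto_mult_left[OF this[unfolded ci], of "1 / of_real s"] show ?thesis
      using s by (simp add: convergentI)
  qed
  define L where "L H = lim (\<lambda>k. cderiv (f k) Z H)" for H
  have L: "(\<lambda>k. cderiv (f k) Z H) \<longlonglongrightarrow> L H" for H
    using conv convergent_LIMSEQ_iff L_def by metis
  have "L (A + B) = L A + L B" for A B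
    using LIMSEQ_unique[OF L[of "A + B"]] tendsto_add[OF L[of A] L[of B]] by (simp add: add)
  moreover have "L (csc c A) = c * L A" for c A
    using LIMSEQ_unique[OF L[of "csc c A"]] tendsto_mult_left[OF L[of A], of c] by (simp add: sc)
  moreover have "cmod (g (Z + H) - g Z - L H) \<le> ?K * (norm H)\<^sup>2" if "norm H \<le> r / 2" for H
  proof (rule LIMSEQ_le_const2)
    have "Z + H \<in> S" using r that by (auto simp: subset_iff dist_norm)
    then show "(\<lambda>k. cmod (f k (Z + H) - f k Z - cderiv (f k) Z H)) \<longlonglongrightarrow> cmod (g (Z + H) - g Z - L H)"
      by (intro tendsto_intros lim L Z)
    show "\<exists>N. \<forall>k\<ge>N. cmod (f k (Z + H) - f k Z - cderiv (f k) Z H) \<le> ?K * (norm H)\<^sup>2"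
      using T(2) that by blast
  qed
  ultimately show "\<exists>L C r. r > 0 \<and> (\<forall>A B. L (A + B) = L A + L B) \<and> (\<forall>c H. L (csc c H) = c * L H) \<and>
      (\<forall>H. norm H \<le> r \<longrightarrow> cmod (g (Z + H) - g Z - L H) \<le> C * (norm H)\<^sup>2)"
    using r(1) by (intro exI[of _ L] exI[of _ ?K] exI[of _ "r/2"]) auto
qed

text \<open>Differentiation under the integral sign.  The derivatives of the integrands are measurable as limits of difference
  quotients, and the quadratic error estimate is integrated.\<close>

lemma holomorphic_mat_integral:
  fixes F :: "'x \<Rightarrow> 'n::finite cmat \<Rightarrow> complex"
  assumes S: "open S" and F: "\<And>x. x \<in> space N \<Longrightarrow> holomorphic_mat (F x) S"
    and meas: "\<And>Z. Z \<in> S \<Longrightarrow> (\<lambda>x. F x Z) \<in> borel_measurable N"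
    and bd: "\<And>Z. Z \<in> S \<Longrightarrow> \<exists>r K. r > 0 \<and> cball Z r \<subseteq> S \<and> integrable N K \<and> (\<forall>x\<in>space N. \<forall>W\<in>cball Z r. cmod (F x W) \<le> K x)"
  shows "holomorphic_mat (\<lambda>Z. \<integral>x. F x Z \<partial>N) S"
proof (rule holomorphic_matI_quadratic[OF S])
  fix Z assume Z: "Z \<in> S"
  from bd[OF this] obtain r K where r: "r > 0" "cball Z r \<subseteq> S" and iK: "integrable N K"
    and K: "\<And>x W. x \<in> space N \<Longrightarrow> W \<in> cball Z r \<Longrightarrow> cmod (F x W) \<le> K x" by blast
  have T1: "cmod (cderiv (F x) Z H) \<le> K x / r * norm H" if "x \<in> space N" for x H
    by (rule holomorphic_mat_taylor(1)[OF S F[OF that] r(2,1) K[OF that]])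
  have T2: "cmod (F x (Z + H) - F x Z - cderiv (F x) Z H) \<le> 8 * K x / r\<^sup>2 * (norm H)\<^sup>2" if "x \<in> space N" "norm H \<le> r / 2" for x H
    by (rule holomorphic_mat_taylor(2)[OF S F[OF that(1)] r(2,1) K[OF that(1)] that(2)])
  have iF: "integrable N (\<lambda>x. F x W)" if "W \<in> cball Z r" for W
    using meas[of W] that r K
    by (intro Bochner_Integration.integrable_bound[OF iK] AE_I2) (auto simp: subset_iff intro: order_trans[OF _ abs_ge_self])
  have md: "(\<lambda>x. cderiv (F x) Z H) \<in> borel_measurable N" for H
  proof (rule borel_measurable_LIMSEQ_metric)
    define s where "s k = complex_of_real (r / (norm H + 1) * (1 / real (Suc k)))" for k
    have n: "norm H + 1 > 0" by (simp add: add_nonneg_pos)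
    have s0: "s \<longlonglongrightarrow> 0"
    proof -
      have "s \<longlonglongrightarrow> of_real (r / (norm H + 1) * 0)"
        unfolding s_def by (intro tendsto_of_real tendsto_mult_left LIMSEQ_Suc[OF lim_1_over_n])
      then show ?thesis by simp
    qed
    have "s k \<noteq> 0" for k using r n by (simp add: s_def del: of_nat_Suc of_real_divide)
    then have sat: "filterlim s (at 0) sequentially"
      using s0 by (simp add: filterlim_at)
    have "norm (csc (s k) H) \<le> r" for k
    proof -
      have "norm (csc (s k) H) = r * (norm H / (norm H + 1) / real (Suc k))"
      proof -
        have "cmod (s k) = r / (norm H + 1) * (1 / real (Suc k))"
          unfolding s_def norm_of_real using r n by (intro abs_of_nonneg) simp
        then show ?thesis by simp
      qed
      also have "\<dots> \<le> r * 1"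
      proof (rule mult_left_mono)
        have "(norm H + 1) * 1 \<le> (norm H + 1) * real (Suc k)"
          using n by (intro mult_left_mono) auto
        then have "norm H \<le> (norm H + 1) * real (Suc k)"
          by (rule order_trans[rotated]) simp
        then show "norm H / (norm H + 1) / real (Suc k) \<le> 1"
          using n by (simp only: divide_divide_eq_left divide_le_eq_1_pos mult_pos_pos of_nat_0_less_iff zero_less_Suc)
      qed (use r in simp)
      finally show ?thesis by simp
    qed
    then have GS: "Z + csc (s k) H \<in> S" for k using r by (auto simp: subset_iff dist_norm)
    show "(\<lambda>x. (F x (Z + csc (s k) H) - F x Z) / s k) \<in> borel_measurable N" for k
      using meas[OF Z] meas[OF GS] by measurable
    fix x assume x: "x \<in> space N"
    have "((\<lambda>\<zeta>. F x (Z + csc \<zeta> H)) has_field_derivative cderiv (F x) (Z + csc 0 H) H) (at 0)"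
      by (rule holomorphic_mat_curve[OF S F[OF x]]) (use Z in \<open>auto intro!: derivative_eq_intros\<close>)
    then have "((\<lambda>h. (F x (Z + csc h H) - F x Z) / h) \<longlongrightarrow> cderiv (F x) Z H) (at 0)"
      by (simp add: has_field_derivative_iff)
    from filterlim_compose[OF this sat]
    show "(\<lambda>k. (F x (Z + csc (s k) H) - F x Z) / s k) \<longlonglongrightarrow> cderiv (F x) Z H" .
  qed
  have id: "integrable N (\<lambda>x. cderiv (F x) Z H)" for H
  proof (rule Bochner_Integration.integrable_bound)
    show "integrable N (\<lambda>x. K x / r * norm H)" using iK by simp
    show "AE x in N. norm (cderiv (F x) Z H) \<le> norm (K x / r * norm H)"
      by (intro AE_I2, simp only: real_norm_def, rule order_trans[OF T1 abs_ge_self])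
  qed (rule md)
  define L where "L H = (\<integral>x. cderiv (F x) Z H \<partial>N)" for H
  have "L (A + B) = L A + L B" for A B
  proof -
    have "L (A + B) = (\<integral>x. cderiv (F x) Z A + cderiv (F x) Z B \<partial>N)"
      unfolding L_def by (intro Bochner_Integration.integral_cong refl cderiv_add[OF S F Z])
    then show ?thesis by (simp add: L_def id)
  qed
  moreover have "L (csc c A) = c * L A" for c A
  proof -
    have "L (csc c A) = (\<integral>x. c * cderiv (F x) Z A \<partial>N)"
      unfolding L_def by (intro Bochner_Integration.integral_cong refl cderiv(2)[OF S F Z])
    then show ?thesis by (simp add: L_def)
  qed
  moreover have "cmod ((\<integral>x. F x (Z + H) \<partial>N) - (\<integral>x. F x Z \<partial>N) - L H) \<le> (8 * (\<integral>x. K x \<partial>N) / r\<^sup>2) * (norm H)\<^sup>2" if "norm H \<le> r / 2" for H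
  proof -
    have i1: "integrable N (\<lambda>x. F x (Z + H))" "integrable N (\<lambda>x. F x Z)"
      using r that by (auto intro!: iF simp: dist_norm)
    have "(\<integral>x. F x (Z + H) \<partial>N) - (\<integral>x. F x Z \<partial>N) - L H = (\<integral>x. F x (Z + H) - F x Z - cderiv (F x) Z H \<partial>N)"
      using i1 id by (simp add: L_def)
    also have "cmod \<dots> \<le> (\<integral>x. 8 * K x / r\<^sup>2 * (norm H)\<^sup>2 \<partial>N)"
      using i1 id iK T2 that
      by (intro order_trans[OF integral_norm_bound] Bochner_Integration.integral_mono) auto
    finally show ?thesis by simp
  qed
  ultimately show "\<exists>L C r. r > 0 \<and> (\<forall>A B. L (A + B) = L A + L B) \<and> (\<forall>c H. L (csc c H) = c * L H) \<and>
      (\<forall>H. norm H \<le> r \<longrightarrow> cmod ((\<integral>x. F x (Z + H) \<partial>N) - (\<integral>x. F x Z \<partial>N) - L H) \<le> C * (norm H)\<^sup>2)"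
    using r(1) by (intro exI[of _ L] exI[of _ "8 * (\<integral>x. K x \<partial>N) / r\<^sup>2"] exI[of _ "r/2"]) auto
qed

subsection \<open>Mean values\<close>

text \<open>Every single rotation preserves the integral, hence so does the average over all rotations; the rest is Fubini's theorem.\<close>

lemma rotation_average:
  fixes h :: "'n::finite cmat \<Rightarrow> complex"
  assumes M: "sigma_finite_measure M" and bor: "(\<lambda>W. W) \<in> M \<rightarrow>\<^sub>M borel"
    and rot: "\<And>c. cmod c = 1 \<Longrightarrow> csc c \<in> M \<rightarrow>\<^sub>M M" "\<And>c. cmod c = 1 \<Longrightarrow> distr M M (csc c) = M"
    and h [measurable]: "h \<in> borel_measurable borel" and ih: "integrable M h"
  shows "(\<integral>W. h W \<partial>M) = (\<integral>W. (\<integral>t. h (csc (expi t) W) \<partial>circ) \<partial>M)"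
    and "integrable M (\<lambda>W. \<integral>t. h (csc (expi t) W) \<partial>circ)"
proof -
  interpret M: sigma_finite_measure M by (rule M)
  interpret c: finite_measure circ by (rule finite_measure_circ)
  interpret P: pair_sigma_finite circ M by unfold_locales
  note bor[measurable]
  have hM: "h \<in> borel_measurable M"
    using measurable_compose[OF bor h] by simp
  have r: "integrable M (\<lambda>W. h (csc (expi t) W))" "(\<integral>W. h (csc (expi t) W) \<partial>M) = (\<integral>W. h W \<partial>M)"
     "(\<integral>W. norm (h (csc (expi t) W)) \<partial>M) = (\<integral>W. norm (h W) \<partial>M)" for t
  proof -
    have "integrable (distr M M (csc (expi t))) h" using ih rot by simp
    then show "integrable M (\<lambda>W. h (csc (expi t) W))"
      by (subst (asm) integrable_distr_eq) (auto intro: rot hM)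
    have "(\<integral>W. h W \<partial>M) = (\<integral>W. h W \<partial>distr M M (csc (expi t)))" using rot by simp
    also have "\<dots> = (\<integral>W. h (csc (expi t) W) \<partial>M)"
      by (rule integral_distr) (auto intro: rot hM)
    finally show "(\<integral>W. h (csc (expi t) W) \<partial>M) = (\<integral>W. h W \<partial>M)" by simp
    have "(\<integral>W. norm (h W) \<partial>M) = (\<integral>W. norm (h W) \<partial>distr M M (csc (expi t)))" using rot by simp
    also have "\<dots> = (\<integral>W. norm (h (csc (expi t) W)) \<partial>M)"
      by (rule integral_distr) (use rot hM in auto)
    finally show "(\<integral>W. norm (h (csc (expi t) W)) \<partial>M) = (\<integral>W. norm (h W) \<partial>M)" by simp
  qed
  have i: "integrable (circ \<Otimes>\<^sub>M M) (\<lambda>(t, W). h (csc (expi t) W))"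
  proof (rule P.Fubini_integrable)
    show "(\<lambda>(t, W). h (csc (expi t) W)) \<in> borel_measurable (circ \<Otimes>\<^sub>M M)"
    proof -
      have [measurable]: "(\<lambda>x. expi (fst x)) \<in> borel_measurable (circ \<Otimes>\<^sub>M M)"
        by (rule measurable_compose[OF measurable_fst]) (rule borel_imp_circ, measurable)
      have [measurable]: "(\<lambda>x. snd x) \<in> circ \<Otimes>\<^sub>M M \<rightarrow>\<^sub>M borel"
        using measurable_compose[OF measurable_snd bor] by simp
      show ?thesis by measurable
    qed
    show "integrable circ (\<lambda>t. \<integral>W. norm (case (t, W) of (t, W) \<Rightarrow> h (csc (expi t) W)) \<partial>M)"
      by (simp add: r)
  qed (simp add: r)
  have "(\<integral>W. (\<integral>t. h (csc (expi t) W) \<partial>circ) \<partial>M) = (\<integral>t. (\<integral>W. h (csc (expi t) W) \<partial>M) \<partial>circ)"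
    using P.Fubini_integral[OF i] by simp
  then show "(\<integral>W. h W \<partial>M) = (\<integral>W. (\<integral>t. h (csc (expi t) W) \<partial>circ) \<partial>M)"
    by (simp add: r measure_circ)
  show "integrable M (\<lambda>W. \<integral>t. h (csc (expi t) W) \<partial>circ)"
    using P.integrable_snd[OF i] by simp
qed

text \<open>A ball is invariant under rotations about its centre, and along each rotation orbit the average is the value at the centre by the
  one-variable mean value property.\<close>

lemma holomorphic_mat_mean_value:
  fixes f :: "'n::finite cmat \<Rightarrow> complex"
  assumes S: "open S" "holomorphic_mat f S" and r: "cball Z r \<subseteq> S" "r > 0"
  shows "(\<integral>W. indicator (ball Z r) W *\<^sub>R f W \<partial>lborel) = f Z * of_real (measure lborel (ball Z r))"
    and "integrable lborel (\<lambda>W. indicator (ball Z r) W *\<^sub>R f W)"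
proof -
  have cont: "continuous_on (cball Z r) f"
    using holomorphic_mat_continuous[OF S] r continuous_on_subset by blast
  have i1: "integrable lborel (\<lambda>W. indicator (cball Z r) W *\<^sub>R f W)"
    by (rule borel_integrable_compact) (use cont in auto)
  have [measurable]: "ball Z r \<in> sets borel" by (rule borel_open) simp
  have "integrable lborel (\<lambda>W. indicator (ball Z r) W *\<^sub>R (indicator (cball Z r) W *\<^sub>R f W))"
    by (rule integrable_mult_indicator[OF _ i1]) simp
  moreover have "indicator (ball Z r) W *\<^sub>R (indicator (cball Z r) W *\<^sub>R f W) = indicator (ball Z r) W *\<^sub>R f W" for W
    by (auto simp: indicator_def)
  ultimately show i2: "integrable lborel (\<lambda>W. indicator (ball Z r) W *\<^sub>R f W)"
    by (simp only:)
  define h where "h W = indicator (ball 0 r) W *\<^sub>R f (Z + W)" for W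
  have hW: "h W = indicator (ball Z r) (Z + W) *\<^sub>R f (Z + W)" for W
    by (simp add: h_def indicator_def dist_norm)
  have hm [measurable]: "h \<in> borel_measurable borel"
  proof -
    have "continuous_on (ball 0 r) (\<lambda>W. f (Z + W))"
      by (rule continuous_on_compose2[OF cont]) (auto intro!: continuous_intros simp: dist_norm)
    then show ?thesis unfolding h_def
      by (intro borel_measurable_continuous_on_indicator) auto
  qed
  have shift: "(\<integral>W. g (Z + W) \<partial>lborel) = (\<integral>W. g W \<partial>lborel)" if "g \<in> borel_measurable borel" for g :: "'n cmat \<Rightarrow> complex"
  proof -
    have "(\<integral>W. g W \<partial>lborel) = (\<integral>W. g W \<partial>distr lborel borel ((+) Z))" by (simp add: lborel_distr_plus)
    also have "\<dots> = (\<integral>W. g (Z + W) \<partial>lborel)"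
      by (rule integral_distr) (use that in auto)
    finally show ?thesis by simp
  qed
  have ih: "integrable lborel h"
  proof -
    have "integrable (distr lborel borel ((+) Z)) (\<lambda>W. indicator (ball Z r) W *\<^sub>R f W)"
      using i2 by (simp add: lborel_distr_plus)
    then show ?thesis
      by (subst (asm) integrable_distr_eq) (use borel_measurable_integrable[OF i2] in \<open>auto simp: hW[abs_def]\<close>)
  qed
  have rot: "distr lborel lborel (csc c) = (lborel :: 'n cmat measure)" if "cmod c = 1" for c
  proof -
    have "distr lborel lborel (csc c :: 'n cmat \<Rightarrow> 'n cmat) = distr lborel borel (csc c)" by (rule distr_cong) auto
    then show ?thesis using lborel_distr_isometry[OF linear_csc, of c] that by simp
  qed
  have "(\<integral>W. indicator (ball Z r) W *\<^sub>R f W \<partial>lborel) = (\<integral>W. h W \<partial>lborel)"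
    unfolding hW using shift[of "\<lambda>W. indicator (ball Z r) W *\<^sub>R f W"] borel_measurable_integrable[OF i2] by simp
  also have "\<dots> = (\<integral>W. (\<integral>t. h (csc (expi t) W) \<partial>circ) \<partial>lborel)"
    by (rule rotation_average(1)) (auto simp: rot ih lborel.sigma_finite_measure_axioms)
  also have "\<dots> = (\<integral>W. indicator (ball (0 :: 'n cmat) r) W *\<^sub>R f Z \<partial>lborel)"
  proof (rule Bochner_Integration.integral_cong[OF refl])
    fix W :: "'n cmat"
    show "(\<integral>t. h (csc (expi t) W) \<partial>circ) = indicator (ball 0 r) W *\<^sub>R f Z"
    proof (cases "norm W < r")
      case True
      define R where "R = (if W = 0 then 2 else r / norm W)"
      have R: "R > 1" using True by (auto simp: R_def)
      have inS: "Z + csc z W \<in> S" if "z \<in> ball 0 R" for z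
      proof -
        have "cmod z * norm W \<le> r" using that r by (auto simp: R_def field_simps split: if_splits intro: less_imp_le)
        then show ?thesis using r by (auto simp: subset_iff dist_norm)
      qed
      have "(\<lambda>z. f (Z + csc z W)) holomorphic_on ball 0 R"
        by (rule holomorphic_mat_on_curve[OF S]) (use inS in \<open>auto intro!: holomorphic_intros\<close>)
      from taylor_coefficient_integral(1)[OF this R, of 0]
      have "(\<integral>t. f (Z + csc (expi t) W) \<partial>circ) = f Z" by simp
      then show ?thesis using True by (simp add: h_def dist_norm)
    next
      case False
      then show ?thesis by (simp add: h_def dist_norm)
    qed
  qed
  also have "\<dots> = f Z * of_real (measure lborel (ball (0 :: 'n cmat) r))"
  proof -
    have "ball (0 :: 'n cmat) r \<in> sets lborel"
      using borel_open[OF open_ball] by simp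
    then have "integrable lborel (indicator (ball (0 :: 'n cmat) r) :: 'n cmat \<Rightarrow> real)"
      using emeasure_bounded_finite[OF bounded_ball] by (rule integrable_real_indicator)
    then show ?thesis
      by (subst integral_scaleR_left) (auto simp: scaleR_conv_of_real mult.commute)
  qed
  also have "measure lborel (ball (0 :: 'n cmat) r) = measure lborel (ball Z r)"
    using r by (simp add: content_ball)
  finally show "(\<integral>W. indicator (ball Z r) W *\<^sub>R f W \<partial>lborel) = f Z * of_real (measure lborel (ball Z r))" .
qed

context weighted_bergman
begin

section \<open>The Bergman space\<close>

lemma H_iff: "f \<in> H \<longleftrightarrow> f \<in> L2 \<and> holomorphic_mat f D \<and> (\<forall>Z. Z \<notin> D \<longrightarrow> f Z = 0)"
  by (simp add: bergman_space_def)

lemma H_L2: "f \<in> H \<Longrightarrow> f \<in> L2" and H_hol: "f \<in> H \<Longrightarrow> holomorphic_mat f D"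
  and H_zero: "f \<in> H \<Longrightarrow> Z \<notin> D \<Longrightarrow> f Z = 0"
  by (auto simp: H_iff)

lemma holomorphic_borel:
  assumes "holomorphic_mat f D" "\<And>Z. Z \<notin> D \<Longrightarrow> f Z = 0"
  shows "f \<in> borel_measurable borel"
proof -
  have "(\<lambda>Z. indicator D Z *\<^sub>R f Z) \<in> borel_measurable borel"
    by (rule borel_measurable_continuous_on_indicator[OF D_sets holomorphic_mat_continuous[OF open_cartan_domain assms(1)]])
  moreover have "indicator D Z *\<^sub>R f Z = f Z" for Z
    using assms(2) by (simp add: indicator_def)
  ultimately show ?thesis by simp
qed

lemma H_borel: "f \<in> H \<Longrightarrow> f \<in> borel_measurable borel"
  by (intro holomorphic_borel H_hol H_zero)

lemma H_bounded:
  assumes "holomorphic_mat f D" "\<And>Z. Z \<notin> D \<Longrightarrow> f Z = 0" "\<And>Z. Z \<in> D \<Longrightarrow> cmod (f Z) \<le> C"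
  shows "f \<in> H"
  using assms holomorphic_borel[OF assms(1,2)] by (auto simp: H_iff intro!: L2_bounded[of f C] borel_imp_v)

lemma H_0: "(\<lambda>Z. 0) \<in> H"
  by (rule H_bounded[of _ 0]) (auto intro: holomorphic_mat_const)

lemma H_add: "f \<in> H \<Longrightarrow> g \<in> H \<Longrightarrow> (\<lambda>Z. f Z + g Z) \<in> H"
  by (auto simp: H_iff intro: L2_add holomorphic_mat_add open_cartan_domain)

lemma H_scale: "f \<in> H \<Longrightarrow> (\<lambda>Z. c * f Z) \<in> H"
  by (auto simp: H_iff intro: L2_scale holomorphic_mat_scale open_cartan_domain)

lemma H_diff: "f \<in> H \<Longrightarrow> g \<in> H \<Longrightarrow> (\<lambda>Z. f Z - g Z) \<in> H"
  using H_add[OF _ H_scale, of f g "-1"] by simp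

lemma H_symmetry:
  assumes "domain_symmetry \<phi>" "f \<in> H" shows "(\<lambda>Z. f (\<phi> Z)) \<in> H"
  using assms unfolding H_iff
  by (auto intro!: L2_symmetry holomorphic_mat_compose_linear[of D] open_cartan_domain simp: domain_symmetry_def)

text \<open>The mean value property over a ball around \<open>W\<close>, rewritten as an inner product.  The kernel is not holomorphic, but it is bounded,
  uniformly in \<open>W\<close>, since the weight is bounded below on the balls used.\<close>

lemma evaluation_kernel:
  assumes Z: "Z \<in> D"
  obtains r C where "r > 0" "C \<ge> 0" "cball Z r \<subseteq> D" 
    "\<And>W. W \<in> cball Z r \<Longrightarrow> \<exists>\<kappa>\<in>L2. nsq \<kappa> \<le> C \<and> (\<forall>f\<in>H. f W = inner2 f \<kappa>)"
proof -
  obtain e where e: "e > 0" "cball Z e \<subseteq> D"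
    using open_contains_cball open_cartan_domain Z by metis
  define r where "r = e / 2"
  have r: "r > 0" using e by (simp add: r_def)
  have sub: "cball W r \<subseteq> cball Z e" if "W \<in> cball Z r" for W
    using that by (auto simp: cball_subset_cball_iff r_def dist_commute)
  obtain m where m: "m > 0" "\<And>W. W \<in> cball Z e \<Longrightarrow> m \<le> weight W"
  proof -
    have "continuous_on (cball Z e) weight"
      using weight_continuous e continuous_on_subset by blast
    then obtain Y where "Y \<in> cball Z e" "\<And>W. W \<in> cball Z e \<Longrightarrow> weight Y \<le> weight W"
      using continuous_attains_inf[OF compact_cball, of Z e weight] e by force
    then show ?thesis using that[of "weight Y"] weight_pos e by blast
  qed
  define vol where "vol = measure lborel (ball Z r)"
  have vol: "measure lborel (ball W r) = vol" "vol > 0" for W :: "'n cmat"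
    using r by (simp_all add: vol_def content_ball)
  have "\<exists>\<kappa>\<in>L2. nsq \<kappa> \<le> (1 / (vol * m))\<^sup>2 \<and> (\<forall>f\<in>H. f W = inner2 f \<kappa>)" if W: "W \<in> cball Z r" for W
  proof -
    define \<kappa> where "\<kappa> Y = complex_of_real (indicator (ball W r) Y / (vol * weight Y))" for Y
    have WD: "cball W r \<subseteq> D" using sub[OF W] e by blast
    have [measurable]: "ball W r \<in> sets borel" by (rule borel_open) simp
    have \<kappa>m [measurable]: "\<kappa> \<in> borel_measurable borel" unfolding \<kappa>_def by measurable
    have bd: "cmod (\<kappa> Y) \<le> 1 / (vol * m)" for Y
    proof (cases "Y \<in> ball W r")
      case True
      then have "m \<le> weight Y" using m(2) sub[OF W] ball_subset_cball by blast
      then have "1 / (vol * weight Y) \<le> 1 / (vol * m)"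
        using m(1) vol by (intro divide_left_mono mult_left_mono mult_pos_pos) auto
      moreover have "cmod (\<kappa> Y) = 1 / (vol * weight Y)"
        using True vol weight_nonneg[of Y] unfolding \<kappa>_def norm_of_real by (simp add: abs_mult)
      ultimately show ?thesis by simp
    next
      case False
      then show ?thesis using vol m(1) by (simp add: \<kappa>_def)
    qed
    have one: "(\<lambda>Z. 1) \<in> L2" "nsq (\<lambda>Z. 1) = 1"
      using norm_const(2) by (simp_all add: L2_iff nsq_def measure_def)
    have \<kappa>L: "\<kappa> \<in> L2" "nsq \<kappa> \<le> (1 / (vol * m))\<^sup>2"
      using L2_mult_bounded[OF one(1) borel_imp_v[OF \<kappa>m] AE_I2[of v, OF bd]] one(2) by simp_all
    moreover have "f W = inner2 f \<kappa>" if f: "f \<in> H" for f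
    proof -
      have [measurable]: "f \<in> borel_measurable borel" using f by (rule H_borel)
      have "inner2 f \<kappa> = (\<integral>Y. weight Y *\<^sub>R (f Y * cnj (\<kappa> Y)) \<partial>lebesgue_on D)"
        unfolding L2_inner_def v_eq
        by (rule integral_density) (auto intro!: measurable_restrict_space1 measurable_completion)
      also have "\<dots> = (\<integral>Y. indicator D Y *\<^sub>R (weight Y *\<^sub>R (f Y * cnj (\<kappa> Y))) \<partial>lebesgue)"
        by (rule integral_restrict_space) auto
      also have "\<dots> = (\<integral>Y. indicator D Y *\<^sub>R (weight Y *\<^sub>R (f Y * cnj (\<kappa> Y))) \<partial>lborel)"
        by (rule integral_completion) measurable
      also have "\<dots> = (\<integral>Y. (1 / of_real vol) * (indicator (ball W r) Y *\<^sub>R f Y) \<partial>lborel)"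
      proof (rule Bochner_Integration.integral_cong[OF refl])
        fix Y :: "'n cmat"
        show "indicator D Y *\<^sub>R (weight Y *\<^sub>R (f Y * cnj (\<kappa> Y))) = (1 / of_real vol) * (indicator (ball W r) Y *\<^sub>R f Y)"
        proof (cases "Y \<in> ball W r")
          case True
          then have "Y \<in> D" using WD by auto
          then show ?thesis
            using True weight_pos[of Y] by (simp add: \<kappa>_def scaleR_conv_of_real)
        qed (simp add: \<kappa>_def)
      qed
      also have "\<dots> = f W"
        using holomorphic_mat_mean_value(1)[OF open_cartan_domain H_hol[OF f] WD r] vol
        by (simp only: integral_mult_right_zero) simp
      finally show ?thesis by simp
    qed
    ultimately show ?thesis by blast
  qed
  moreover have "cball Z r \<subseteq> D" using sub[of Z] e r by auto
  ultimately show thesis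
    using that[of r "(1 / (vol * m))\<^sup>2"] r by simp
qed

lemma evaluation_bound:
  assumes Z: "Z \<in> D"
  obtains r C where "r > 0" "C \<ge> 0" "cball Z r \<subseteq> D" "\<And>f W. f \<in> H \<Longrightarrow> W \<in> cball Z r \<Longrightarrow> (cmod (f W))\<^sup>2 \<le> C * nsq f"
proof -
  obtain r C where r: "r > 0" "C \<ge> 0" "cball Z r \<subseteq> D"
    and \<kappa>: "\<And>W. W \<in> cball Z r \<Longrightarrow> \<exists>\<kappa>\<in>L2. nsq \<kappa> \<le> C \<and> (\<forall>f\<in>H. f W = inner2 f \<kappa>)"
    using evaluation_kernel[OF Z] by metis
  have "(cmod (f W))\<^sup>2 \<le> C * nsq f" if f: "f \<in> H" and W: "W \<in> cball Z r" for f W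
  proof -
    obtain k where k: "k \<in> L2" "nsq k \<le> C" "f W = inner2 f k" using \<kappa>[OF W] f by blast
    have "(cmod (f W))\<^sup>2 \<le> nsq f * nsq k"
      unfolding k(3) by (rule cauchy_schwarz[OF H_L2[OF f] k(1)])
    also have "\<dots> \<le> nsq f * C" using k(2) by (rule mult_left_mono) simp
    finally show ?thesis by (simp add: mult.commute)
  qed
  then show thesis using that r by blast
qed

lemma H_nsq_0: assumes "f \<in> H" "nsq f = 0" shows "f = (\<lambda>Z. 0)"
proof
  fix Z show "f Z = 0"
  proof (cases "Z \<in> D")
    case True
    then obtain r C where "r > 0" "\<And>f W. f \<in> H \<Longrightarrow> W \<in> cball Z r \<Longrightarrow> (cmod (f W))\<^sup>2 \<le> C * nsq f"
      using evaluation_bound by metis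
    then have "(cmod (f Z))\<^sup>2 \<le> C * 0" using assms by (metis centre_in_cball less_imp_le)
    then show ?thesis by simp
  qed (use assms H_zero in auto)
qed

text \<open>By \<open>evaluation_bound\<close> a Cauchy sequence converges pointwise and is locally bounded, so its limit is holomorphic; Fatou's lemma
  turns the pointwise convergence into convergence in the norm.\<close>

lemma H_complete:
  assumes f: "\<And>k. f k \<in> H" and cau: "\<And>e. e > 0 \<Longrightarrow> \<exists>N. \<forall>m\<ge>N. \<forall>k\<ge>N. nsq (\<lambda>Z. f m Z - f k Z) < e"
  obtains h where "h \<in> H" "(\<lambda>k. nsq (\<lambda>Z. f k Z - h Z)) \<longlonglongrightarrow> 0"
proof -
  have conv: "convergent (\<lambda>k. f k Z)" for Z
  proof (cases "Z \<in> D")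
    case True
    then obtain r C where rC: "r > 0" "C \<ge> 0" "\<And>f W. f \<in> H \<Longrightarrow> W \<in> cball Z r \<Longrightarrow> (cmod (f W))\<^sup>2 \<le> C * nsq f"
      using evaluation_bound by metis
    have "Cauchy (\<lambda>k. f k Z)"
    proof (rule metric_CauchyI)
      fix e :: real assume e: "e > 0"
      then obtain N where N: "\<And>m k. m \<ge> N \<Longrightarrow> k \<ge> N \<Longrightarrow> nsq (\<lambda>Z. f m Z - f k Z) < e\<^sup>2 / (C + 1)"
        using cau[of "e\<^sup>2 / (C + 1)"] rC(2) by fastforce
      have "dist (f m Z) (f k Z) < e" if "m \<ge> N" "k \<ge> N" for m k
      proof -
        have "(cmod (f m Z - f k Z))\<^sup>2 \<le> C * nsq (\<lambda>Z. f m Z - f k Z)"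
          using rC(3)[OF H_diff[OF f f], of Z m k] rC(1) by simp
        also have "\<dots> \<le> (C + 1) * nsq (\<lambda>Z. f m Z - f k Z)"
          by (intro mult_right_mono) auto
        also have "\<dots> < e\<^sup>2"
          using N[OF that] rC(2) by (simp add: field_simps)
        finally show ?thesis
          using e by (simp add: dist_norm power2_less_imp_less)
      qed
      then show "\<exists>N. \<forall>m\<ge>N. \<forall>k\<ge>N. dist (f m Z) (f k Z) < e" by blast
    qed
    then show ?thesis by (rule Cauchy_convergent)
  next
    case False
    then show ?thesis using H_zero[OF f] by (simp add: convergent_const)
  qed
  define h where "h Z = lim (\<lambda>k. f k Z)" for Z
  have h: "(\<lambda>k. f k Z) \<longlonglongrightarrow> h Z" for Z
    using conv convergent_LIMSEQ_iff h_def by metis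
  have h0: "h Z = 0" if "Z \<notin> D" for Z
    using h[of Z] H_zero[OF f that] by (simp add: LIMSEQ_const_iff)
  obtain N where N: "\<And>m k. m \<ge> N \<Longrightarrow> k \<ge> N \<Longrightarrow> nsq (\<lambda>Z. f m Z - f k Z) < 1"
    using cau[of 1] by auto
  define B where "B = 2 * 1 + 2 * nsq (f N)"
  have B: "nsq (f (k + N)) \<le> B" for k
  proof -
    have "nsq (\<lambda>Z. (f (k + N) Z - f N Z) + f N Z) \<le> 2 * nsq (\<lambda>Z. f (k + N) Z - f N Z) + 2 * nsq (f N)"
      using f by (intro nsq_add_le H_L2 H_diff)
    then show ?thesis using N[of "k + N" N] by (simp add: B_def)
  qed
  have hol: "holomorphic_mat h D"
  proof (rule holomorphic_mat_uniform_limit[where f="\<lambda>k. f (k + N)"])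
    show "(\<lambda>k. f (k + N) Z) \<longlonglongrightarrow> h Z" for Z
      using h[of Z] by (rule LIMSEQ_ignore_initial_segment)
    fix Z assume "Z \<in> D"
    then obtain r C where rC: "r > 0" "C \<ge> 0" "cball Z r \<subseteq> D" "\<And>f W. f \<in> H \<Longrightarrow> W \<in> cball Z r \<Longrightarrow> (cmod (f W))\<^sup>2 \<le> C * nsq f"
      using evaluation_bound by metis
    have "cmod (f (k + N) W) \<le> sqrt (C * B)" if "W \<in> cball Z r" for k W
    proof (rule real_le_rsqrt)
      have "(cmod (f (k + N) W))\<^sup>2 \<le> C * nsq (f (k + N))"
        using rC(4)[OF f that] .
      also have "\<dots> \<le> C * B" using B rC(2) by (intro mult_left_mono)
      finally show "(cmod (f (k + N) W))\<^sup>2 \<le> C * B" .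
    qed
    then show "\<exists>r M. r > 0 \<and> cball Z r \<subseteq> D \<and> (\<forall>k. \<forall>W\<in>cball Z r. cmod (f (k + N) W) \<le> M)"
      using rC by blast
  qed (auto intro: open_cartan_domain H_hol f)
  have [measurable]: "h \<in> borel_measurable borel" "f k \<in> borel_measurable borel" for k
    using holomorphic_borel[OF hol h0] H_borel[OF f] by auto
  have key: "(\<lambda>Z. f k Z - h Z) \<in> L2 \<and> nsq (\<lambda>Z. f k Z - h Z) \<le> e"
    if e: "e > 0" and M: "\<And>j. j \<ge> M \<Longrightarrow> nsq (\<lambda>Z. f k Z - f j Z) \<le> e" for e k M
  proof -
    let ?u = "\<lambda>Z. (cmod (f k Z - h Z))\<^sup>2"
    have "(\<integral>\<^sup>+Z. ennreal (?u Z) \<partial>v) = (\<integral>\<^sup>+Z. liminf (\<lambda>j. ennreal ((cmod (f k Z - f j Z))\<^sup>2)) \<partial>v)"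
    proof (rule nn_integral_cong)
      fix Z
      have "(\<lambda>j. ennreal ((cmod (f k Z - f j Z))\<^sup>2)) \<longlonglongrightarrow> ennreal (?u Z)"
        by (intro tendsto_ennrealI tendsto_intros h)
      then show "ennreal (?u Z) = liminf (\<lambda>j. ennreal ((cmod (f k Z - f j Z))\<^sup>2))"
        by (intro lim_imp_Liminf[symmetric]) auto
    qed
    also have "\<dots> \<le> liminf (\<lambda>j. \<integral>\<^sup>+Z. ennreal ((cmod (f k Z - f j Z))\<^sup>2) \<partial>v)"
      by (rule nn_integral_liminf) measurable
    also have "\<dots> = liminf (\<lambda>j. ennreal (nsq (\<lambda>Z. f k Z - f j Z)))"
    proof -
      have "(\<integral>\<^sup>+Z. ennreal ((cmod (f k Z - f j Z))\<^sup>2) \<partial>v) = ennreal (nsq (\<lambda>Z. f k Z - f j Z))" for j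
        unfolding nsq_def using H_L2[OF H_diff[OF f f]] by (intro nn_integral_eq_integral) (auto simp: L2_iff)
      then show ?thesis by simp
    qed
    also have "\<dots> \<le> ennreal e"
    proof -
      have "liminf (\<lambda>j. ennreal (nsq (\<lambda>Z. f k Z - f j Z))) \<le> liminf (\<lambda>j. ennreal e)"
        by (rule Liminf_mono) (auto simp: eventually_sequentially intro!: exI[of _ M] ennreal_leI M)
      then show ?thesis by (simp add: Liminf_const)
    qed
    finally have le: "(\<integral>\<^sup>+Z. ennreal (?u Z) \<partial>v) \<le> ennreal e" .
    have i: "integrable v ?u"
    proof (rule integrableI_bounded)
      show "(\<integral>\<^sup>+Z. ennreal (norm (?u Z)) \<partial>v) < \<infinity>"
        using le by (simp add: order_le_less_trans)
    qed measurable
    have "ennreal (nsq (\<lambda>Z. f k Z - h Z)) = (\<integral>\<^sup>+Z. ennreal (?u Z) \<partial>v)"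
      unfolding nsq_def by (rule nn_integral_eq_integral[OF i, symmetric]) simp
    then have "ennreal (nsq (\<lambda>Z. f k Z - h Z)) \<le> ennreal e" using le by simp
    then have "nsq (\<lambda>Z. f k Z - h Z) \<le> e" using e by (simp add: ennreal_le_iff)
    then show ?thesis
      using i by (simp add: L2_iff)
  qed
  have "(\<lambda>Z. f N Z - h Z) \<in> L2"
    using key[of 1 N N] N by (simp add: less_imp_le)
  then have "(\<lambda>Z. f N Z - (f N Z - h Z)) \<in> L2"
    by (rule L2_diff[OF H_L2[OF f]])
  then have hH: "h \<in> H"
    using hol h0 by (simp add: H_iff)
  moreover have "(\<lambda>k. nsq (\<lambda>Z. f k Z - h Z)) \<longlonglongrightarrow> 0"
  proof (rule LIMSEQ_I)
    fix e :: real assume e: "e > 0"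
    then obtain M where M: "\<And>m k. m \<ge> M \<Longrightarrow> k \<ge> M \<Longrightarrow> nsq (\<lambda>Z. f m Z - f k Z) < e / 2"
      using cau[of "e / 2"] by auto
    have "nsq (\<lambda>Z. f k Z - h Z) < e" if "k \<ge> M" for k
    proof -
      have "nsq (\<lambda>Z. f k Z - h Z) \<le> e / 2"
        using key[of "e / 2" M k] M that e by (simp add: less_imp_le)
      then show ?thesis using e by linarith
    qed
    then show "\<exists>N. \<forall>k\<ge>N. norm (nsq (\<lambda>Z. f k Z - h Z) - 0) < e"
      by (intro exI[of _ M]) simp
  qed
  ultimately show thesis using that by blast
qed

subsection \<open>The orthogonal projection\<close>

text \<open>A sequence that minimises the distance to \<open>g\<close> is a Cauchy sequence by the parallelogram law.  Its members are
  nearly orthogonal to the Bergman space by \<open>inner2_bound\<close>, and orthogonality of the limit follows.\<close>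

lemma projection_exists:
  assumes g: "g \<in> L2"
  obtains h where "h \<in> H" "\<And>f. f \<in> H \<Longrightarrow> inner2 (\<lambda>Z. g Z - h Z) f = 0"
proof -
  define d where "d = (INF f\<in>H. nsq (\<lambda>Z. g Z - f Z))"
  have bdd: "bdd_below ((\<lambda>f. nsq (\<lambda>Z. g Z - f Z)) ` H)"
    by (rule bdd_belowI2[of _ 0]) simp
  have d: "d \<le> nsq (\<lambda>Z. g Z - f Z)" if "f \<in> H" for f
    unfolding d_def using bdd that by (rule cINF_lower)
  have "\<exists>f\<in>H. nsq (\<lambda>Z. g Z - f Z) < d + 1 / real (Suc k)" for k
    unfolding d_def using H_0 bdd by (subst cINF_less_iff[symmetric]) auto
  then obtain f where fH: "\<And>k. f k \<in> H" and f: "\<And>k. nsq (\<lambda>Z. g Z - f k Z) < d + 1 / real (Suc k)"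
    by metis
  have par: "nsq (\<lambda>Z. f m Z - f k Z) \<le> 2 / real (Suc m) + 2 / real (Suc k)" for m k
  proof -
    let ?a = "\<lambda>Z. g Z - f k Z" and ?b = "\<lambda>Z. g Z - f m Z"
    have ab: "?a \<in> L2" "?b \<in> L2" using g fH by (auto intro: L2_diff H_L2)
    have "nsq (\<lambda>Z. ?a Z - ?b Z) + nsq (\<lambda>Z. ?a Z + ?b Z) = 2 * nsq ?a + 2 * nsq ?b"
      using nsq_add[OF ab] nsq_diff[OF ab] by simp
    moreover have "(\<lambda>Z. ?a Z - ?b Z) = (\<lambda>Z. f m Z - f k Z)" by auto
    moreover have "nsq (\<lambda>Z. ?a Z + ?b Z) \<ge> 4 * d"
    proof -
      have "(\<lambda>Z. ?a Z + ?b Z) = (\<lambda>Z. 2 * (g Z - (1/2) * (f k Z + f m Z)))"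
        by (rule ext) (simp add: algebra_simps)
      then have "nsq (\<lambda>Z. ?a Z + ?b Z) = 4 * nsq (\<lambda>Z. g Z - (1/2) * (f k Z + f m Z))"
        using nsq_scale[of 2 "\<lambda>Z. g Z - (1/2) * (f k Z + f m Z)"] by simp
      moreover have "(\<lambda>Z. (1/2) * (f k Z + f m Z)) \<in> H"
        by (intro H_scale H_add fH)
      ultimately show ?thesis using d by fastforce
    qed
    ultimately show ?thesis using f[of k] f[of m] by simp
  qed
  obtain h where hH: "h \<in> H" and h: "(\<lambda>k. nsq (\<lambda>Z. f k Z - h Z)) \<longlonglongrightarrow> 0"
  proof (rule H_complete[of f])
    fix e :: real assume e: "e > 0"
    obtain N where N: "4 / e < real N" using reals_Archimedean2 by blast
    have "nsq (\<lambda>Z. f m Z - f k Z) < e" if "m \<ge> N" "k \<ge> N" for m k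
    proof -
      have "2 / real (Suc j) < e / 2" if "j \<ge> N" for j
      proof -
        have "4 / e < real (Suc j)" using N that by linarith
        then show ?thesis using e by (simp add: field_simps)
      qed
      from this[of m] this[of k] show ?thesis using par[of m k] that by linarith
    qed
    then show "\<exists>N. \<forall>m\<ge>N. \<forall>k\<ge>N. nsq (\<lambda>Z. f m Z - f k Z) < e" by blast
  qed (use fH in auto)
  have "inner2 (\<lambda>Z. g Z - h Z) p = 0" if p: "p \<in> H" for p
  proof -
    have pL: "p \<in> L2" using p by (rule H_L2)
    have gf: "(\<lambda>Z. g Z - f k Z) \<in> L2" for k using g fH by (auto intro: L2_diff H_L2)
    have fh: "(\<lambda>Z. f k Z - h Z) \<in> L2" for k using fH hH by (auto intro: L2_diff H_L2)
    have b1: "(cmod (inner2 (\<lambda>Z. g Z - f k Z) p))\<^sup>2 \<le> 1 / real (Suc k) * nsq p" for k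
    proof -
      have "d \<le> nsq (\<lambda>Z. (g Z - f k Z) - c * p Z)" for c
        using d[OF H_add[OF fH[of k] H_scale[OF p, of c]]] by (simp add: diff_diff_eq)
      from inner2_bound[OF gf pL this]
      have "(cmod (inner2 (\<lambda>Z. g Z - f k Z) p))\<^sup>2 \<le> (nsq (\<lambda>Z. g Z - f k Z) - d) * nsq p" .
      also have "\<dots> \<le> 1 / real (Suc k) * nsq p"
        using f[of k] by (intro mult_right_mono) auto
      finally show ?thesis .
    qed
    have l0: "(\<lambda>k. 1 / real (Suc k) * nsq p) \<longlonglongrightarrow> 0"
      using tendsto_mult_right[OF LIMSEQ_Suc[OF lim_1_over_n], of "nsq p"] by simp
    have l1: "(\<lambda>k. (cmod (inner2 (\<lambda>Z. g Z - f k Z) p))\<^sup>2) \<longlonglongrightarrow> 0"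
      by (rule tendsto_sandwich[OF _ _ tendsto_const l0]) (use b1 in auto)
    have l2: "(\<lambda>k. (cmod (inner2 (\<lambda>Z. f k Z - h Z) p))\<^sup>2) \<longlonglongrightarrow> 0"
    proof (rule tendsto_sandwich[OF _ _ tendsto_const])
      show "(\<lambda>k. nsq (\<lambda>Z. f k Z - h Z) * nsq p) \<longlonglongrightarrow> 0"
        using tendsto_mult_right[OF h, of "nsq p"] by simp
    qed (use cauchy_schwarz[OF fh pL] in auto)
    have z: "(\<lambda>k. X k) \<longlonglongrightarrow> 0" if "(\<lambda>k. (cmod (X k))\<^sup>2) \<longlonglongrightarrow> 0" for X
    proof -
      have "(\<lambda>k. sqrt ((cmod (X k))\<^sup>2)) \<longlonglongrightarrow> sqrt 0" using that by (intro tendsto_intros)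
      then show ?thesis by (simp add: tendsto_norm_zero_iff)
    qed
    have "(\<lambda>k. inner2 (\<lambda>Z. g Z - f k Z) p + inner2 (\<lambda>Z. f k Z - h Z) p) \<longlonglongrightarrow> 0 + 0"
      by (intro tendsto_add z l1 l2)
    moreover have "inner2 (\<lambda>Z. g Z - f k Z) p + inner2 (\<lambda>Z. f k Z - h Z) p = inner2 (\<lambda>Z. g Z - h Z) p" for k
      using inner2_add_left[OF gf fh pL, of k k] by simp
    ultimately show ?thesis by (simp add: LIMSEQ_const_iff)
  qed
  then show thesis using that hH by blast
qed

lemma proj_unique:
  assumes g: "g \<in> L2" and h: "h \<in> H" "\<And>f. f \<in> H \<Longrightarrow> inner2 (\<lambda>Z. g Z - h Z) f = 0"
  shows "bergman_proj lam g = h"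
  unfolding bergman_proj_def
proof (rule the_equality)
  show "h \<in> H \<and> (\<forall>f\<in>H. inner2 (\<lambda>Z. g Z - h Z) f = 0)" using h by blast
  fix h' assume h': "h' \<in> H \<and> (\<forall>f\<in>H. inner2 (\<lambda>Z. g Z - h' Z) f = 0)"
  let ?u = "\<lambda>Z. h' Z - h Z"
  have u: "?u \<in> H" using h h' by (auto intro: H_diff)
  have "inner2 ?u ?u = inner2 (\<lambda>Z. (g Z - h Z) - (g Z - h' Z)) ?u" by simp
  also have "\<dots> = inner2 (\<lambda>Z. g Z - h Z) ?u - inner2 (\<lambda>Z. g Z - h' Z) ?u"
  proof (rule inner2_diff_left)
    show "(\<lambda>Z. g Z - h Z) \<in> L2" "(\<lambda>Z. g Z - h' Z) \<in> L2"
      using L2_diff[OF g H_L2] h h' by blast+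
    show "?u \<in> L2" using u by (rule H_L2)
  qed
  also have "\<dots> = 0" using h h' u by simp
  finally have "nsq ?u = 0" by (simp add: inner2_self)
  then show "h' = h" using H_nsq_0[OF u] by (metis eq_iff_diff_eq_0 ext)
qed

lemma proj:
  assumes g: "g \<in> L2"
  shows "bergman_proj lam g \<in> H" "f \<in> H \<Longrightarrow> inner2 (bergman_proj lam g) f = inner2 g f"
proof -
  obtain h where h: "h \<in> H" "\<And>f. f \<in> H \<Longrightarrow> inner2 (\<lambda>Z. g Z - h Z) f = 0"
    using projection_exists[OF g] by blast
  have e: "bergman_proj lam g = h" using proj_unique[OF g h] by blast
  show "bergman_proj lam g \<in> H" using e h by simp
  show "inner2 (bergman_proj lam g) f = inner2 g f" if "f \<in> H"
    using h(2)[OF that] inner2_diff_left[OF g H_L2[OF h(1)] H_L2[OF that]] e by simp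
qed

lemma proj_nsq:
  assumes g: "g \<in> L2" shows "nsq (bergman_proj lam g) \<le> nsq g"
proof -
  let ?h = "bergman_proj lam g"
  have h: "?h \<in> H" using proj[OF g] by simp
  have "inner2 g ?h = of_real (nsq ?h)"
    using proj(2)[OF g h] by (simp add: inner2_self)
  then have "nsq (\<lambda>Z. g Z - ?h Z) = nsq g - nsq ?h"
    using nsq_diff[OF g H_L2[OF h]] by simp
  then show ?thesis using nsq_nonneg[of "\<lambda>Z. g Z - ?h Z"] by linarith
qed

subsection \<open>Toeplitz operators\<close>

abbreviation T :: "('n cmat \<Rightarrow> complex) \<Rightarrow> 'n operator" where "T \<equiv> toeplitz lam"

text \<open>The conditions on a bounded symbol expressed with the weighted measure, which has the same measurable sets as Lebesgue
  measure on the domain and vanishes on its null sets.\<close>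

definition symbol :: "('n cmat \<Rightarrow> complex) \<Rightarrow> bool" where
  "symbol a \<longleftrightarrow> a \<in> borel_measurable v \<and> (\<exists>C. AE Z in v. cmod (a Z) \<le> C)"

lemma Linf_symbol: "a \<in> Linf_space \<Longrightarrow> symbol a"
  unfolding symbol_def Linf_space_def by (auto simp: borel_measurable_v intro: AE_v)

lemma symbol_cnj: "symbol a \<Longrightarrow> symbol (\<lambda>Z. cnj (a Z))"
  unfolding symbol_def by auto

lemma symbol_mult_L2: "symbol a \<Longrightarrow> f \<in> L2 \<Longrightarrow> (\<lambda>Z. a Z * f Z) \<in> L2"
  unfolding symbol_def using L2_mult_bounded(1) by blast

lemma toeplitz_eq: "f \<in> H \<Longrightarrow> T a f = bergman_proj lam (\<lambda>Z. a Z * f Z)"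
  by (simp add: toeplitz_def)

lemma toeplitz_H: "symbol a \<Longrightarrow> f \<in> H \<Longrightarrow> T a f \<in> H"
  by (simp add: toeplitz_eq proj symbol_mult_L2 H_L2)

lemma toeplitz_inner: "symbol a \<Longrightarrow> f \<in> H \<Longrightarrow> g \<in> H \<Longrightarrow> inner2 (T a f) g = inner2 (\<lambda>Z. a Z * f Z) g"
  by (simp add: toeplitz_eq proj symbol_mult_L2 H_L2)

lemma toeplitz_adjoint:
  assumes "symbol a" "f \<in> H" "g \<in> H"
  shows "inner2 (T a f) g = inner2 f (T (\<lambda>Z. cnj (a Z)) g)"
proof -
  have "inner2 f (T (\<lambda>Z. cnj (a Z)) g) = cnj (inner2 (\<lambda>Z. cnj (a Z) * g Z) f)"
    using toeplitz_inner[OF symbol_cnj[OF assms(1)] assms(3,2)] inner2_cnj by metis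
  also have "\<dots> = inner2 f (\<lambda>Z. cnj (a Z) * g Z)"
    using inner2_cnj by metis
  also have "\<dots> = inner2 (\<lambda>Z. a Z * f Z) g"
    by (simp add: L2_inner_def mult_ac)
  finally show ?thesis using toeplitz_inner assms by simp
qed

lemma toeplitz_bounded_ops:
  assumes a: "symbol a" shows "T a \<in> bounded_ops lam"
proof -
  obtain C where C: "AE Z in v. cmod (a Z) \<le> C" and am: "a \<in> borel_measurable v"
    using a by (auto simp: symbol_def)
  have add: "T a (\<lambda>Z. f Z + g Z) = (\<lambda>Z. T a f Z + T a g Z)" if "f \<in> H" "g \<in> H" for f g
    unfolding toeplitz_eq[OF H_add[OF that]]
  proof (rule proj_unique)
    show "(\<lambda>Z. a Z * (f Z + g Z)) \<in> L2" using a that by (intro symbol_mult_L2 H_L2 H_add)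
    show "(\<lambda>Z. T a f Z + T a g Z) \<in> H" using a that by (intro H_add toeplitz_H)
    fix p assume p: "p \<in> H"
    have "inner2 (\<lambda>Z. a Z * (f Z + g Z) - (T a f Z + T a g Z)) p
       = inner2 (\<lambda>Z. (a Z * f Z + a Z * g Z) - (T a f Z + T a g Z)) p"
      by (simp add: distrib_left)
    also have "\<dots> = 0"
      using a that p by (simp add: inner2_diff_left inner2_add_left L2_add symbol_mult_L2 H_L2 toeplitz_H toeplitz_inner)
    finally show "inner2 (\<lambda>Z. a Z * (f Z + g Z) - (T a f Z + T a g Z)) p = 0" .
  qed
  have sc: "T a (\<lambda>Z. c * f Z) = (\<lambda>Z. c * T a f Z)" if "f \<in> H" for f c
    unfolding toeplitz_eq[OF H_scale[OF that]]
  proof (rule proj_unique)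
    show "(\<lambda>Z. a Z * (c * f Z)) \<in> L2" using a that by (intro symbol_mult_L2 H_L2 H_scale)
    show "(\<lambda>Z. c * T a f Z) \<in> H" using a that by (intro H_scale toeplitz_H)
    fix p assume p: "p \<in> H"
    have "inner2 (\<lambda>Z. a Z * (c * f Z) - c * T a f Z) p = inner2 (\<lambda>Z. c * (a Z * f Z - T a f Z)) p"
      by (simp add: algebra_simps)
    also have "\<dots> = 0"
      using a that p by (simp add: inner2_scale_left inner2_diff_left symbol_mult_L2 H_L2 toeplitz_H toeplitz_inner)
    finally show "inner2 (\<lambda>Z. a Z * (c * f Z) - c * T a f Z) p = 0" .
  qed
  have bd: "L2_norm lam (T a f) \<le> \<bar>C\<bar> * L2_norm lam f" if "f \<in> H" for f
  proof -
    have "nsq (T a f) \<le> nsq (\<lambda>Z. a Z * f Z)"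
      unfolding toeplitz_eq[OF that] using a that by (intro proj_nsq symbol_mult_L2 H_L2)
    also have "\<dots> \<le> C\<^sup>2 * nsq f"
      by (rule L2_mult_bounded(2)[OF H_L2[OF that] am C])
    finally have "sqrt (nsq (T a f)) \<le> sqrt (C\<^sup>2 * nsq f)" by simp
    then show ?thesis by (simp add: L2_norm_nsq real_sqrt_mult)
  qed
  have "T a \<in> H \<rightarrow>\<^sub>E H"
    using toeplitz_H[OF a] by (auto simp: toeplitz_def)
  then show ?thesis
    unfolding bounded_ops_def using add sc bd by blast
qed

text \<open>Composition with \<open>\<phi>\<close> preserves inner products and the Bergman space, so it also preserves the relation that characterises the
  projection.\<close>

lemma toeplitz_symmetry:
  assumes a: "symbol a" and \<phi>: "domain_symmetry \<phi>" "domain_symmetry \<psi>" "\<And>Z. \<phi> (\<psi> Z) = Z" "\<And>Z. \<psi> (\<phi> Z) = Z"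
    and inv: "AE Z in v. a (\<phi> Z) = a Z" and f: "f \<in> H"
  shows "T a (\<lambda>Z. f (\<phi> Z)) = (\<lambda>Z. T a f (\<phi> Z))"
  unfolding toeplitz_eq[OF H_symmetry[OF \<phi>(1) f]]
proof (rule proj_unique)
  have af: "(\<lambda>Z. a Z * f Z) \<in> L2" using a f by (intro symbol_mult_L2 H_L2)
  have m: "\<phi> \<in> v \<rightarrow>\<^sub>M v" by (rule domain_symmetry_measure[OF \<phi>(1)])
  have am [measurable]: "a \<in> borel_measurable v" using a by (simp add: symbol_def)
  have [measurable]: "(\<lambda>Z. a (\<phi> Z)) \<in> borel_measurable v" by (rule measurable_compose[OF m am])
  show 1: "(\<lambda>Z. a Z * f (\<phi> Z)) \<in> L2" by (rule symbol_mult_L2[OF a H_L2[OF H_symmetry[OF \<phi>(1) f]]])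
  show 2: "(\<lambda>Z. T a f (\<phi> Z)) \<in> H" by (rule H_symmetry[OF \<phi>(1) toeplitz_H[OF a f]])
  fix p assume p: "p \<in> H"
  define q where "q Z = p (\<psi> Z)" for Z
  have q: "q \<in> H" unfolding q_def using \<phi>(2) p by (rule H_symmetry)
  let ?u = "\<lambda>Z. a Z * f Z - T a f Z"
  have u: "?u \<in> L2" by (rule L2_diff[OF af H_L2[OF toeplitz_H[OF a f]]])
  have [measurable]: "(\<lambda>Z. f (\<phi> Z)) \<in> borel_measurable v" "(\<lambda>Z. T a f (\<phi> Z)) \<in> borel_measurable v" "p \<in> borel_measurable v"
    using H_symmetry[OF \<phi>(1) f] 2 p by (auto intro: L2_measurable H_L2)
  have "inner2 (\<lambda>Z. a Z * f (\<phi> Z) - T a f (\<phi> Z)) p = inner2 (\<lambda>Z. ?u (\<phi> Z)) (\<lambda>Z. q (\<phi> Z))"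
    unfolding L2_inner_def q_def \<phi>(4)
  proof (rule integral_cong_AE)
    show "AE Z in v. (a Z * f (\<phi> Z) - T a f (\<phi> Z)) * cnj (p Z) = (a (\<phi> Z) * f (\<phi> Z) - T a f (\<phi> Z)) * cnj (p Z)"
      using inv by eventually_elim simp
  qed measurable
  also have "\<dots> = inner2 ?u q"
    by (rule inner2_symmetry[OF \<phi>(1) L2_measurable[OF u] L2_measurable[OF H_L2[OF q]]])
  also have "\<dots> = 0"
    using inner2_diff_left[OF af H_L2[OF toeplitz_H[OF a f]] H_L2[OF q]] toeplitz_inner[OF a f q] by simp
  finally show "inner2 (\<lambda>Z. a Z * f (\<phi> Z) - T a f (\<phi> Z)) p = 0" .
qed

section \<open>Homogeneous functions\<close>

text \<open>These are the homogeneous polynomials of degree \<open>k\<close>, described by their behaviour under scaling.\<close>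

definition Hom :: "nat \<Rightarrow> ('n cmat \<Rightarrow> complex) set" where
  "Hom k = {p \<in> H. \<forall>c Z. cmod c \<le> 1 \<longrightarrow> Z \<in> D \<longrightarrow> p (csc c Z) = c ^ k * p Z}"

lemma Hom_H: "p \<in> Hom k \<Longrightarrow> p \<in> H"
  and Hom_csc: "p \<in> Hom k \<Longrightarrow> cmod c \<le> 1 \<Longrightarrow> Z \<in> D \<Longrightarrow> p (csc c Z) = c ^ k * p Z"
  by (auto simp: Hom_def)

text \<open>The values on the domain are \<open>2\<^sup>k\<close> times the values on the domain shrunk by \<open>1/2\<close>, which is contained in a compact subset \<open>K\<close>.\<close>

lemma homogeneous_bounded:
  assumes p: "holomorphic_mat p D" and hom: "\<And>c Z. cmod c \<le> 1 \<Longrightarrow> Z \<in> D \<Longrightarrow> p (csc c Z) = c ^ k * p Z"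
  obtains C where "\<And>Z. Z \<in> D \<Longrightarrow> cmod (p Z) \<le> C"
proof -
  define K where "K = {Y :: 'n cmat. \<forall>x. norm (Y *v x) \<le> (1/2) * norm x}"
  have "closed K"
    unfolding K_def matrix_vector_mult_def
    by (intro closed_Collect_all closed_Collect_le continuous_intros)
  moreover have KD: "K \<subseteq> D"
  proof
    fix Y assume "Y \<in> K"
    then have "contracts Y"
      by (intro contracts_uniformI[of "1/2"]) (auto simp: K_def)
    then show "Y \<in> D" by (simp add: cartan_domain_iff)
  qed
  moreover have "bounded K"
    using KD bounded_cartan_domain bounded_subset by blast
  ultimately have "compact K" by (simp add: compact_eq_bounded_closed)
  then have "bounded (p ` K)"
    using holomorphic_mat_continuous[OF open_cartan_domain p] KD
    by (intro compact_imp_bounded compact_continuous_image) (auto intro: continuous_on_subset)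
  then obtain C where C: "\<And>Y. Y \<in> K \<Longrightarrow> cmod (p Y) \<le> C"
    unfolding bounded_iff by blast
  have "cmod (p Z) \<le> 2 ^ k * C" if "Z \<in> D" for Z
  proof -
    have "csc (1/2) Z \<in> K"
      using that contracts_le[of Z] by (auto simp: K_def csc_matvec norm_cvec_scale cartan_domain_iff)
    from C[OF this] have "cmod ((1/2) ^ k * p Z) \<le> C"
      using hom[of "1/2" Z] that by simp
    then show ?thesis by (simp add: norm_mult norm_divide norm_power field_simps)
  qed
  then show thesis using that by blast
qed

lemma HomI:
  assumes p: "holomorphic_mat p D" and hom: "\<And>c Z. cmod c \<le> 1 \<Longrightarrow> Z \<in> D \<Longrightarrow> p (csc c Z) = c ^ k * p Z"
    and "\<And>Z. Z \<notin> D \<Longrightarrow> p Z = 0"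
  shows "p \<in> Hom k"
proof -
  obtain C where "\<And>Z. Z \<in> D \<Longrightarrow> cmod (p Z) \<le> C"
    using homogeneous_bounded[OF p hom] by blast
  then show ?thesis using H_bounded[OF p assms(3)] hom by (auto simp: Hom_def)
qed

lemma slice_holomorphic:
  assumes "holomorphic_mat g D" "Z \<in> D"
  obtains R where "R > 1" "(\<lambda>\<zeta>. g (csc \<zeta> Z)) holomorphic_on ball 0 R"
proof -
  obtain R where R: "R > 1" "\<And>c. cmod c < R \<Longrightarrow> csc c Z \<in> D"
    using csc_cartan_domain_beyond[OF assms(2)] by blast
  have "(\<lambda>\<zeta>. g (csc \<zeta> Z)) holomorphic_on ball 0 R"
    by (rule holomorphic_mat_on_curve[OF open_cartan_domain assms(1)]) (use R in \<open>auto intro!: holomorphic_intros\<close>)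
  then show thesis using that R by blast
qed

text \<open>The homogeneous part of degree \<open>k\<close>: a Fourier coefficient for the action of the circle by rotations.\<close>

definition component :: "nat \<Rightarrow> ('n cmat \<Rightarrow> complex) \<Rightarrow> 'n cmat \<Rightarrow> complex" where
  "component k g Z = (if Z \<in> D then \<integral>t. g (csc (expi t) Z) / expi t ^ k \<partial>circ else 0)"

lemma component_eq_taylor:
  assumes "holomorphic_mat g D" "Z \<in> D"
  shows "component k g Z = (deriv ^^ k) (\<lambda>\<zeta>. g (csc \<zeta> Z)) 0 / fact k"
proof -
  obtain R where R: "R > 1" "(\<lambda>\<zeta>. g (csc \<zeta> Z)) holomorphic_on ball 0 R"
    using slice_holomorphic[OF assms] by blast
  then show ?thesis
    using taylor_coefficient_integral(1)[OF R(2,1), of k] assms(2) by (simp add: component_def)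
qed

text \<open>The integral formula shows that the component is holomorphic, and its description as a Taylor coefficient
  along complex lines shows that it is homogeneous.\<close>

lemma component_Hom:
  assumes g: "holomorphic_mat g D" shows "component k g \<in> Hom k"
proof (rule HomI)
  have "holomorphic_mat (\<lambda>Z. \<integral>t. g (csc (expi t) Z) / expi t ^ k \<partial>circ) D"
  proof (rule holomorphic_mat_integral[OF open_cartan_domain])
    have rot: "csc (expi t) Z \<in> D" if "Z \<in> D" for t Z
      using that by (simp add: csc_in_cartan_domain)
    show "holomorphic_mat (\<lambda>Z. g (csc (expi t) Z) / expi t ^ k) D" for t
    proof -
      have "holomorphic_mat (\<lambda>Z. (1 / expi t ^ k) * g (csc (expi t) Z)) D"
        by (intro holomorphic_mat_scale holomorphic_mat_compose_linear[OF open_cartan_domain g] open_cartan_domain linear_csc rot)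
           (auto simp: mult.commute)
      then show ?thesis by simp
    qed
    show "(\<lambda>t. g (csc (expi t) Z) / expi t ^ k) \<in> borel_measurable circ" if "Z \<in> D" for Z
    proof -
      have "continuous_on UNIV (\<lambda>t. g (csc (expi t) Z) / expi t ^ k)"
        by (intro continuous_intros continuous_on_compose2[OF holomorphic_mat_continuous[OF open_cartan_domain g]])
           (auto simp: rot that)
      then show ?thesis by (intro borel_imp_circ borel_measurable_continuous_onI)
    qed
    fix Z assume Z: "Z \<in> D"
    obtain r where r: "r > 0" "cball Z r \<subseteq> D"
      using open_contains_cball open_cartan_domain Z by metis
    define A where "A = (\<lambda>x. csc (fst x) (snd x)) ` (sphere 0 1 \<times> cball Z r)"
    have "compact A"
      unfolding A_def by (intro compact_continuous_image compact_Times compact_sphere compact_cball continuous_intros)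
    moreover have "A \<subseteq> D"
      using r by (auto simp: A_def intro!: csc_in_cartan_domain)
    ultimately have "bounded (g ` A)"
      using holomorphic_mat_continuous[OF open_cartan_domain g]
      by (intro compact_imp_bounded compact_continuous_image) (auto intro: continuous_on_subset)
    then obtain K where K: "\<And>Y. Y \<in> A \<Longrightarrow> cmod (g Y) \<le> K"
      unfolding bounded_iff by blast
    have "cmod (g (csc (expi t) W) / expi t ^ k) \<le> K" if "W \<in> cball Z r" for t W
    proof -
      have "csc (expi t) W \<in> A" using that unfolding A_def by (intro image_eqI[of _ _ "(expi t, W)"]) auto
      then show ?thesis using K by (simp add: norm_divide norm_power)
    qed
    then show "\<exists>r K. r > 0 \<and> cball Z r \<subseteq> D \<and> integrable circ K \<and> (\<forall>t\<in>space circ. \<forall>W\<in>cball Z r. cmod (g (csc (expi t) W) / expi t ^ k) \<le> K t)"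
      using r finite_measure.integrable_const[OF finite_measure_circ]
      by (intro exI[of _ r] exI[of _ "\<lambda>t. K"]) auto
  qed
  then show "holomorphic_mat (component k g) D"
    by (rule holomorphic_mat_cong[rotated]) (simp add: component_def)
  show "component k g Z = 0" if "Z \<notin> D" for Z
    using that by (simp add: component_def)
  fix c :: complex and Z assume c: "cmod c \<le> 1" and Z: "Z \<in> D"
  obtain R where R: "R > 1" "(\<lambda>\<zeta>. g (csc \<zeta> Z)) holomorphic_on ball 0 R"
    using slice_holomorphic[OF g Z] by blast
  have cz: "c * w \<in> ball 0 R" if "w \<in> ball 0 1" for w
  proof -
    have "cmod (c * w) \<le> 1 * cmod w"
      unfolding norm_mult using c by (intro mult_right_mono) auto
    then show ?thesis using that R by simp
  qed
  have "(deriv ^^ k) (\<lambda>\<zeta>. g (csc (c * \<zeta>) Z)) 0 = c ^ k * (deriv ^^ k) (\<lambda>\<zeta>. g (csc \<zeta> Z)) (c * 0)"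
    by (rule higher_deriv_compose_linear[OF R(2) open_ball[of 0 1]]) (use cz in simp_all)
  then show "component k g (csc c Z) = c ^ k * component k g Z"
    using component_eq_taylor[OF g csc_in_cartan_domain[OF Z c], of k] component_eq_taylor[OF g Z, of k]
    by (simp add: mult.commute)
qed

text \<open>Averaging \<open>\<langle>g, p\<rangle>\<close> over rotations replaces \<open>g\<close> by its component of the degree of \<open>p\<close>.  Taking for \<open>p\<close> the component itself shows that all
  components vanish, that is, all Taylor coefficients of \<open>g\<close> along complex lines through the origin.\<close>

lemma homogeneous_dense:
  assumes g: "g \<in> H" and orth: "\<And>k p. p \<in> Hom k \<Longrightarrow> inner2 g p = 0"
  shows "g = (\<lambda>Z. 0)"
proof -
  have hol: "holomorphic_mat g D" using g by (rule H_hol)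
  have zero: "component k g = (\<lambda>Z. 0)" for k
  proof -
    define p where "p = component k g"
    have p: "p \<in> Hom k" unfolding p_def by (rule component_Hom[OF hol])
    have pH: "p \<in> H" using p by (rule Hom_H)
    have bm: "g \<in> borel_measurable borel" "p \<in> borel_measurable borel"
      using g pH by (auto intro: H_borel)
    have "inner2 g p = (\<integral>W. (\<integral>t. g (csc (expi t) W) * cnj (p (csc (expi t) W)) \<partial>circ) \<partial>v)"
      unfolding L2_inner_def
    proof (rule rotation_average(1))
      show "sigma_finite_measure v" by unfold_locales
      show "(\<lambda>W. W) \<in> v \<rightarrow>\<^sub>M borel" by (rule borel_imp_v) simp
      show "csc c \<in> v \<rightarrow>\<^sub>M v" "distr v v (csc c) = v" if "cmod c = 1" for c
        using domain_symmetry_measure[OF domain_symmetry_rotation[OF that]] by auto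
      show "(\<lambda>W. g W * cnj (p W)) \<in> borel_measurable borel"
        using bm by measurable
      show "integrable v (\<lambda>W. g W * cnj (p W))"
        using g pH by (intro L2_prod_integrable H_L2)
    qed
    also have "\<dots> = (\<integral>W. p W * cnj (p W) \<partial>v)"
    proof (rule Bochner_Integration.integral_cong[OF refl])
      fix W assume "W \<in> space v"
      then have W: "W \<in> D" by simp
      have eq: "g (csc (expi t) W) * cnj (p (csc (expi t) W)) = cnj (p W) * (g (csc (expi t) W) / expi t ^ k)" for t
      proof -
        have "p (csc (expi t) W) = expi t ^ k * p W" using Hom_csc[OF p _ W, of "expi t"] by simp
        moreover have "cnj (expi t ^ k) = 1 / expi t ^ k"
        proof -
          have "expi t ^ k * cnj (expi t ^ k) = 1"
            by (metis cmod_expi complex_norm_square norm_power of_real_1 power_one)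
          then show ?thesis by (simp add: field_simps)
        qed
        ultimately show ?thesis by simp
      qed
      have "(\<integral>t. g (csc (expi t) W) * cnj (p (csc (expi t) W)) \<partial>circ) = cnj (p W) * (\<integral>t. g (csc (expi t) W) / expi t ^ k \<partial>circ)"
        by (simp only: eq integral_mult_right_zero)
      also have "\<dots> = cnj (p W) * p W" using W by (simp add: p_def component_def)
      finally show "(\<integral>t. g (csc (expi t) W) * cnj (p (csc (expi t) W)) \<partial>circ) = p W * cnj (p W)"
        by (simp add: mult.commute)
    qed
    also have "\<dots> = of_real (nsq p)"
      by (simp add: inner2_self flip: L2_inner_def)
    finally have "nsq p = 0" using orth[OF p] by simp
    then show ?thesis using H_nsq_0[OF pH] p_def by simp
  qed
  show ?thesis
  proof
    fix Z show "g Z = 0"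
    proof (cases "Z \<in> D")
      case True
      obtain R where R: "R > 1" "(\<lambda>\<zeta>. g (csc \<zeta> Z)) holomorphic_on ball 0 R"
        using slice_holomorphic[OF hol True] by blast
      have "(deriv ^^ k) (\<lambda>\<zeta>. g (csc \<zeta> Z)) 0 = 0" for k
        using component_eq_taylor[OF hol True, of k] zero[of k] by simp
      then have "g (csc 1 Z) = 0"
        using R by (intro holomorphic_fun_eq_0_on_ball[OF R(2)]) auto
      then show ?thesis by simp
    qed (use g H_zero in auto)
  qed
qed

end

section \<open>The unitary group is a set of uniqueness\<close>

text \<open>Its entries are polynomials in the entries of the matrix, unlike those of the inverse.\<close>

definition adjugate :: "'n::finite cmat \<Rightarrow> 'n cmat" where
  "adjugate A = (\<chi> k l. det (\<chi> i j. if j = k then (if i = l then 1 else 0) else A $ i $ j))"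

lemma matmul_adjugate:
  assumes "det A \<noteq> 0" shows "A ** adjugate A = csc (det A) (mat 1)"
proof -
  have "(A ** adjugate A) $ i $ l = det A * (mat 1 :: 'a cmat) $ i $ l" for i l
  proof -
    define x where "x = (\<chi> k. det (\<chi> i j. if j = k then (axis l 1 :: complex ^ 'a) $ i else A $ i $ j) / det A)"
    have "A *v x = axis l 1"
      using cramer[OF assms, of x "axis l 1"] by (simp add: x_def)
    moreover have "adjugate A $ k $ l = det A * x $ k" for k
      using assms by (simp add: adjugate_def x_def axis_def cong: if_cong)
    then have "(A ** adjugate A) $ i $ l = det A * (A *v x) $ i"
      by (simp add: matrix_matrix_mult_def matrix_vector_mult_def sum_distrib_left mult_ac)
    ultimately have "(A ** adjugate A) $ i $ l = det A * (axis l 1 :: complex ^ 'a) $ i"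
      by simp
    then show ?thesis by (simp add: axis_def mat_def)
  qed
  then show ?thesis by (simp add: vec_eq_iff)
qed

lemma adjugate_inverse:
  assumes "B ** A = mat 1" "det A \<noteq> 0" shows "adjugate A = csc (det A) B"
proof -
  have "adjugate A = B ** (A ** adjugate A)"
    by (simp add: matrix_mul_assoc assms(1))
  then show ?thesis by (simp add: matmul_adjugate[OF assms(2)] csc_mult)
qed

lemma holomorphic_on_det:
  fixes M :: "complex \<Rightarrow> 'n::finite cmat"
  assumes "\<And>i j. (\<lambda>z. M z $ i $ j) holomorphic_on S"
  shows "(\<lambda>z. det (M z)) holomorphic_on S"
  unfolding det_def by (intro holomorphic_intros assms)

lemma holomorphic_on_adjugate:
  fixes M :: "complex \<Rightarrow> 'n::finite cmat"
  assumes "\<And>i j. (\<lambda>z. M z $ i $ j) holomorphic_on S"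
  shows "(\<lambda>z. adjugate (M z) $ k $ l) holomorphic_on S"
proof -
  have "(\<lambda>z. if j = k then if i = l then 1 else 0 else M z $ i $ j) holomorphic_on S" for i j
    using assms by (cases "j = k"; cases "i = l") auto
  then show ?thesis
    unfolding adjugate_def by (simp add: holomorphic_on_det)
qed

text \<open>The Cayley transform \<open>(X - \<i>)(X + \<i>)\<^sup>-\<^sup>1\<close> of a Hermitian matrix is unitary; the adjugate is the inverse up to the factor \<open>det (X + \<i>)\<close>.\<close>

lemma cayley_unitary:
  assumes X: "ctransp X = X"
  shows "\<exists>U\<in>unitary_group. (X - csc \<i> (mat 1)) ** adjugate (X + csc \<i> (mat 1)) = csc (det (X + csc \<i> (mat 1))) U"
proof -
  define A where "A = X + csc \<i> (mat 1)"
  define C where "C = X - csc \<i> (mat 1)"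
  have AC: "ctransp A = C" "ctransp C = A"
    using X by (simp_all add: A_def C_def vec_eq_iff mat_def)
  have comm: "A ** C = C ** A"
    by (simp add: A_def C_def matmul_add_distrib matmul_diff_distrib csc_mult vec_eq_iff algebra_simps)
  have "inj ((*v) A)"
  proof (rule injI)
    fix x y assume "A *v x = A *v y"
    define w where "w = x - y"
    have "A *v w = 0"
      using \<open>A *v x = A *v y\<close> by (simp add: w_def matrix_vector_mult_diff_distrib)
    then have "X *v w + \<i> *s w = 0"
      by (simp add: A_def matrix_vector_mult_add_rdistrib csc_matvec)
    then have Xw: "X *v w = (- \<i>) *s w"
      by (simp add: vec_eq_iff eq_neg_iff_add_eq_0)
    have "(\<i> *s w) \<bullet> (X *v w) = (X *v (\<i> *s w)) \<bullet> w"
      using inner_matvec[of "\<i> *s w" X w] X by simp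
    also have "X *v (\<i> *s w) = w"
      using Xw by (simp add: vector_scalar_commute vec_eq_iff)
    finally have "(\<i> *s w) \<bullet> ((- \<i>) *s w) = w \<bullet> w"
      by (simp only: Xw)
    moreover have "(\<i> *s w) \<bullet> ((- \<i>) *s w) = - (w \<bullet> w)"
    proof -
      have "(- \<i>) *s w = - (\<i> *s w)" by (simp add: vec_eq_iff)
      then show ?thesis
        by (simp only: inner_minus_right power2_norm_eq_inner[symmetric] norm_cvec_scale) simp
    qed
    ultimately have "w = 0" by (simp add: eq_neg_iff_add_eq_0)
    then show "x = y" by (simp add: w_def)
  qed
  then obtain B where B: "B ** A = mat 1"
    using matrix_left_invertible_injective by blast
  then have B': "A ** B = mat 1"
    using matrix_left_right_inverse by blast
  have d: "det A \<noteq> 0"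
    using B by (metis det_I det_mul mult_zero_right zero_neq_one)
  have CB: "C ** ctransp B = mat 1" "ctransp B ** C = mat 1"
    using arg_cong[OF B, of ctransp] arg_cong[OF B', of ctransp] by (simp_all add: AC)
  have "ctransp (C ** B) ** (C ** B) = mat 1"
  proof -
    have "ctransp (C ** B) ** (C ** B) = ctransp B ** (A ** C) ** B"
      by (simp add: AC matrix_mul_assoc)
    also have "\<dots> = (ctransp B ** C) ** (A ** B)"
      by (simp only: comm matrix_mul_assoc)
    finally show ?thesis by (simp add: CB B')
  qed
  then have "C ** B \<in> unitary_group"
    unfolding unitary_group_def using matrix_left_right_inverse by blast
  moreover have "C ** adjugate A = csc (det A) (C ** B)"
    by (simp add: adjugate_inverse[OF B d] csc_mult)
  ultimately show ?thesis
    unfolding A_def C_def by blast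
qed

lemma zero_islimpt_Reals: "(0::complex) islimpt \<real>"
  unfolding islimpt_approachable
proof (intro allI impI)
  fix e :: real assume "e > 0"
  then show "\<exists>x'\<in>\<real>. x' \<noteq> 0 \<and> dist x' (0::complex) < e"
    by (intro bexI[of _ "of_real (e / 2)"]) (auto simp: norm_divide)
qed

text \<open>Homogeneity allows clearing the denominator of the Cayley transform, which makes \<open>\<Psi>\<close> an entire function of \<open>X\<close> that vanishes on
  Hermitian matrices.  Every matrix has the form \<open>P + \<i> Q\<close> with \<open>P\<close>, \<open>Q\<close> Hermitian, and \<open>z \<mapsto> \<Psi>(P + z Q)\<close> vanishes on the real
  line, so \<open>\<Psi>\<close> vanishes identically.  The Cayley transforms of general matrices fill a neighbourhood of the origin, and homogeneity
  does the rest.\<close>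

lemma homogeneous_zero_on_unitary:
  fixes \<Phi> :: "'n::finite cmat \<Rightarrow> complex"
  assumes hol: "holomorphic_mat \<Phi> UNIV" and hom: "\<And>c Y. \<Phi> (csc c Y) = c ^ k * \<Phi> Y"
    and zero: "\<And>U. U \<in> unitary_group \<Longrightarrow> \<Phi> U = 0"
  shows "\<Phi> Y = 0"
proof -
  let ?i = "csc \<i> (mat 1) :: 'n cmat"
  define \<Psi> where "\<Psi> X = \<Phi> ((X - ?i) ** adjugate (X + ?i))" for X
  have herm: "\<Psi> X = 0" if "ctransp X = X" for X
    using cayley_unitary[OF that] zero unfolding \<Psi>_def by (metis hom mult_zero_right)
  have all: "\<Psi> X = 0" for X
  proof -
    define P where "P = csc (1/2) (X + ctransp X)"
    define Q where "Q = csc (1/(2 * \<i>)) (X - ctransp X)"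
    have PQ: "ctransp P = P" "ctransp Q = Q" "X = P + csc \<i> Q"
      by (simp_all add: P_def Q_def vec_eq_iff field_simps)
    define M where "M z = P + csc z Q" for z
    have hM: "(\<lambda>z. M z $ i $ j) holomorphic_on UNIV" for i j
      unfolding M_def by (auto intro!: holomorphic_intros)
    have ent: "(\<lambda>z. ((M z - ?i) ** adjugate (M z + ?i)) $ i $ j) holomorphic_on UNIV" for i j
    proof -
      have "(\<lambda>z. (M z - ?i) $ i $ l) holomorphic_on UNIV" and "(\<lambda>z. adjugate (M z + ?i) $ l $ j) holomorphic_on UNIV" for l
        using hM by (auto intro!: holomorphic_intros holomorphic_on_adjugate)
      then have "(\<lambda>z. \<Sum>l\<in>UNIV. (M z - ?i) $ i $ l * adjugate (M z + ?i) $ l $ j) holomorphic_on UNIV"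
        by (intro holomorphic_on_sum holomorphic_on_mult)
      then show ?thesis
        by (simp only: matrix_matrix_mult_def vec_lambda_beta)
    qed
    have "(\<lambda>z. \<Psi> (M z)) holomorphic_on UNIV"
      unfolding \<Psi>_def by (rule holomorphic_mat_on_curve[OF open_UNIV hol]) (use ent in auto)
    moreover have "\<Psi> (M z) = 0" if "z \<in> \<real>" for z
    proof (rule herm)
      have "cnj z = z" using that by (simp add: Reals_cnj_iff)
      then show "ctransp (M z) = M z"
        using PQ by (simp add: M_def vec_eq_iff)
    qed
    ultimately have "\<Psi> (M \<i>) = 0"
      by (rule analytic_continuation[OF _ open_UNIV connected_UNIV subset_UNIV UNIV_I zero_islimpt_Reals]) auto
    then show ?thesis by (simp add: M_def PQ(3))
  qed
  have small: "\<Phi> Y = 0" if "norm Y < 1" for Y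
  proof -
    have "inj ((*v) (mat 1 - Y))"
    proof (rule injI)
      fix x y assume "(mat 1 - Y) *v x = (mat 1 - Y) *v y"
      then have "(mat 1 - Y) *v (x - y) = 0"
        by (simp add: matrix_vector_mult_diff_distrib)
      then have "x - y = Y *v (x - y)"
        by (simp add: matrix_vector_mult_diff_rdistrib)
      from arg_cong[OF this, of norm] have le: "norm (x - y) \<le> norm Y * norm (x - y)"
        using norm_matvec_le[of Y "x - y"] by linarith
      show "x = y"
      proof (rule ccontr)
        assume "x \<noteq> y"
        then have "norm Y * norm (x - y) < 1 * norm (x - y)"
          using that by (intro mult_strict_right_mono) auto
        with le show False by linarith
      qed
    qed
    then obtain B where B: "B ** (mat 1 - Y) = mat 1"
      using matrix_left_invertible_injective by blast
    then have B': "(mat 1 - Y) ** B = mat 1"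
      using matrix_left_right_inverse by blast
    \<comment> \<open>The inverse Cayley transform of \<open>Y\<close>.\<close>
    define X where "X = csc \<i> ((mat 1 + Y) ** B)"
    have Xp: "X + ?i = csc (2 * \<i>) B"
    proof -
      have "X + ?i = csc \<i> ((mat 1 + Y) ** B + (mat 1 - Y) ** B)"
        by (simp add: X_def B' csc_add)
      also have "(mat 1 + Y) ** B + (mat 1 - Y) ** B = csc 2 B"
        by (simp add: matmul_add_distrib matmul_diff_distrib vec_eq_iff)
      finally show ?thesis by (simp add: mult.commute)
    qed
    have Xm: "X - ?i = csc (2 * \<i>) (Y ** B)"
    proof -
      have "X - ?i = csc \<i> ((mat 1 + Y) ** B - (mat 1 - Y) ** B)"
        by (simp add: X_def B' vec_eq_iff algebra_simps)
      also have "(mat 1 + Y) ** B - (mat 1 - Y) ** B = csc 2 (Y ** B)"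
        by (simp add: matmul_add_distrib matmul_diff_distrib vec_eq_iff)
      finally show ?thesis by (simp add: mult.commute)
    qed
    have inv: "csc (1 / (2 * \<i>)) (mat 1 - Y) ** (X + ?i) = mat 1"
      by (simp add: Xp csc_mult B')
    have d: "det (X + ?i) \<noteq> 0"
      using inv by (metis det_I det_mul mult_zero_right zero_neq_one)
    have "(X - ?i) ** adjugate (X + ?i) = csc (det (X + ?i)) Y"
      unfolding adjugate_inverse[OF inv d] Xm
      by (simp add: csc_mult matrix_mul_assoc[symmetric] B)
    then have "det (X + ?i) ^ k * \<Phi> Y = 0"
      using all[of X] by (simp add: \<Psi>_def hom)
    then show ?thesis using d by simp
  qed
  define s where "s = complex_of_real (1 / (norm Y + 1))"
  have "norm Y + 1 > 0" by (simp add: add_nonneg_pos)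
  then have s: "s \<noteq> 0" "norm (csc s Y) < 1"
    by (simp_all add: s_def norm_divide del: of_real_add)
  from small[OF s(2)] show ?thesis using s(1) by (simp add: hom)
qed

context weighted_bergman
begin

section \<open>Homogeneous functions extend to all matrices\<close>

text \<open>A homogeneous function is determined at any matrix by its values in the domain after scaling; the factor \<open>norm Y + 1\<close> is one
  that always brings \<open>Y\<close> into the domain, and by \<open>hext_eq\<close> every other such factor gives the same value.\<close>

definition hext :: "nat \<Rightarrow> ('n cmat \<Rightarrow> complex) \<Rightarrow> 'n cmat \<Rightarrow> complex" where
  "hext k p Y = of_real (norm Y + 1) ^ k * p (csc (1 / of_real (norm Y + 1)) Y)"

lemma norm_add_1_pos: "norm (Y :: 'n cmat) + 1 > 0"
  by (simp add: add_nonneg_pos)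

lemma scale_in_D: "norm (Y :: 'n cmat) < t \<Longrightarrow> csc (1 / of_real t) Y \<in> D"
proof (rule ball_subset_cartan_domain)
  assume "norm Y < t"
  moreover from this have "t > 0" using norm_ge_zero[of Y] by linarith
  ultimately show "norm (csc (1 / of_real t) Y) < 1" by (simp add: norm_divide)
qed

lemma hext_eq:
  assumes p: "p \<in> Hom k" and t: "t > 0" and D: "csc (1 / of_real t) Y \<in> D"
  shows "hext k p Y = of_real t ^ k * p (csc (1 / of_real t) Y)"
proof -
  define w where "w = max t (norm Y + 1)"
  have red: "of_real u ^ k * p (csc (1 / of_real u) Y) = of_real w ^ k * p (csc (1 / of_real w) Y)"
    if u: "0 < u" "u \<le> w" "csc (1 / of_real u) Y \<in> D" for u
  proof -
    have w: "w > 0" using u by linarith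
    have "csc (1 / of_real w) Y = csc (of_real (u / w)) (csc (1 / of_real u) Y)"
      using u w by simp
    then have "p (csc (1 / of_real w) Y) = of_real (u / w) ^ k * p (csc (1 / of_real u) Y)"
      using Hom_csc[OF p _ u(3), of "of_real (u / w)"] u w by (simp add: norm_divide)
    then show ?thesis using w by (simp add: power_divide)
  qed
  show ?thesis
    unfolding hext_def
    using red[of t] red[of "norm Y + 1"] t D norm_add_1_pos[of Y] scale_in_D[of Y "norm Y + 1"]
    by (simp add: w_def)
qed

lemma hext_on_D: "p \<in> Hom k \<Longrightarrow> Y \<in> D \<Longrightarrow> hext k p Y = p Y"
  using hext_eq[of p k 1 Y] by simp

lemma hext_csc:
  assumes p: "p \<in> Hom k" shows "hext k p (csc c Y) = c ^ k * hext k p Y"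
proof -
  define a b where "a = 1 + cmod c" and "b = norm Y + 1"
  have a: "a > 0" and b: "b > 0" using norm_add_1_pos[of Y] by (simp_all add: a_def b_def add_pos_nonneg)
  have YD: "csc (1 / of_real b) Y \<in> D" by (rule scale_in_D) (simp add: b_def)
  have c: "cmod (c / of_real a) \<le> 1" using a by (simp only: norm_divide norm_of_real) (simp add: a_def)
  have eq: "csc (1 / of_real (a * b)) (csc c Y) = csc (c / of_real a) (csc (1 / of_real b) Y)"
    using a b by simp
  have "hext k p (csc c Y) = of_real (a * b) ^ k * p (csc (1 / of_real (a * b)) (csc c Y))"
    using a b csc_in_cartan_domain[OF YD c] by (intro hext_eq p) (simp_all only: eq mult_pos_pos)
  also have "\<dots> = of_real (a * b) ^ k * ((c / of_real a) ^ k * p (csc (1 / of_real b) Y))"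
    unfolding eq by (simp only: Hom_csc[OF p c YD])
  also have "\<dots> = c ^ k * (of_real b ^ k * p (csc (1 / of_real b) Y))"
    using a by (simp add: power_mult_distrib power_divide)
  also have "of_real b ^ k * p (csc (1 / of_real b) Y) = hext k p Y"
    using hext_eq[OF p b YD] by simp
  finally show ?thesis .
qed

text \<open>Near a given matrix the scaling factor can be kept constant.\<close>

lemma hext_holomorphic:
  assumes p: "p \<in> Hom k" shows "holomorphic_mat (hext k p) UNIV"
  unfolding holomorphic_mat_iff[OF open_UNIV]
proof
  fix Z :: "'n cmat"
  define t where "t = norm Z + 2"
  have t: "t > 0" unfolding t_def using norm_ge_zero[of Z] by linarith
  have inD: "csc (1 / of_real t) Y \<in> D" if "Y \<in> ball Z 1" for Y
  proof (rule scale_in_D)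
    have "norm Y \<le> norm Z + norm (Y - Z)" by (metis add_diff_cancel_left' diff_add_cancel norm_triangle_ineq add.commute)
    then show "norm Y < t" using that by (simp add: t_def dist_norm norm_minus_commute)
  qed
  have "holomorphic_mat (\<lambda>Y. of_real t ^ k * p (csc (1 / of_real t) Y)) (ball Z 1)"
    using p inD
    by (intro holomorphic_mat_scale open_ball holomorphic_mat_compose_linear[OF open_cartan_domain H_hol[OF Hom_H[OF p]]] linear_csc)
       (auto simp: mult.commute)
  then have "holomorphic_mat (hext k p) (ball Z 1)"
    by (rule holomorphic_mat_cong[rotated]) (simp add: hext_eq[OF p t inD])
  then show "\<exists>f'. (hext k p has_derivative f') (at Z) \<and> (\<forall>c H. f' (csc c H) = c * f' H)"
    unfolding holomorphic_mat_iff[OF open_ball] by simp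
qed

lemma hext_continuous: "p \<in> Hom k \<Longrightarrow> continuous_on UNIV (hext k p)"
  by (rule holomorphic_mat_continuous[OF open_UNIV hext_holomorphic])

section \<open>Integral representation of invariant Toeplitz operators\<close>

text \<open>Evaluation is the inner product with the kernel of \<open>evaluation_kernel\<close>; the kernel may be replaced by its projection \<open>h\<close>, and the
  projection in the Toeplitz operator then disappears, which leaves \<open>\<beta> = a cnj(h)\<close>.\<close>

lemma toeplitz_evaluation:
  assumes a: "symbol a" and Z: "Z \<in> D"
  obtains \<beta> where "\<beta> \<in> L2" "\<And>f. f \<in> H \<Longrightarrow> T a f Z = (\<integral>W. f W * \<beta> W \<partial>v)"
proof -
  obtain \<kappa> where \<kappa>: "\<kappa> \<in> L2" "\<And>f. f \<in> H \<Longrightarrow> f Z = inner2 f \<kappa>"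
    using evaluation_kernel[OF Z] by (metis centre_in_cball less_imp_le)
  let ?h = "bergman_proj lam \<kappa>"
  have h: "?h \<in> H" by (rule proj(1)[OF \<kappa>(1)])
  have "T a f Z = (\<integral>W. f W * (a W * cnj (?h W)) \<partial>v)" if f: "f \<in> H" for f
  proof -
    have Tf: "T a f \<in> H" by (rule toeplitz_H[OF a f])
    have "T a f Z = inner2 (T a f) \<kappa>" by (rule \<kappa>(2)[OF Tf])
    also have "\<dots> = inner2 (T a f) ?h"
      using proj(2)[OF \<kappa>(1) Tf] inner2_cnj by metis
    also have "\<dots> = inner2 (\<lambda>Z. a Z * f Z) ?h" by (rule toeplitz_inner[OF a f h])
    finally show ?thesis by (simp add: L2_inner_def mult_ac)
  qed
  moreover have "(\<lambda>W. a W * cnj (?h W)) \<in> L2"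
    by (rule symbol_mult_L2[OF a L2_cnj[OF H_L2[OF h]]])
  ultimately show thesis using that by blast
qed

lemma toeplitz_scale:
  assumes "symbol a" "f \<in> H" shows "T a (\<lambda>Z. c * f Z) = (\<lambda>Z. c * T a f Z)"
  using toeplitz_bounded_ops[OF assms(1)] assms(2) by (auto simp: bounded_ops_def)

text \<open>Since the operator commutes with rotations, the image has the right behaviour under scalars on the
  unit circle; the maximum principle extends it to the unit disc.\<close>

lemma toeplitz_Hom:
  assumes a: "symbol a" and rot: "\<And>c f. cmod c = 1 \<Longrightarrow> f \<in> H \<Longrightarrow> T a (\<lambda>Z. f (csc c Z)) = (\<lambda>Z. T a f (csc c Z))"
    and p: "p \<in> Hom k"
  shows "T a p \<in> Hom k"
proof -
  define q where "q = T a p"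
  have q: "q \<in> H" unfolding q_def by (rule toeplitz_H[OF a Hom_H[OF p]])
  have circle: "q (csc c Z) = c ^ k * q Z" if c: "cmod c = 1" for c Z
  proof -
    have "p (csc c W) = c ^ k * p W" for W
    proof (cases "W \<in> D")
      case True
      then show ?thesis using Hom_csc[OF p] c by simp
    next
      case False
      then have "csc c W \<notin> D"
        using domain_symmetry_rotation[OF c] by (auto simp: domain_symmetry_def)
      then show ?thesis using False H_zero[OF Hom_H[OF p]] by simp
    qed
    then have "T a (\<lambda>W. c ^ k * p W) = (\<lambda>Z. q (csc c Z))"
      using rot[OF c Hom_H[OF p]] by (simp add: q_def)
    then show ?thesis
      using toeplitz_scale[OF a Hom_H[OF p], of "c ^ k"] by (simp add: q_def fun_eq_iff)
  qed
  have "q (csc c Z) = c ^ k * q Z" if c: "cmod c \<le> 1" and Z: "Z \<in> D" for c Z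
  proof -
    obtain R where R: "R > 1" "(\<lambda>\<zeta>. q (csc \<zeta> Z)) holomorphic_on ball 0 R"
      using slice_holomorphic[OF H_hol[OF q] Z] by blast
    let ?\<phi> = "\<lambda>\<zeta>. q (csc \<zeta> Z) - \<zeta> ^ k * q Z"
    have hol: "?\<phi> holomorphic_on ball 0 R"
      by (intro holomorphic_intros R)
    have "cmod (?\<phi> c) \<le> 0"
    proof (rule maximum_modulus_frontier[of ?\<phi> "cball 0 1"])
      show "?\<phi> holomorphic_on interior (cball 0 1)"
        using R(1) by (intro holomorphic_on_subset[OF hol]) auto
      show "continuous_on (closure (cball 0 1)) ?\<phi>"
        using R(1) by (intro holomorphic_on_imp_continuous_on holomorphic_on_subset[OF hol]) auto
      show "cmod (?\<phi> z) \<le> 0" if "z \<in> frontier (cball 0 1)" for z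
        using that circle[of z Z] by simp
    qed (use c in auto)
    then show ?thesis by simp
  qed
  then show ?thesis using q by (simp add: Hom_def q_def)
qed

text \<open>Left and right multiplication are treated together: \<open>m Y W\<close> multiplies \<open>W\<close> by \<open>Y\<close>, on one fixed side.\<close>

definition one_sided :: "('n cmat \<Rightarrow> 'n cmat \<Rightarrow> 'n cmat) \<Rightarrow> bool" where
  "one_sided m \<longleftrightarrow> m = (\<lambda>Y W. Y ** W) \<or> m = (\<lambda>Y W. W ** Y)"

lemma one_sided:
  assumes "one_sided m"
  shows "linear (\<lambda>Y. m Y W)" "m (csc c Y) W = csc c (m Y W)" "m Y (csc c W) = csc c (m Y W)"
    "m Y (mat 1) = Y" "m (mat 1) W = W" "continuous_on UNIV (\<lambda>x. m (fst x) (snd x))"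
    "U \<in> unitary_group \<Longrightarrow> W \<in> D \<Longrightarrow> m U W \<in> D"
  using assms linear_matmul[of W] contracts_unitary_mult[of U W] unfolding one_sided_def cartan_domain_iff
  by (auto simp: csc_mult intro!: continuous_intros)

text \<open>For unitary \<open>Y\<close> the formula evaluates the image of the translate \<open>p (m Y \<cdot>)\<close> at one point, and both sides are
  entire and homogeneous in \<open>Y\<close>, so that \<open>homogeneous_zero_on_unitary\<close> gives it for all \<open>Y\<close>.  The function \<open>\<beta>\<close> is the same
  for all \<open>p\<close> and \<open>k\<close>.\<close>

lemma toeplitz_representation:
  assumes m: "one_sided m" and a: "symbol a"
    and inv: "\<And>U f. U \<in> unitary_group \<Longrightarrow> f \<in> H \<Longrightarrow> T a (\<lambda>Z. f (m U Z)) = (\<lambda>Z. T a f (m U Z))"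
  obtains \<beta> where "\<beta> \<in> L2"
    "\<And>k p. p \<in> Hom k \<Longrightarrow> T a p \<in> Hom k"
    "\<And>k p Y. p \<in> Hom k \<Longrightarrow> (1/2) ^ k * hext k (T a p) Y = (\<integral>W. hext k p (m Y W) * \<beta> W \<partial>v)"
proof -
  \<comment> \<open>The identity matrix lies on the boundary of the domain, so evaluation takes place at half of it; this produces the factor \<open>(1/2) ^ k\<close>.\<close>
  define Z0 where "Z0 = csc (1/2) (mat 1 :: 'n cmat)"
  have "contracts Z0"
    by (rule contracts_uniformI[of "1/2"]) (simp_all add: Z0_def csc_matvec norm_cvec_scale)
  then have Z0: "Z0 \<in> D" by (simp add: cartan_domain_iff)
  obtain \<beta> where \<beta>: "\<beta> \<in> L2" "\<And>f. f \<in> H \<Longrightarrow> T a f Z0 = (\<integral>W. f W * \<beta> W \<partial>v)"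
    using toeplitz_evaluation[OF a Z0] by blast
  have [measurable]: "\<beta> \<in> borel_measurable v" using \<beta>(1) by (rule L2_measurable)
  have i\<beta>: "integrable v (\<lambda>W. cmod (\<beta> W))" using L2_integrable[OF \<beta>(1)] by simp
  have rot: "T a (\<lambda>Z. f (csc c Z)) = (\<lambda>Z. T a f (csc c Z))" if "cmod c = 1" "f \<in> H" for c f
    using inv[OF csc_unitary[OF that(1)] that(2)] by (simp add: one_sided[OF m])
  have THom: "T a p \<in> Hom k" if "p \<in> Hom k" for p k
    by (rule toeplitz_Hom[OF a rot that])
  have "(1/2) ^ k * hext k (T a p) Y = (\<integral>W. hext k p (m Y W) * \<beta> W \<partial>v)" if p: "p \<in> Hom k" for k p Y
  proof -
    define q where "q = T a p"
    have q: "q \<in> Hom k" unfolding q_def by (rule THom[OF p])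
    let ?F = "\<lambda>W Y. hext k p (m Y W) * \<beta> W"
    define \<Phi> where "\<Phi> Y = (1/2) ^ k * hext k q Y - (\<integral>W. ?F W Y \<partial>v)" for Y
    have cont: "continuous_on UNIV (\<lambda>x. hext k p (m (fst x) (snd x)))"
      by (rule continuous_on_compose2[OF hext_continuous[OF p] one_sided(6)[OF m]]) auto
    have hF: "holomorphic_mat (\<lambda>Y. \<integral>W. ?F W Y \<partial>v) UNIV"
    proof (rule holomorphic_mat_integral[OF open_UNIV])
      show "holomorphic_mat (?F W) UNIV" for W
        by (intro holomorphic_mat_mult holomorphic_mat_const open_UNIV
            holomorphic_mat_compose_linear[OF open_UNIV hext_holomorphic[OF p]])
           (simp_all add: one_sided[OF m])
      show "(\<lambda>W. ?F W Y) \<in> borel_measurable v" for Y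
      proof -
        have "continuous_on UNIV (\<lambda>W. (Y, W))" by (intro continuous_intros)
        from continuous_on_compose2[OF cont this] have "continuous_on UNIV (\<lambda>W. hext k p (m Y W))"
          by simp
        then have [measurable]: "(\<lambda>W. hext k p (m Y W)) \<in> borel_measurable v"
          by (intro borel_imp_v borel_measurable_continuous_onI)
        show ?thesis by measurable
      qed
      fix Y :: "'n cmat"
      have "compact ((\<lambda>x. hext k p (m (fst x) (snd x))) ` (cball Y 1 \<times> closure D))"
        using bounded_cartan_domain
        by (intro compact_continuous_image compact_Times compact_cball) (auto intro: continuous_on_subset[OF cont])
      from compact_imp_bounded[OF this] obtain K where K: "\<And>x. x \<in> cball Y 1 \<times> closure D \<Longrightarrow> cmod (hext k p (m (fst x) (snd x))) \<le> K"
        unfolding bounded_iff by blast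
      have "cmod (?F W V) \<le> K * cmod (\<beta> W)" if "W \<in> D" "V \<in> cball Y 1" for W V
        using K[of "(V, W)"] that closure_subset[of D] by (auto simp: norm_mult intro!: mult_right_mono)
      then show "\<exists>r K. r > 0 \<and> cball Y r \<subseteq> UNIV \<and> integrable v K \<and> (\<forall>W\<in>space v. \<forall>V\<in>cball Y r. cmod (?F W V) \<le> K W)"
        using i\<beta> by (intro exI[of _ 1] exI[of _ "\<lambda>W. K * cmod (\<beta> W)"]) simp
    qed
    have "\<Phi> Y = 0"
    proof (rule homogeneous_zero_on_unitary)
      have "holomorphic_mat (\<lambda>Y. (1/2) ^ k * hext k q Y + (-1) * (\<integral>W. ?F W Y \<partial>v)) UNIV"
        by (intro holomorphic_mat_add holomorphic_mat_scale open_UNIV hF hext_holomorphic q)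
      then show "holomorphic_mat \<Phi> UNIV" by (simp add: \<Phi>_def[abs_def])
      show "\<Phi> (csc c Y) = c ^ k * \<Phi> Y" for c Y
      proof -
        have F: "?F W (csc c Y) = c ^ k * ?F W Y" for W
          by (simp add: one_sided[OF m] hext_csc[OF p])
        have "(\<integral>W. ?F W (csc c Y) \<partial>v) = c ^ k * (\<integral>W. ?F W Y \<partial>v)"
          by (simp only: F integral_mult_right_zero)
        then show ?thesis
          unfolding \<Phi>_def hext_csc[OF q] by (simp only: right_diff_distrib mult.left_commute)
      qed
      fix U :: "'n cmat" assume U: "U \<in> unitary_group"
      have mU: "m U Z0 = csc (1/2) U" by (simp add: Z0_def one_sided[OF m])
      have UD: "csc (1/2) U \<in> D" using one_sided(7)[OF m U Z0] by (simp add: mU)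
      have "hext k q U = 2 ^ k * q (csc (1/2) U)"
        using hext_eq[OF q, of 2 U] UD by simp
      then have "(1/2) ^ k * hext k q U = T a p (m U Z0)"
        by (simp add: q_def mU power_divide)
      also have "\<dots> = T a (\<lambda>Z. p (m U Z)) Z0"
        by (simp add: inv[OF U Hom_H[OF p]])
      also have "\<dots> = (\<integral>W. p (m U W) * \<beta> W \<partial>v)"
      proof (rule \<beta>(2))
        have "domain_symmetry (m U)"
          using m domain_symmetry_unitary[OF U] by (auto simp: one_sided_def)
        then show "(\<lambda>Z. p (m U Z)) \<in> H" by (rule H_symmetry) (rule Hom_H[OF p])
      qed
      also have "\<dots> = (\<integral>W. ?F W U \<partial>v)"
        by (rule Bochner_Integration.integral_cong[OF refl]) (simp add: hext_on_D[OF p] one_sided(7)[OF m U])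
      finally show "\<Phi> U = 0" by (simp add: \<Phi>_def)
    qed
    then show ?thesis by (simp add: \<Phi>_def q_def)
  qed
  then show thesis using that \<beta>(1) THom by blast
qed

section \<open>Commutation of left and right invariant Toeplitz operators\<close>

definition left_symbol :: "('n cmat \<Rightarrow> complex) \<Rightarrow> bool" where
  "left_symbol a \<longleftrightarrow> symbol a \<and> (\<forall>U\<in>unitary_group. AE Z in v. a (U ** Z) = a Z)"

definition right_symbol :: "('n cmat \<Rightarrow> complex) \<Rightarrow> bool" where
  "right_symbol a \<longleftrightarrow> symbol a \<and> (\<forall>U\<in>unitary_group. AE Z in v. a (Z ** U) = a Z)"

lemma left_symbol_cnj: "left_symbol a \<Longrightarrow> left_symbol (\<lambda>Z. cnj (a Z))"
  by (auto simp: left_symbol_def symbol_cnj)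

lemma right_symbol_cnj: "right_symbol a \<Longrightarrow> right_symbol (\<lambda>Z. cnj (a Z))"
  by (auto simp: right_symbol_def symbol_cnj)

lemma toeplitz_left:
  assumes "left_symbol a" "U \<in> unitary_group" "f \<in> H"
  shows "T a (\<lambda>Z. f (U ** Z)) = (\<lambda>Z. T a f (U ** Z))"
  by (rule toeplitz_symmetry[of a "\<lambda>Z. U ** Z" "\<lambda>Z. ctransp U ** Z"])
     (use assms in \<open>auto simp: left_symbol_def unitary_cancel domain_symmetry_unitary unitary_ctransp\<close>)

lemma toeplitz_right:
  assumes "right_symbol a" "U \<in> unitary_group" "f \<in> H"
  shows "T a (\<lambda>Z. f (Z ** U)) = (\<lambda>Z. T a f (Z ** U))"
  by (rule toeplitz_symmetry[of a "\<lambda>Z. Z ** U" "\<lambda>Z. Z ** ctransp U"])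
     (use assms in \<open>auto simp: right_symbol_def unitary_cancel domain_symmetry_unitary unitary_ctransp\<close>)

text \<open>Both compositions, evaluated at \<open>Y\<close>, equal \<open>4\<^sup>k\<close> times the integral of \<open>p(X Y W) \<beta>(X) \<alpha>(W)\<close> over \<open>X\<close> and \<open>W\<close>; the left invariant operator acts on
  the argument from the right and the right invariant one from the left, so the two do not interfere.\<close>

lemma commute_on_Hom:
  assumes a: "left_symbol a" and b: "right_symbol b" and p: "p \<in> Hom k"
  shows "T a (T b p) = T b (T a p)"
proof -
  have sa: "symbol a" and sb: "symbol b" using a b by (auto simp: left_symbol_def right_symbol_def)
  obtain \<alpha> where \<alpha>: "\<alpha> \<in> L2" "\<And>k p. p \<in> Hom k \<Longrightarrow> T a p \<in> Hom k"
    "\<And>k p Y. p \<in> Hom k \<Longrightarrow> (1/2) ^ k * hext k (T a p) Y = (\<integral>W. hext k p (Y ** W) * \<alpha> W \<partial>v)"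
    using toeplitz_representation[of "\<lambda>Y W. Y ** W" a] toeplitz_left[OF a] sa by (auto simp: one_sided_def)
  obtain \<beta> where \<beta>: "\<beta> \<in> L2" "\<And>k p. p \<in> Hom k \<Longrightarrow> T b p \<in> Hom k"
    "\<And>k p Y. p \<in> Hom k \<Longrightarrow> (1/2) ^ k * hext k (T b p) Y = (\<integral>W. hext k p (W ** Y) * \<beta> W \<partial>v)"
    using toeplitz_representation[of "\<lambda>Y W. W ** Y" b] toeplitz_right[OF b] sb by (auto simp: one_sided_def)
  have am: "\<alpha> \<in> borel_measurable v" and bm: "\<beta> \<in> borel_measurable v"
    using \<alpha>(1) \<beta>(1) by (auto intro: L2_measurable)
  have ia: "integrable v (\<lambda>W. cmod (\<alpha> W))" and ib: "integrable v (\<lambda>W. cmod (\<beta> W))"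
    using \<alpha>(1) \<beta>(1) by (auto intro: integrable_norm L2_integrable)
  have swap: "(\<integral>W. (\<integral>X. hext k p (X ** Y ** W) * \<beta> X \<partial>v) * \<alpha> W \<partial>v) = (\<integral>X. (\<integral>W. hext k p (X ** Y ** W) * \<alpha> W \<partial>v) * \<beta> X \<partial>v)" for Y
  proof -
    interpret P: pair_sigma_finite v v by unfold_locales
    have cont: "continuous_on UNIV (\<lambda>x. hext k p (fst x ** Y ** snd x))"
      by (rule continuous_on_compose2[OF hext_continuous[OF p]]) (auto intro!: continuous_intros)
    have "compact ((\<lambda>x. hext k p (fst x ** Y ** snd x)) ` (closure D \<times> closure D))"
      using bounded_cartan_domain
      by (intro compact_continuous_image compact_Times) (auto intro: continuous_on_subset[OF cont])
    from compact_imp_bounded[OF this] obtain K where K: "\<And>x. x \<in> closure D \<times> closure D \<Longrightarrow> cmod (hext k p (fst x ** Y ** snd x)) \<le> K"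
      unfolding bounded_iff by blast
    have KD: "cmod (hext k p (X ** Y ** W)) \<le> K" if "X \<in> D" "W \<in> D" for X W
      using K[of "(X, W)"] that closure_subset[of D] by auto
    have hm: "(\<lambda>x. hext k p (fst x ** Y ** snd x)) \<in> borel_measurable (v \<Otimes>\<^sub>M v)"
    proof -
      have "(\<lambda>x. hext k p (fst x ** Y ** snd x)) \<in> borel_measurable (borel \<Otimes>\<^sub>M borel)"
        using borel_measurable_continuous_onI[OF cont] by (simp add: borel_prod)
      moreover have "(\<lambda>x. x) \<in> v \<Otimes>\<^sub>M v \<rightarrow>\<^sub>M borel \<Otimes>\<^sub>M (borel :: 'n cmat measure)"
      proof -
        have id: "(\<lambda>W. W) \<in> v \<rightarrow>\<^sub>M borel" by (rule borel_imp_v) simp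
        have "(\<lambda>x. (fst x, snd x)) \<in> v \<Otimes>\<^sub>M v \<rightarrow>\<^sub>M borel \<Otimes>\<^sub>M (borel :: 'n cmat measure)"
          by (intro measurable_Pair measurable_compose[OF measurable_fst id] measurable_compose[OF measurable_snd id])
        then show ?thesis by simp
      qed
      ultimately show ?thesis using measurable_compose by fastforce
    qed
    have fm: "(\<lambda>x. \<beta> (fst x)) \<in> borel_measurable (v \<Otimes>\<^sub>M v)" "(\<lambda>x. \<alpha> (snd x)) \<in> borel_measurable (v \<Otimes>\<^sub>M v)"
      using measurable_compose[OF measurable_fst bm] measurable_compose[OF measurable_snd am] by auto
    let ?f = "\<lambda>(X, W). hext k p (X ** Y ** W) * \<beta> X * \<alpha> W"
    have fmeas [measurable]: "?f \<in> borel_measurable (v \<Otimes>\<^sub>M v)"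
      unfolding case_prod_beta by (intro borel_measurable_times hm fm)
    have bd: "cmod (?f (X, W)) \<le> K * cmod (\<beta> X) * cmod (\<alpha> W)" if "X \<in> D" "W \<in> D" for X W
      using KD[OF that] by (simp add: norm_mult mult_right_mono)
    have isl: "integrable v (\<lambda>W. ?f (X, W))" if X: "X \<in> D" for X
    proof (rule Bochner_Integration.integrable_bound)
      show "integrable v (\<lambda>W. K * cmod (\<beta> X) * cmod (\<alpha> W))" using ia by simp
      show "(\<lambda>W. ?f (X, W)) \<in> borel_measurable v"
        using X by (intro measurable_Pair2[OF fmeas]) simp
      show "AE W in v. norm (?f (X, W)) \<le> norm (K * cmod (\<beta> X) * cmod (\<alpha> W))"
        using bd[OF X] by (intro AE_I2) (auto intro: order_trans[OF _ abs_ge_self])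
    qed
    have int: "integrable (v \<Otimes>\<^sub>M v) ?f"
    proof (rule P.Fubini_integrable[OF fmeas])
      show "AE X in v. integrable v (\<lambda>W. ?f (X, W))"
        using isl by (intro AE_I2) simp
      show "integrable v (\<lambda>X. \<integral>W. norm (?f (X, W)) \<partial>v)"
      proof (rule Bochner_Integration.integrable_bound)
        show "integrable v (\<lambda>X. K * cmod (\<beta> X) * (\<integral>W. cmod (\<alpha> W) \<partial>v))" using ib by simp
        show "(\<lambda>X. \<integral>W. norm (?f (X, W)) \<partial>v) \<in> borel_measurable v"
          by (rule v.borel_measurable_lebesgue_integral) measurable
        have "(\<integral>W. norm (?f (X, W)) \<partial>v) \<le> K * cmod (\<beta> X) * (\<integral>W. cmod (\<alpha> W) \<partial>v)" if X: "X \<in> D" for X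
        proof -
          have "(\<integral>W. norm (?f (X, W)) \<partial>v) \<le> (\<integral>W. K * cmod (\<beta> X) * cmod (\<alpha> W) \<partial>v)"
            using bd[OF X] ia by (intro Bochner_Integration.integral_mono integrable_norm isl X) auto
          then show ?thesis by simp
        qed
        then show "AE X in v. norm (\<integral>W. norm (?f (X, W)) \<partial>v) \<le> norm (K * cmod (\<beta> X) * (\<integral>W. cmod (\<alpha> W) \<partial>v))"
          by (intro AE_I2) (auto intro: order_trans[OF _ abs_ge_self])
      qed
    qed
    have "(\<integral>W. (\<integral>X. hext k p (X ** Y ** W) * \<beta> X * \<alpha> W \<partial>v) \<partial>v) = (\<integral>X. (\<integral>W. hext k p (X ** Y ** W) * \<beta> X * \<alpha> W \<partial>v) \<partial>v)"
      by (rule P.Fubini_integral[OF int])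
    moreover have "(\<integral>W. hext k p (X ** Y ** W) * \<beta> X * \<alpha> W \<partial>v) = (\<integral>W. hext k p (X ** Y ** W) * \<alpha> W \<partial>v) * \<beta> X" for X
      by (subst integral_mult_left_zero[symmetric]) (simp only: mult_ac)
    moreover have "(\<integral>X. hext k p (X ** Y ** W) * \<beta> X * \<alpha> W \<partial>v) = (\<integral>X. hext k p (X ** Y ** W) * \<beta> X \<partial>v) * \<alpha> W" for W
      by (rule integral_mult_left_zero)
    ultimately show ?thesis by simp
  qed
  have ext: "hext k (T a (T b p)) Y = hext k (T b (T a p)) Y" for Y
  proof -
    have "(1/2) ^ k * ((1/2) ^ k * hext k (T a (T b p)) Y) = (\<integral>W. ((1/2) ^ k * hext k (T b p) (Y ** W)) * \<alpha> W \<partial>v)"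
      unfolding \<alpha>(3)[OF \<beta>(2)[OF p]] integral_mult_right_zero[symmetric] by (simp add: mult.assoc)
    also have "\<dots> = (\<integral>W. (\<integral>X. hext k p (X ** Y ** W) * \<beta> X \<partial>v) * \<alpha> W \<partial>v)"
      by (simp only: \<beta>(3)[OF p] matrix_mul_assoc)
    also have "\<dots> = (\<integral>X. (\<integral>W. hext k p (X ** Y ** W) * \<alpha> W \<partial>v) * \<beta> X \<partial>v)"
      by (rule swap)
    also have "\<dots> = (\<integral>X. ((1/2) ^ k * hext k (T a p) (X ** Y)) * \<beta> X \<partial>v)"
      by (simp only: \<alpha>(3)[OF p])
    also have "\<dots> = (1/2) ^ k * ((1/2) ^ k * hext k (T b (T a p)) Y)"
      unfolding \<beta>(3)[OF \<alpha>(2)[OF p]] integral_mult_right_zero[symmetric] by (simp add: mult.assoc)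
    finally show ?thesis by simp
  qed
  show ?thesis
  proof
    fix Z
    have 1: "T a (T b p) \<in> Hom k" "T b (T a p) \<in> Hom k"
      using \<alpha>(2) \<beta>(2) p by auto
    show "T a (T b p) Z = T b (T a p) Z"
    proof (cases "Z \<in> D")
      case True
      then show ?thesis using ext[of Z] hext_on_D 1 by metis
    next
      case False
      then show ?thesis using H_zero Hom_H 1 by metis
    qed
  qed
qed

text \<open>The commutator is moved to the other side of the inner product with a homogeneous function, where it becomes the
  commutator of the Toeplitz operators with conjugate symbols and vanishes by \<open>commute_on_Hom\<close>.\<close>

lemma toeplitz_commute:
  assumes a: "left_symbol a" and b: "right_symbol b" and f: "f \<in> H"
  shows "T a (T b f) = T b (T a f)"
proof -
  have sa: "symbol a" and sb: "symbol b" using a b by (auto simp: left_symbol_def right_symbol_def)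
  let ?a = "\<lambda>Z. cnj (a Z)" and ?b = "\<lambda>Z. cnj (b Z)"
  have sa': "symbol ?a" and sb': "symbol ?b" using sa sb by (auto intro: symbol_cnj)
  let ?u = "\<lambda>Z. T a (T b f) Z - T b (T a f) Z"
  have H1: "T a (T b f) \<in> H" "T b (T a f) \<in> H" using sa sb f by (auto intro: toeplitz_H)
  have "?u = (\<lambda>Z. 0)"
  proof (rule homogeneous_dense)
    show "?u \<in> H" using H1 by (rule H_diff)
    fix k p assume p: "p \<in> Hom k"
    have pH: "p \<in> H" using p by (rule Hom_H)
    have "inner2 (T a (T b f)) p = inner2 f (T ?b (T ?a p))"
      using sa sb sa' f pH by (simp add: toeplitz_adjoint toeplitz_H)
    also have "T ?b (T ?a p) = T ?a (T ?b p)"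
      using commute_on_Hom[OF left_symbol_cnj[OF a] right_symbol_cnj[OF b] p] by simp
    also have "inner2 f (T ?a (T ?b p)) = inner2 (T b (T a f)) p"
      using sa sb sb' f pH by (simp add: toeplitz_adjoint toeplitz_H)
    finally show "inner2 ?u p = 0"
      using inner2_diff_left[OF H_L2[OF H1(1)] H_L2[OF H1(2)] H_L2[OF pH]] by simp
  qed
  then show ?thesis by (simp add: fun_eq_iff)
qed

section \<open>Commutants are unital Banach algebras\<close>

abbreviation B :: "'n operator set" where "B \<equiv> bounded_ops lam"

lemma B_iff:
  "S \<in> B \<longleftrightarrow> S \<in> H \<rightarrow>\<^sub>E H \<and> (\<forall>f\<in>H. \<forall>g\<in>H. S (\<lambda>Z. f Z + g Z) = (\<lambda>Z. S f Z + S g Z)) \<and>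
     (\<forall>c. \<forall>f\<in>H. S (\<lambda>Z. c * f Z) = (\<lambda>Z. c * S f Z)) \<and> (\<exists>K. \<forall>f\<in>H. nsq (S f) \<le> K * nsq f)"
proof -
  have "(\<exists>C. \<forall>f\<in>H. L2_norm lam (S f) \<le> C * L2_norm lam f) \<longleftrightarrow> (\<exists>K. \<forall>f\<in>H. nsq (S f) \<le> K * nsq f)"
  proof
    assume "\<exists>C. \<forall>f\<in>H. L2_norm lam (S f) \<le> C * L2_norm lam f"
    then obtain C where C: "\<And>f. f \<in> H \<Longrightarrow> L2_norm lam (S f) \<le> C * L2_norm lam f" by blast
    have "nsq (S f) \<le> C\<^sup>2 * nsq f" if "f \<in> H" for f
    proof -
      have "(L2_norm lam (S f))\<^sup>2 \<le> (C * L2_norm lam f)\<^sup>2"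
        using C[OF that] by (intro power_mono) (simp_all add: L2_norm_nsq(1))
      then show ?thesis by (simp add: power_mult_distrib L2_norm_nsq(2))
    qed
    then show "\<exists>K. \<forall>f\<in>H. nsq (S f) \<le> K * nsq f" by blast
  next
    assume "\<exists>K. \<forall>f\<in>H. nsq (S f) \<le> K * nsq f"
    then obtain K where "\<And>f. f \<in> H \<Longrightarrow> nsq (S f) \<le> K * nsq f" by blast
    then have "L2_norm lam (S f) \<le> sqrt K * L2_norm lam f" if "f \<in> H" for f
      using that unfolding L2_norm_nsq(1) real_sqrt_mult[symmetric] by simp
    then show "\<exists>C. \<forall>f\<in>H. L2_norm lam (S f) \<le> C * L2_norm lam f" by blast
  qed
  then show ?thesis unfolding bounded_ops_def by simp
qed

lemma B_H: "S \<in> B \<Longrightarrow> f \<in> H \<Longrightarrow> S f \<in> H"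
  by (auto simp: B_iff)

lemma B_add: "S \<in> B \<Longrightarrow> f \<in> H \<Longrightarrow> g \<in> H \<Longrightarrow> S (\<lambda>Z. f Z + g Z) = (\<lambda>Z. S f Z + S g Z)"
  and B_scale: "S \<in> B \<Longrightarrow> f \<in> H \<Longrightarrow> S (\<lambda>Z. c * f Z) = (\<lambda>Z. c * S f Z)"
  by (auto simp: B_iff)

lemma B_diff:
  assumes "S \<in> B" "f \<in> H" "g \<in> H" shows "S (\<lambda>Z. f Z - g Z) = (\<lambda>Z. S f Z - S g Z)"
  using B_add[OF assms(1,2) H_scale[OF assms(3)], of "-1"] B_scale[OF assms(1,3), of "-1"] by simp

lemma B_bound:
  assumes "S \<in> B" obtains K where "K \<ge> 0" "\<And>f. f \<in> H \<Longrightarrow> nsq (S f) \<le> K * nsq f"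
proof -
  obtain K where K: "\<And>f. f \<in> H \<Longrightarrow> nsq (S f) \<le> K * nsq f" using assms unfolding B_iff by blast
  have "nsq (S f) \<le> \<bar>K\<bar> * nsq f" if "f \<in> H" for f
    using K[OF that] mult_right_mono[OF abs_ge_self nsq_nonneg, of K f] by linarith
  then show thesis using that[of "\<bar>K\<bar>"] by simp
qed

lemma BI:
  assumes "\<And>f. f \<in> H \<Longrightarrow> S f \<in> H" "\<And>f. f \<notin> H \<Longrightarrow> S f = undefined"
    and "\<And>f g. f \<in> H \<Longrightarrow> g \<in> H \<Longrightarrow> S (\<lambda>Z. f Z + g Z) = (\<lambda>Z. S f Z + S g Z)"
    and "\<And>c f. f \<in> H \<Longrightarrow> S (\<lambda>Z. c * f Z) = (\<lambda>Z. c * S f Z)"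
    and "\<And>f. f \<in> H \<Longrightarrow> nsq (S f) \<le> K * nsq f"
  shows "S \<in> B"
  unfolding B_iff using assms by (intro conjI exI[of _ K]) (auto simp: PiE_iff extensional_def)

lemma op_simps:
  "f \<in> H \<Longrightarrow> op_id lam f = f" "f \<notin> H \<Longrightarrow> op_id lam f = undefined"
  "f \<in> H \<Longrightarrow> op_add lam S R f = (\<lambda>Z. S f Z + R f Z)" "f \<notin> H \<Longrightarrow> op_add lam S R f = undefined"
  "f \<in> H \<Longrightarrow> op_diff lam S R f = (\<lambda>Z. S f Z - R f Z)" "f \<notin> H \<Longrightarrow> op_diff lam S R f = undefined"
  "f \<in> H \<Longrightarrow> op_scale lam c S f = (\<lambda>Z. c * S f Z)" "f \<notin> H \<Longrightarrow> op_scale lam c S f = undefined"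
  "f \<in> H \<Longrightarrow> op_mult lam S R f = S (R f)" "f \<notin> H \<Longrightarrow> op_mult lam S R f = undefined"
  by (auto simp: op_id_def op_add_def op_diff_def op_scale_def op_mult_def compose_def)

lemma op_id_B: "op_id lam \<in> B"
  by (rule BI[of _ 1]) (auto simp: op_simps H_add H_scale)

lemma op_scale_B: assumes "S \<in> B" shows "op_scale lam c S \<in> B"
proof -
  obtain K where K: "K \<ge> 0" "\<And>f. f \<in> H \<Longrightarrow> nsq (S f) \<le> K * nsq f" using B_bound[OF assms] by blast
  show ?thesis
  proof (rule BI[of _ "(cmod c)\<^sup>2 * K"])
    fix f assume f: "f \<in> H"
    show "nsq (op_scale lam c S f) \<le> (cmod c)\<^sup>2 * K * nsq f"
      using K(2)[OF f] f by (simp add: op_simps nsq_scale mult.assoc mult_left_mono)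
  qed (auto simp: op_simps H_add H_scale B_H[OF assms] B_add[OF assms] B_scale[OF assms] algebra_simps)
qed

lemma op_add_B: assumes "S \<in> B" "R \<in> B" shows "op_add lam S R \<in> B"
proof -
  obtain K where K: "K \<ge> 0" "\<And>f. f \<in> H \<Longrightarrow> nsq (S f) \<le> K * nsq f" using B_bound[OF assms(1)] by blast
  obtain L where L: "L \<ge> 0" "\<And>f. f \<in> H \<Longrightarrow> nsq (R f) \<le> L * nsq f" using B_bound[OF assms(2)] by blast
  show ?thesis
  proof (rule BI[of _ "2 * K + 2 * L"])
    fix f assume f: "f \<in> H"
    have "nsq (\<lambda>Z. S f Z + R f Z) \<le> 2 * nsq (S f) + 2 * nsq (R f)"
      by (rule nsq_add_le[OF H_L2[OF B_H[OF assms(1) f]] H_L2[OF B_H[OF assms(2) f]]])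
    also have "\<dots> \<le> (2 * K + 2 * L) * nsq f"
      using K(2)[OF f] L(2)[OF f] by (simp add: algebra_simps)
    finally show "nsq (op_add lam S R f) \<le> (2 * K + 2 * L) * nsq f" using f by (simp add: op_simps)
  qed (auto simp: op_simps H_add H_scale B_H[OF assms(1)] B_H[OF assms(2)] B_add[OF assms(1)] B_add[OF assms(2)]
      B_scale[OF assms(1)] B_scale[OF assms(2)] algebra_simps)
qed

lemma op_diff_B: assumes "S \<in> B" "R \<in> B" shows "op_diff lam S R \<in> B"
proof -
  have "op_diff lam S R = op_add lam S (op_scale lam (-1) R)"
    by (rule ext) (simp add: op_diff_def op_add_def op_scale_def)
  then show ?thesis using op_add_B[OF assms(1) op_scale_B[OF assms(2)]] by simp
qed

lemma op_mult_B: assumes "S \<in> B" "R \<in> B" shows "op_mult lam S R \<in> B"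
proof -
  obtain K where K: "K \<ge> 0" "\<And>f. f \<in> H \<Longrightarrow> nsq (S f) \<le> K * nsq f" using B_bound[OF assms(1)] by blast
  obtain L where L: "L \<ge> 0" "\<And>f. f \<in> H \<Longrightarrow> nsq (R f) \<le> L * nsq f" using B_bound[OF assms(2)] by blast
  show ?thesis
  proof (rule BI[of _ "K * L"])
    fix f assume f: "f \<in> H"
    have "nsq (S (R f)) \<le> K * nsq (R f)" using K(2) B_H[OF assms(2) f] by blast
    also have "\<dots> \<le> K * (L * nsq f)" using L(2)[OF f] K(1) by (rule mult_left_mono)
    finally show "nsq (op_mult lam S R f) \<le> K * L * nsq f" using f by (simp add: op_simps mult.assoc)
  qed (auto simp: op_simps H_add H_scale B_H[OF assms(1)] B_H[OF assms(2)] B_add[OF assms(1)] B_add[OF assms(2)]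
      B_scale[OF assms(1)] B_scale[OF assms(2)])
qed

lemma op_norm_bound:
  assumes S: "S \<in> B" and f: "f \<in> H" shows "nsq (S f) \<le> (op_norm lam S)\<^sup>2 * nsq f"
proof -
  obtain K where K: "K \<ge> 0" "\<And>f. f \<in> H \<Longrightarrow> nsq (S f) \<le> K * nsq f" using B_bound[OF S] by blast
  let ?A = "{f \<in> H. L2_norm lam f \<le> 1}"
  have bdd: "bdd_above ((\<lambda>f. L2_norm lam (S f)) ` ?A)"
  proof (rule bdd_aboveI2)
    fix f assume "f \<in> ?A"
    then have f: "f \<in> H" "nsq f \<le> 1" by (auto simp: L2_norm_nsq(1))
    have "nsq (S f) \<le> K * 1"
      using K(2)[OF f(1)] mult_left_mono[OF f(2) K(1)] by linarith
    then show "L2_norm lam (S f) \<le> sqrt K" by (simp add: L2_norm_nsq(1))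
  qed
  show ?thesis
  proof (cases "nsq f = 0")
    case True
    then show ?thesis using K(2)[OF f] by simp
  next
    case False
    then have n: "nsq f > 0" using nsq_nonneg[of f] by linarith
    define c where "c = complex_of_real (1 / sqrt (nsq f))"
    have c: "(cmod c)\<^sup>2 = 1 / nsq f" using n by (simp add: c_def norm_divide power_divide)
    let ?g = "\<lambda>Z. c * f Z"
    have "?g \<in> ?A"
      using H_scale[OF f, of c] n by (simp add: L2_norm_nsq(1) nsq_scale c)
    then have "L2_norm lam (S ?g) \<le> op_norm lam S"
      unfolding op_norm_def using bdd by (intro cSUP_upper)
    then have "nsq (S ?g) \<le> (op_norm lam S)\<^sup>2"
      using power_mono[of "L2_norm lam (S ?g)" "op_norm lam S" 2] by (simp add: L2_norm_nsq)
    moreover have "nsq (S ?g) = nsq (S f) / nsq f"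
      by (simp add: B_scale[OF S f] nsq_scale c)
    ultimately show ?thesis using n by (simp add: field_simps)
  qed
qed

lemma op_mult_commute_iff: "op_mult lam S R = op_mult lam R S \<longleftrightarrow> (\<forall>f\<in>H. S (R f) = R (S f))"
  unfolding op_mult_def compose_def restrict_def fun_eq_iff by auto

text \<open>Closedness is the only point that is not algebra: if \<open>X\<^sub>k \<rightarrow> Q\<close> in norm and every \<open>X\<^sub>k\<close> commutes with \<open>R\<close>, then
  \<open>R Q f - Q R f\<close> equals \<open>(X\<^sub>k - Q) R f - R (X\<^sub>k - Q) f\<close>, which tends to 0.\<close>

lemma commutant_algebra:
  assumes C: "C \<subseteq> B"
  shows "unital_banach_algebra lam {S \<in> B. \<forall>R\<in>C. op_mult lam S R = op_mult lam R S}"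
  unfolding unital_banach_algebra_def op_mult_commute_iff
proof (intro conjI ballI allI impI)
  let ?A = "{S \<in> B. \<forall>R\<in>C. \<forall>f\<in>H. S (R f) = R (S f)}"
  have CH: "R f \<in> H" if "R \<in> C" "f \<in> H" for R f using C that B_H by blast
  show "?A \<subseteq> B" by blast
  show "op_id lam \<in> ?A" using op_id_B CH by (auto simp: op_simps)
  fix S Q assume "S \<in> ?A" "Q \<in> ?A"
  then have S: "S \<in> B" "\<And>R f. R \<in> C \<Longrightarrow> f \<in> H \<Longrightarrow> S (R f) = R (S f)"
    and Q: "Q \<in> B" "\<And>R f. R \<in> C \<Longrightarrow> f \<in> H \<Longrightarrow> Q (R f) = R (Q f)" by auto
  have "op_add lam S Q (R f) = R (op_add lam S Q f)" if "R \<in> C" "f \<in> H" for R f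
  proof -
    have "R \<in> B" using C that(1) by blast
    from B_add[OF this B_H[OF S(1) that(2)] B_H[OF Q(1) that(2)]] show ?thesis
      using S(2)[OF that] Q(2)[OF that] CH[OF that] that by (simp add: op_simps)
  qed
  then show "op_add lam S Q \<in> ?A"
    using op_add_B[OF S(1) Q(1)] by blast
  have "op_mult lam S Q (R f) = R (op_mult lam S Q f)" if "R \<in> C" "f \<in> H" for R f
    using S(2)[OF that(1) B_H[OF Q(1) that(2)]] Q(2)[OF that] CH[OF that] that by (simp add: op_simps)
  then show "op_mult lam S Q \<in> ?A"
    using op_mult_B[OF S(1) Q(1)] by blast
next
  let ?A = "{S \<in> B. \<forall>R\<in>C. \<forall>f\<in>H. S (R f) = R (S f)}"
  have CH: "R f \<in> H" if "R \<in> C" "f \<in> H" for R f using C that B_H by blast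
  fix c S assume "S \<in> ?A"
  then have S: "S \<in> B" "\<And>R f. R \<in> C \<Longrightarrow> f \<in> H \<Longrightarrow> S (R f) = R (S f)" by auto
  have "op_scale lam c S (R f) = R (op_scale lam c S f)" if "R \<in> C" "f \<in> H" for R f
  proof -
    have "R \<in> B" using C that(1) by blast
    from B_scale[OF this B_H[OF S(1) that(2)]] show ?thesis
      using S(2)[OF that] CH[OF that] that by (simp add: op_simps)
  qed
  then show "op_scale lam c S \<in> ?A"
    using op_scale_B[OF S(1)] by blast
next
  let ?A = "{S \<in> B. \<forall>R\<in>C. \<forall>f\<in>H. S (R f) = R (S f)}"
  fix X :: "nat \<Rightarrow> 'n operator" and Q :: "'n operator"
  assume Q: "Q \<in> B" and X: "\<forall>k. X k \<in> ?A" and lim: "(\<lambda>k. op_norm lam (op_diff lam (X k) Q)) \<longlonglongrightarrow> 0"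
  have "Q (R f) = R (Q f)" if R: "R \<in> C" and f: "f \<in> H" for R f
  proof -
    have RB: "R \<in> B" using R C by blast
    obtain K where K: "K \<ge> 0" "\<And>f. f \<in> H \<Longrightarrow> nsq (R f) \<le> K * nsq f" using B_bound[OF RB] by blast
    have Rf: "R f \<in> H" using B_H[OF RB f] .
    define e where "e k = op_norm lam (op_diff lam (X k) Q)" for k
    let ?u = "\<lambda>Z. R (Q f) Z - Q (R f) Z"
    have u: "?u \<in> H" using B_H[OF RB B_H[OF Q f]] B_H[OF Q Rf] by (rule H_diff)
    have bound: "nsq ?u \<le> (2 * nsq (R f) + 2 * (K * nsq f)) * (e k)\<^sup>2" for k
    proof -
      have XB: "X k \<in> B" and Xc: "X k (R f) = R (X k f)" using X R f by auto
      have dB: "op_diff lam (X k) Q \<in> B" by (rule op_diff_B[OF XB Q])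
      let ?d = "\<lambda>g Z. X k g Z - Q g Z"
      have d: "?d g \<in> H \<and> nsq (?d g) \<le> (e k)\<^sup>2 * nsq g" if "g \<in> H" for g
        using op_norm_bound[OF dB that] H_diff[OF B_H[OF XB that] B_H[OF Q that]] that by (simp add: op_simps e_def)
      have eq: "?u = (\<lambda>Z. ?d (R f) Z + (-1) * R (?d f) Z)"
        using B_diff[OF RB B_H[OF XB f] B_H[OF Q f]] Xc by (simp add: fun_eq_iff)
      have "nsq ?u \<le> 2 * nsq (?d (R f)) + 2 * nsq (\<lambda>Z. (-1) * R (?d f) Z)"
        unfolding eq using d[OF Rf] d[OF f] B_H[OF RB] by (intro nsq_add_le H_L2 H_scale) auto
      also have "nsq (\<lambda>Z. (-1) * R (?d f) Z) = nsq (R (?d f))"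
        using nsq_scale[of "-1" "R (?d f)"] by simp
      also have "2 * nsq (?d (R f)) + 2 * nsq (R (?d f)) \<le> 2 * ((e k)\<^sup>2 * nsq (R f)) + 2 * (K * ((e k)\<^sup>2 * nsq f))"
        using d[OF Rf] d[OF f] K(2)[of "?d f"] mult_left_mono[OF conjunct2[OF d[OF f]] K(1)] by simp
      finally show ?thesis by (simp add: algebra_simps)
    qed
    have "(\<lambda>k. (2 * nsq (R f) + 2 * (K * nsq f)) * (e k)\<^sup>2) \<longlonglongrightarrow> (2 * nsq (R f) + 2 * (K * nsq f)) * 0\<^sup>2"
      using lim unfolding e_def by (intro tendsto_intros)
    then have "nsq ?u \<le> (2 * nsq (R f) + 2 * (K * nsq f)) * 0\<^sup>2"
      by (rule LIMSEQ_le_const) (use bound in blast)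
    then have "nsq ?u = 0" using nsq_nonneg[of ?u] by simp
    from H_nsq_0[OF u this] show ?thesis by (simp add: fun_eq_iff)
  qed
  then show "Q \<in> ?A" using Q by blast
qed

text \<open>Commutants are taken twice: the generators on the left commute with the generators on the right, hence so does the whole left
  algebra, and then the generators on the right lie in the commutant of the left algebra.\<close>

lemma toeplitz_algebras_commute:
  assumes S: "S \<in> toeplitz_algebra lam (left_invariant_symbols :: ('n cmat \<Rightarrow> complex) set)"
    and R: "R \<in> toeplitz_algebra lam (right_invariant_symbols :: ('n cmat \<Rightarrow> complex) set)"
  shows "op_mult lam S R = op_mult lam R S"
proof -
  let ?L = "T ` left_invariant_symbols" and ?R = "T ` right_invariant_symbols"
  have left: "left_symbol a" if "a \<in> left_invariant_symbols" for a
    using that by (auto simp: left_invariant_symbols_def left_symbol_def Linf_symbol intro: AE_v)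
  have right: "right_symbol a" if "a \<in> right_invariant_symbols" for a
    using that by (auto simp: right_invariant_symbols_def right_symbol_def Linf_symbol intro: AE_v)
  have LB: "?L \<subseteq> B" and RB: "?R \<subseteq> B"
    using left right toeplitz_bounded_ops by (auto simp: left_symbol_def right_symbol_def)
  let ?C = "\<lambda>X. {S \<in> B. \<forall>R\<in>X. op_mult lam S R = op_mult lam R S}"
  have "?L \<subseteq> ?C ?R"
    using LB by (auto simp: op_mult_commute_iff intro!: toeplitz_commute left right)
  then have 1: "toeplitz_algebra lam left_invariant_symbols \<subseteq> ?C ?R"
    unfolding toeplitz_algebra_def using commutant_algebra[OF RB] by (rule hull_minimal)
  then have "toeplitz_algebra lam left_invariant_symbols \<subseteq> B" by blast
  note alg = commutant_algebra[OF this]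
  have "?R \<subseteq> ?C (toeplitz_algebra lam left_invariant_symbols)"
  proof
    fix Q assume Q: "Q \<in> ?R"
    then have "op_mult lam P Q = op_mult lam Q P" if "P \<in> toeplitz_algebra lam left_invariant_symbols" for P
      using 1 that by blast
    then show "Q \<in> ?C (toeplitz_algebra lam left_invariant_symbols)"
      using Q RB by auto
  qed
  then have "toeplitz_algebra lam right_invariant_symbols \<subseteq> ?C (toeplitz_algebra lam left_invariant_symbols)"
    unfolding toeplitz_algebra_def[of lam right_invariant_symbols] using alg by (rule hull_minimal)
  then have "op_mult lam R S = op_mult lam S R" using S R by blast
  then show ?thesis by simp
qed

end

theorem theorem4p19:
  fixes lam :: real
  assumes "lam > 2 * real CARD('n::finite) - 1"
  shows "\<forall>S \<in> toeplitz_algebra lam (left_invariant_symbols :: ('n cmat \<Rightarrow> complex) set).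
         \<forall>T \<in> toeplitz_algebra lam (right_invariant_symbols :: ('n cmat \<Rightarrow> complex) set).
           op_mult lam S T = op_mult lam T S"
proof -
  interpret weighted_bergman lam "TYPE('n)"
    by unfold_locales (rule assms)
  show ?thesis using toeplitz_algebras_commute by blast
qed

end
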